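(* Let $\mathcal{U}$ be a Hopf algebra over $k$ with dual Hopf algebra $\mathcal{U}^*$, let $\mathcal{H}\subset\mathcal{U}$ be a Hopf subalgebra, and let $\mathcal{L}$ be an $\mathcal{H}$-base algebra. Then the algebra $\mathcal{U}^*\ltimes(\mathcal{L}\otimes\mathcal{L}_{op})$ is a right bialgebroid over the base $\mathcal{L}$ with the target map $t:\lambda\mapsto1\otimes1\otimes\iota(\lambda)$, the source map $s:\lambda\mapsto1\otimes\lambda\otimes1$, the coproduct $$\Delta(u\otimes\lambda\otimes\mu):=(u^{(1)}\otimes1\otimes\mu)\otimes_{\mathcal{L}}(u^{(2)}\otimes\lambda\otimes1),$$ and the counit $\varepsilon(u\otimes\lambda\otimes\mu):=\varepsilon_{\mathcal{U}^*}(u)\,\iota^{-1}(\mu)\lambda$.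
   Context: $k$ is a field of characteristic zero (or a ring of formal power series over such a field); algebras are associative unital $k$-algebras, $\otimes=\otimes_k$; Hopf algebras have invertible antipode $\gamma$. $\mathcal{U}^*$ is a Hopf algebra with a non-degenerate Hopf pairing $\langle\cdot,\cdot\rangle$ with $\mathcal{U}$. $\mathcal{L}_{op}$ is the opposite algebra, with multiplication denoted $\cdot$, and $\iota:\mathcal{L}\to\mathcal{L}_{op}$ is the identity map. **Base algebra.** An $\mathcal{H}$-base algebra is an algebra $\mathcal{L}$ that is a left $\mathcal{H}$-module algebra (action $\triangleright$) and a left $\mathcal{H}$-comodule algebra with coaction $\delta(\lambda)=\lambda^{(1)}\otimes\lambda^{[2]}\in\mathcal{H}\otimes\mathcal{L}$ such that $\delta(h\triangleright\lambda)=h^{(1)}\lambda^{(1)}\gamma(h^{(3)})\otimes h^{(2)}\triangleright\lambda^{[2]}$ and $\lambda\mu=(\lambda^{(1)}\triangleright\mu)\lambda^{[2]}$. Then $\mathcal{L}_{op}$ is an $\mathcal{H}_{op}$-base algebra with action $x\blacktriangleright\lambda=\gamma^{-1}(x)\triangleright\lambda$ and the same coaction $\mu\mapsto\mu^{(1)}\otimes\mu^{[2]}$. **The algebra $\mathcal{U}^*\ltimes(\mathcal{L}\otimes\mathcal{L}_{op})$.** $\mathcal{U}$ and $\mathcal{U}_{op}$ act on $\mathcal{U}^*$ by $x\triangleright u=u^{(1)}\langle x,u^{(2)}\rangle$ and $y\blacktriangleright u=\langle y,u^{(1)}\rangle u^{(2)}$. On the vector space $\mathcal{U}^*\otimes\mathcal{L}\otimes\mathcal{L}_{op}$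 the associative multiplication is $$(u\otimes\lambda\otimes\mu)(v\otimes\alpha\otimes\beta)=u\,\bigl(\lambda^{(1)}\triangleright\mu^{(1)}\blacktriangleright v\bigr)\otimes\lambda^{[2]}\alpha\otimes\mu^{[2]}\cdot\beta .$$ **Right bialgebroid.** A right $\mathcal{L}$-bialgebroid is an algebra $B$ with an algebra homomorphism $s:\mathcal{L}\to B$ and an algebra anti-homomorphism $t:\mathcal{L}\to B$ with commuting images, so that $B$ is an $\mathcal{L}$-bimodule by right multiplication, $\lambda\cdot a=a\,t(\lambda)$, $a\cdot\lambda=a\,s(\lambda)$ (so $a\,s(\lambda)\otimes_{\mathcal{L}}b=a\otimes_{\mathcal{L}}b\,t(\lambda)$); a coassociative bimodule map $\Delta:B\to B\otimes_{\mathcal{L}}B$ which is an algebra homomorphism into the algebra $\{z\in B\otimes_{\mathcal{L}}B:(s(\lambda)\otimes1)z=(1\otimes t(\lambda))z\ \forall\lambda\in\mathcal{L}\}$; and a bimodule map $\varepsilon:B\to\mathcal{L}$ with $\varepsilon(1)=1$, $\varepsilon(s(\varepsilon(a))b)=\varepsilon(ab)=\varepsilon(t(\varepsilon(a))b)$ and $(\varepsilon\otimes_{\mathcal{L}}\mathrm{id})\Delta=\mathrm{id}=(\mathrm{id}\otimes_{\mathcal{L}}\varepsilon)\Delta$. *)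

theory Defs
  imports "HOL-Algebra.Free_Abelian_Groups" "HOL-Algebra.QuotRing" "HOL-Algebra.Module"
begin

section \<open>The ground ring\<close>

definition char_zero_field :: "'k ring \<Rightarrow> bool" where
  "char_zero_field K \<longleftrightarrow>
     field K \<and> (\<forall>n::nat. 0 < n \<longrightarrow> [n] \<cdot>\<^bsub>K\<^esub> \<one>\<^bsub>K\<^esub> \<noteq> \<zero>\<^bsub>K\<^esub>)"

definition fps_ring :: "'k ring \<Rightarrow> (nat \<Rightarrow> 'k) ring" where
  "fps_ring F =
     \<lparr>carrier = {f. \<forall>n. f n \<in> carrier F},
      monoid.mult = (\<lambda>f g n. \<Oplus>\<^bsub>F\<^esub>i\<in>{..n}. f i \<otimes>\<^bsub>F\<^esub> g (n - i)),
      one = (\<lambda>n. if n = 0 then \<one>\<^bsub>F\<^esub> else \<zero>\<^bsub>F\<^esub>),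
      zero = (\<lambda>n. \<zero>\<^bsub>F\<^esub>),
      add = (\<lambda>f g n. f n \<oplus>\<^bsub>F\<^esub> g n)\<rparr>"

text \<open>The coefficient field embeds into its ring of power series, so it may be
  taken to live on the same type.\<close>

definition ground_ring :: "'k ring \<Rightarrow> bool" where
  "ground_ring K \<longleftrightarrow>
     char_zero_field K \<or> (\<exists>F :: 'k ring. char_zero_field F \<and> K \<simeq> fps_ring F)"


section \<open>Associative algebras\<close>

text \<open>The library locale \<^locale>\<open>algebra\<close> is restricted to commutative algebras.\<close>

locale assoc_algebra = module K A + ring A for K (structure) and A (structure) +
  assumes smult_mult_left:
      "\<lbrakk>c \<in> carrier K; x \<in> carrier A; y \<in> carrier A\<rbrakk> \<Longrightarrow>
        (c \<odot>\<^bsub>A\<^esub> x) \<otimes>\<^bsub>A\<^esub> y = c \<odot>\<^bsub>A\<^esub> (x \<otimes>\<^bsub>A\<^esub> y)"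
    and smult_mult_right:
      "\<lbrakk>c \<in> carrier K; x \<in> carrier A; y \<in> carrier A\<rbrakk> \<Longrightarrow>
        x \<otimes>\<^bsub>A\<^esub> (c \<odot>\<^bsub>A\<^esub> y) = c \<odot>\<^bsub>A\<^esub> (x \<otimes>\<^bsub>A\<^esub> y)"

definition linear_maps ::
  "('k, 'r) ring_scheme \<Rightarrow> ('k, 'm, 'x) module_scheme \<Rightarrow> ('k, 'n, 'y) module_scheme
     \<Rightarrow> ('m \<Rightarrow> 'n) set" where
  "linear_maps K M N =
     {f \<in> hom (add_monoid M) (add_monoid N).
        \<forall>c\<in>carrier K. \<forall>x\<in>carrier M. f (c \<odot>\<^bsub>M\<^esub> x) = c \<odot>\<^bsub>N\<^esub> f x}"

definition algebra_homs ::
  "('k, 'r) ring_scheme \<Rightarrow> ('k, 'm, 'x) module_scheme \<Rightarrow> ('k, 'n, 'y) module_scheme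
     \<Rightarrow> ('m \<Rightarrow> 'n) set" where
  "algebra_homs K A B = ring_hom A B \<inter> linear_maps K A B"

definition bilinear_map ::
  "('k, 'r) ring_scheme \<Rightarrow> ('k, 'm, 'x) module_scheme \<Rightarrow> ('k, 'n, 'y) module_scheme
     \<Rightarrow> ('k, 'p, 'z) module_scheme \<Rightarrow> ('m \<Rightarrow> 'n \<Rightarrow> 'p) \<Rightarrow> bool" where
  "bilinear_map K M N P f \<longleftrightarrow>
     (\<forall>m\<in>carrier M. f m \<in> linear_maps K N P) \<and>
     (\<forall>n\<in>carrier N. (\<lambda>m. f m n) \<in> linear_maps K M P)"

definition ground_algebra :: "'k ring \<Rightarrow> ('k, 'k) module" where
  "ground_algebra K = ring.extend K (module.fields (\<lambda>c x. c \<otimes>\<^bsub>K\<^esub> x))"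

text \<open>The opposite algebra has the same elements: the identity map \<open>\<iota>\<close> from an algebra to
  its opposite is not written.\<close>

definition opposite :: "('k, 'a) module \<Rightarrow> ('k, 'a) module" where
  "opposite A = A\<lparr>monoid.mult := \<lambda>x y. y \<otimes>\<^bsub>A\<^esub> x\<rparr>"


section \<open>Tensor products\<close>

text \<open>The balanced tensor product of a right module \<open>M\<close> and a left module \<open>N\<close> over the
  (possibly noncommutative) scalars \<open>S\<close>, with actions \<open>ra\<close> and \<open>la\<close>: the free abelian
  group on pairs modulo the subgroup generated by the usual relators. Its elements are
  cosets of formal integer combinations of pairs.\<close>

type_synonym ('m, 'n) tens = "('m \<times> 'n \<Rightarrow>\<^sub>0 int) set"

abbreviation formal_sums ::
  "('m, 'x) ring_scheme \<Rightarrow> ('n, 'y) ring_scheme \<Rightarrow> ('m \<times> 'n \<Rightarrow>\<^sub>0 int) monoid" where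
  "formal_sums M N \<equiv> free_Abelian_group (carrier M \<times> carrier N)"

definition tensor_relators ::
  "'s set \<Rightarrow> ('m \<Rightarrow> 's \<Rightarrow> 'm) \<Rightarrow> ('s \<Rightarrow> 'n \<Rightarrow> 'n) \<Rightarrow> ('m, 'x) ring_scheme
     \<Rightarrow> ('n, 'y) ring_scheme \<Rightarrow> ('m, 'n) tens" where
  "tensor_relators S ra la M N =
     {frag_of (m \<oplus>\<^bsub>M\<^esub> m', n) - frag_of (m, n) - frag_of (m', n) | m m' n.
        m \<in> carrier M \<and> m' \<in> carrier M \<and> n \<in> carrier N} \<union>
     {frag_of (m, n \<oplus>\<^bsub>N\<^esub> n') - frag_of (m, n) - frag_of (m, n') | m n n'.
        m \<in> carrier M \<and> n \<in> carrier N \<and> n' \<in> carrier N} \<union>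
     {frag_of (ra m r, n) - frag_of (m, la r n) | m r n.
        m \<in> carrier M \<and> r \<in> S \<and> n \<in> carrier N}"

definition tensor_null ::
  "'s set \<Rightarrow> ('m \<Rightarrow> 's \<Rightarrow> 'm) \<Rightarrow> ('s \<Rightarrow> 'n \<Rightarrow> 'n) \<Rightarrow> ('m, 'x) ring_scheme
     \<Rightarrow> ('n, 'y) ring_scheme \<Rightarrow> ('m, 'n) tens" where
  "tensor_null S ra la M N = generate (formal_sums M N) (tensor_relators S ra la M N)"

definition balanced_elem ::
  "'s set \<Rightarrow> ('m \<Rightarrow> 's \<Rightarrow> 'm) \<Rightarrow> ('s \<Rightarrow> 'n \<Rightarrow> 'n) \<Rightarrow> ('m, 'x) ring_scheme
     \<Rightarrow> ('n, 'y) ring_scheme \<Rightarrow> 'm \<Rightarrow> 'n \<Rightarrow> ('m, 'n) tens" where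
  "balanced_elem S ra la M N m n =
     tensor_null S ra la M N #>\<^bsub>formal_sums M N\<^esub> frag_of (m, n)"

text \<open>The additive map out of a tensor product which sends \<open>m \<otimes> n\<close> to \<open>f m n\<close>. It is
  meaningful when \<open>f\<close> is balanced, for then all representatives of the coset \<open>X\<close> yield the
  same value. In Sweedler notation \<open>tensor_lift G (\<lambda>x y. f x y) X\<close> is
  \<open>f (x\<^sup>(\<^sup>1\<^sup>)) (x\<^sup>(\<^sup>2\<^sup>))\<close> for \<open>X = x\<^sup>(\<^sup>1\<^sup>) \<otimes> x\<^sup>(\<^sup>2\<^sup>)\<close>.\<close>

definition group_lift ::
  "('g, 'z) monoid_scheme \<Rightarrow> ('m \<Rightarrow> 'n \<Rightarrow> 'g) \<Rightarrow> ('m, 'n) tens \<Rightarrow> 'g" where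
  "group_lift G f X =
     (THE g. \<exists>c\<in>X. g =
        (\<Otimes>\<^bsub>G\<^esub>p\<in>Poly_Mapping.keys c. f (fst p) (snd p) [^]\<^bsub>G\<^esub> Poly_Mapping.lookup c p))"

definition tensor_lift ::
  "('g, 'z) ring_scheme \<Rightarrow> ('m \<Rightarrow> 'n \<Rightarrow> 'g) \<Rightarrow> ('m, 'n) tens \<Rightarrow> 'g" where
  "tensor_lift G f X = group_lift (add_monoid G) f X"

text \<open>A tensor product as a \<open>K\<close>-module; \<open>K\<close> acts through the first factor.\<close>

definition balanced_tensor ::
  "'s set \<Rightarrow> ('m \<Rightarrow> 's \<Rightarrow> 'm) \<Rightarrow> ('s \<Rightarrow> 'n \<Rightarrow> 'n) \<Rightarrow> ('k, 'm, 'x) module_scheme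
     \<Rightarrow> ('k, 'n, 'y) module_scheme \<Rightarrow> ('k, ('m, 'n) tens) module" where
  "balanced_tensor S ra la M N =
     (let T = formal_sums M N Mod tensor_null S ra la M N in
      \<lparr>carrier = carrier T, monoid.mult = undefined, one = undefined,
       zero = \<one>\<^bsub>T\<^esub>, add = monoid.mult T,
       smult = \<lambda>c. group_lift T (\<lambda>m n. balanced_elem S ra la M N (c \<odot>\<^bsub>M\<^esub> m) n)\<rparr>)"

subsection \<open>Tensor products of algebras over the ground ring\<close>

definition tensor_elem ::
  "('k, 'r) ring_scheme \<Rightarrow> ('k, 'a, 'x) module_scheme \<Rightarrow> ('k, 'b, 'y) module_scheme
     \<Rightarrow> 'a \<Rightarrow> 'b \<Rightarrow> ('a, 'b) tens" where
  "tensor_elem K A B =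
     balanced_elem (carrier K) (\<lambda>a c. c \<odot>\<^bsub>A\<^esub> a) (\<lambda>c b. c \<odot>\<^bsub>B\<^esub> b) A B"

definition tensor_algebra ::
  "('k, 'r) ring_scheme \<Rightarrow> ('k, 'a, 'x) module_scheme \<Rightarrow> ('k, 'b, 'y) module_scheme
     \<Rightarrow> ('k, ('a, 'b) tens) module" where
  "tensor_algebra K A B =
     (let T = balanced_tensor (carrier K) (\<lambda>a c. c \<odot>\<^bsub>A\<^esub> a) (\<lambda>c b. c \<odot>\<^bsub>B\<^esub> b) A B in
      T\<lparr>monoid.mult := \<lambda>X Y.
          tensor_lift T (\<lambda>a b. tensor_lift T (\<lambda>a' b'.
            tensor_elem K A B (a \<otimes>\<^bsub>A\<^esub> a') (b \<otimes>\<^bsub>B\<^esub> b')) Y) X,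
        one := tensor_elem K A B \<one>\<^bsub>A\<^esub> \<one>\<^bsub>B\<^esub>\<rparr>)"

text \<open>The map \<open>f \<otimes> g\<close> with values in \<open>A \<otimes> B\<close>.\<close>

definition tensor_map ::
  "('k, 'r) ring_scheme \<Rightarrow> ('k, 'a, 'x) module_scheme \<Rightarrow> ('k, 'b, 'y) module_scheme
     \<Rightarrow> ('m \<Rightarrow> 'a) \<Rightarrow> ('n \<Rightarrow> 'b) \<Rightarrow> ('m, 'n) tens \<Rightarrow> ('a, 'b) tens" where
  "tensor_map K A B f g =
     tensor_lift (tensor_algebra K A B) (\<lambda>m n. tensor_elem K A B (f m) (g n))"

definition tensor_assoc ::
  "('k, 'r) ring_scheme \<Rightarrow> ('k, 'a, 'x) module_scheme \<Rightarrow> ('k, 'b, 'y) module_scheme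
     \<Rightarrow> ('k, 'c, 'z) module_scheme \<Rightarrow> (('a, 'b) tens, 'c) tens \<Rightarrow> ('a, ('b, 'c) tens) tens" where
  "tensor_assoc K A B C =
     (let BC = tensor_algebra K B C; T = tensor_algebra K A BC in
      tensor_lift T (\<lambda>X c. tensor_lift T (\<lambda>a b.
        tensor_elem K A BC a (tensor_elem K B C b c)) X))"

subsection \<open>Tensor products of bimodules\<close>

record ('l, 'k, 'm) bimod = "('k, 'm) module" +
  lsmul :: "'l \<Rightarrow> 'm \<Rightarrow> 'm"
  rsmul :: "'m \<Rightarrow> 'l \<Rightarrow> 'm"

definition regular_bimodule :: "('k, 'l) module \<Rightarrow> ('l, 'k, 'l) bimod" where
  "regular_bimodule L =
     module.extend L (bimod.fields (\<lambda>l x. l \<otimes>\<^bsub>L\<^esub> x) (\<lambda>x l. x \<otimes>\<^bsub>L\<^esub> l))"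

definition bimodule_maps ::
  "('k, 'r) ring_scheme \<Rightarrow> ('k, 'l) module \<Rightarrow> ('l, 'k, 'm) bimod \<Rightarrow> ('l, 'k, 'n) bimod
     \<Rightarrow> ('m \<Rightarrow> 'n) set" where
  "bimodule_maps K L M N =
     {f \<in> linear_maps K M N. \<forall>l\<in>carrier L. \<forall>m\<in>carrier M.
        f (lsmul M l m) = lsmul N l (f m) \<and> f (rsmul M m l) = rsmul N (f m) l}"

definition bimod_elem ::
  "('k, 'l) module \<Rightarrow> ('l, 'k, 'm) bimod \<Rightarrow> ('l, 'k, 'n) bimod \<Rightarrow> 'm \<Rightarrow> 'n
     \<Rightarrow> ('m, 'n) tens" where
  "bimod_elem L M N = balanced_elem (carrier L) (rsmul M) (lsmul N) M N"

definition bimod_tensor ::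
  "('k, 'l) module \<Rightarrow> ('l, 'k, 'm) bimod \<Rightarrow> ('l, 'k, 'n) bimod
     \<Rightarrow> ('l, 'k, ('m, 'n) tens) bimod" where
  "bimod_tensor L M N =
     (let T = balanced_tensor (carrier L) (rsmul M) (lsmul N) M N in
      module.extend T (bimod.fields
        (\<lambda>l. tensor_lift T (\<lambda>m n. bimod_elem L M N (lsmul M l m) n))
        (\<lambda>X l. tensor_lift T (\<lambda>m n. bimod_elem L M N m (rsmul N n l)) X)))"

definition bimod_tensor_map ::
  "('k, 'l) module \<Rightarrow> ('l, 'k, 'a) bimod \<Rightarrow> ('l, 'k, 'b) bimod
     \<Rightarrow> ('m \<Rightarrow> 'a) \<Rightarrow> ('n \<Rightarrow> 'b) \<Rightarrow> ('m, 'n) tens \<Rightarrow> ('a, 'b) tens" where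
  "bimod_tensor_map L M N f g =
     tensor_lift (bimod_tensor L M N) (\<lambda>m n. bimod_elem L M N (f m) (g n))"

definition bimod_assoc ::
  "('k, 'l) module \<Rightarrow> ('l, 'k, 'm) bimod \<Rightarrow> ('l, 'k, 'n) bimod \<Rightarrow> ('l, 'k, 'p) bimod
     \<Rightarrow> (('m, 'n) tens, 'p) tens \<Rightarrow> ('m, ('n, 'p) tens) tens" where
  "bimod_assoc L M N P =
     (let NP = bimod_tensor L N P; T = bimod_tensor L M NP in
      tensor_lift T (\<lambda>X p. tensor_lift T (\<lambda>m n.
        bimod_elem L M NP m (bimod_elem L N P n p)) X))"


section \<open>Hopf algebras\<close>

record ('k, 'a) hopf = "('k, 'a) module" +
  comult :: "'a \<Rightarrow> ('a, 'a) tens"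
  counit :: "'a \<Rightarrow> 'k"
  antipode :: "'a \<Rightarrow> 'a"

locale hopf_algebra =
  fixes K :: "'k ring" and A :: "('k, 'a) hopf"
  assumes assoc_algebra: "assoc_algebra K A"
    and comult_hom: "comult A \<in> algebra_homs K A (tensor_algebra K A A)"
    and counit_hom: "counit A \<in> algebra_homs K A (ground_algebra K)"
    and coassoc: "x \<in> carrier A \<Longrightarrow>
      tensor_assoc K A A A (tensor_map K (tensor_algebra K A A) A (comult A) id (comult A x)) =
      tensor_map K A (tensor_algebra K A A) id (comult A) (comult A x)"
    and counit_left: "x \<in> carrier A \<Longrightarrow>
      tensor_lift A (\<lambda>y z. counit A y \<odot>\<^bsub>A\<^esub> z) (comult A x) = x"
    and counit_right: "x \<in> carrier A \<Longrightarrow>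
      tensor_lift A (\<lambda>y z. counit A z \<odot>\<^bsub>A\<^esub> y) (comult A x) = x"
    and antipode_linear: "antipode A \<in> linear_maps K A A"
    and antipode_left: "x \<in> carrier A \<Longrightarrow>
      tensor_lift A (\<lambda>y z. antipode A y \<otimes>\<^bsub>A\<^esub> z) (comult A x) = counit A x \<odot>\<^bsub>A\<^esub> \<one>\<^bsub>A\<^esub>"
    and antipode_right: "x \<in> carrier A \<Longrightarrow>
      tensor_lift A (\<lambda>y z. y \<otimes>\<^bsub>A\<^esub> antipode A z) (comult A x) = counit A x \<odot>\<^bsub>A\<^esub> \<one>\<^bsub>A\<^esub>"
    and antipode_invertible: "bij_betw (antipode A) (carrier A) (carrier A)"

text \<open>A Hopf subalgebra is a subset carrying a Hopf algebra structure for which the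
  inclusion is a homomorphism of Hopf algebras. The coproducts are compared after applying
  \<open>id \<otimes> id\<close>, since tensors over \<open>H\<close> and over \<open>U\<close> are different cosets.\<close>

locale hopf_subalgebra = H: hopf_algebra K H + U: hopf_algebra K U for K H U +
  assumes subset: "carrier H \<subseteq> carrier U"
    and inclusion_hom: "id \<in> algebra_homs K H U"
    and inclusion_comult: "h \<in> carrier H \<Longrightarrow> tensor_map K U U id id (comult H h) = comult U h"
    and inclusion_counit: "h \<in> carrier H \<Longrightarrow> counit H h = counit U h"
    and inclusion_antipode: "h \<in> carrier H \<Longrightarrow> antipode H h = antipode U h"

locale nondegenerate_hopf_pairing = U: hopf_algebra K U + V: hopf_algebra K V
  for K :: "'k ring" and U :: "('k, 'u) hopf" and V :: "('k, 'v) hopf" +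
  fixes pair :: "'u \<Rightarrow> 'v \<Rightarrow> 'k"
  assumes bilinear: "bilinear_map K U V (ground_algebra K) pair"
    and pair_mult_left: "\<lbrakk>x \<in> carrier U; y \<in> carrier U; u \<in> carrier V\<rbrakk> \<Longrightarrow>
      pair (x \<otimes>\<^bsub>U\<^esub> y) u = tensor_lift K (\<lambda>u1 u2. pair x u1 \<otimes>\<^bsub>K\<^esub> pair y u2) (comult V u)"
    and pair_mult_right: "\<lbrakk>x \<in> carrier U; u \<in> carrier V; v \<in> carrier V\<rbrakk> \<Longrightarrow>
      pair x (u \<otimes>\<^bsub>V\<^esub> v) = tensor_lift K (\<lambda>x1 x2. pair x1 u \<otimes>\<^bsub>K\<^esub> pair x2 v) (comult U x)"
    and pair_one_left: "u \<in> carrier V \<Longrightarrow> pair \<one>\<^bsub>U\<^esub> u = counit V u"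
    and pair_one_right: "x \<in> carrier U \<Longrightarrow> pair x \<one>\<^bsub>V\<^esub> = counit U x"
    and pair_antipode: "\<lbrakk>x \<in> carrier U; u \<in> carrier V\<rbrakk> \<Longrightarrow>
      pair (antipode U x) u = pair x (antipode V u)"
    and nondegenerate_left:
      "\<lbrakk>x \<in> carrier U; \<forall>u\<in>carrier V. pair x u = \<zero>\<^bsub>K\<^esub>\<rbrakk> \<Longrightarrow> x = \<zero>\<^bsub>U\<^esub>"
    and nondegenerate_right:
      "\<lbrakk>u \<in> carrier V; \<forall>x\<in>carrier U. pair x u = \<zero>\<^bsub>K\<^esub>\<rbrakk> \<Longrightarrow> u = \<zero>\<^bsub>V\<^esub>"


section \<open>Base algebras\<close>

text \<open>In \<open>yetter_drinfeld\<close> the iterated coproduct is \<open>(id \<otimes> \<Delta>) \<Delta> h = h\<^sup>1 \<otimes> h\<^sup>2 \<otimes> h\<^sup>3\<close>.\<close>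

locale base_algebra = H: hopf_algebra K H
  for K :: "'k ring" and H :: "('k, 'h) hopf" +
  fixes L :: "('k, 'l) module"
    and act :: "'h \<Rightarrow> 'l \<Rightarrow> 'l"
    and coact :: "'l \<Rightarrow> ('h, 'l) tens"
  assumes L_algebra: "assoc_algebra K L"
    and act_bilinear: "bilinear_map K H L L act"
    and act_mult: "\<lbrakk>g \<in> carrier H; h \<in> carrier H; l \<in> carrier L\<rbrakk> \<Longrightarrow>
      act (g \<otimes>\<^bsub>H\<^esub> h) l = act g (act h l)"
    and act_one: "l \<in> carrier L \<Longrightarrow> act \<one>\<^bsub>H\<^esub> l = l"
    and act_module_algebra: "\<lbrakk>h \<in> carrier H; l \<in> carrier L; m \<in> carrier L\<rbrakk> \<Longrightarrow>
      act h (l \<otimes>\<^bsub>L\<^esub> m) = tensor_lift L (\<lambda>h1 h2. act h1 l \<otimes>\<^bsub>L\<^esub> act h2 m) (comult H h)"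
    and act_unit: "h \<in> carrier H \<Longrightarrow> act h \<one>\<^bsub>L\<^esub> = counit H h \<odot>\<^bsub>L\<^esub> \<one>\<^bsub>L\<^esub>"
    and coact_hom: "coact \<in> algebra_homs K L (tensor_algebra K H L)"
    and coact_coassoc: "l \<in> carrier L \<Longrightarrow>
      tensor_assoc K H H L (tensor_map K (tensor_algebra K H H) L (comult H) id (coact l)) =
      tensor_map K H (tensor_algebra K H L) id coact (coact l)"
    and coact_counit: "l \<in> carrier L \<Longrightarrow>
      tensor_lift L (\<lambda>h m. counit H h \<odot>\<^bsub>L\<^esub> m) (coact l) = l"
    and yetter_drinfeld: "\<lbrakk>h \<in> carrier H; l \<in> carrier L\<rbrakk> \<Longrightarrow>
      coact (act h l) =
        tensor_lift (tensor_algebra K H L) (\<lambda>h1 h'.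
          tensor_lift (tensor_algebra K H L) (\<lambda>h2 h3.
            tensor_lift (tensor_algebra K H L) (\<lambda>l1 l2.
              tensor_elem K H L (h1 \<otimes>\<^bsub>H\<^esub> l1 \<otimes>\<^bsub>H\<^esub> antipode H h3) (act h2 l2))
            (coact l))
          (comult H h'))
        (comult H h)"
    and quasi_commutative: "\<lbrakk>l \<in> carrier L; m \<in> carrier L\<rbrakk> \<Longrightarrow>
      l \<otimes>\<^bsub>L\<^esub> m = tensor_lift L (\<lambda>l1 l2. act l1 m \<otimes>\<^bsub>L\<^esub> l2) (coact l)"


section \<open>Right bialgebroids\<close>

definition bialgebroid_bimodule ::
  "('k, 'b) module \<Rightarrow> ('l \<Rightarrow> 'b) \<Rightarrow> ('l \<Rightarrow> 'b) \<Rightarrow> ('l, 'k, 'b) bimod" where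
  "bialgebroid_bimodule B s t =
     module.extend B (bimod.fields (\<lambda>l a. a \<otimes>\<^bsub>B\<^esub> t l) (\<lambda>a l. a \<otimes>\<^bsub>B\<^esub> s l))"

text \<open>The elements \<open>z\<close> of \<open>B \<otimes>\<^sub>L B\<close> with \<open>(s l \<otimes> 1) z = (1 \<otimes> t l) z\<close> for all \<open>l\<close>, with
  factorwise multiplication.\<close>

definition takeuchi_algebra ::
  "('k, 'l) module \<Rightarrow> ('k, 'b) module \<Rightarrow> ('l \<Rightarrow> 'b) \<Rightarrow> ('l \<Rightarrow> 'b)
     \<Rightarrow> ('k, ('b, 'b) tens) module" where
  "takeuchi_algebra L B s t =
     (let M = bialgebroid_bimodule B s t; T = bimod_tensor L M M in
      \<lparr>carrier = {z \<in> carrier T. \<forall>l\<in>carrier L.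
          bimod_tensor_map L M M (\<lambda>a. s l \<otimes>\<^bsub>B\<^esub> a) id z =
          bimod_tensor_map L M M id (\<lambda>b. t l \<otimes>\<^bsub>B\<^esub> b) z},
       monoid.mult = \<lambda>X Y.
          tensor_lift T (\<lambda>a b. tensor_lift T (\<lambda>a' b'.
            bimod_elem L M M (a \<otimes>\<^bsub>B\<^esub> a') (b \<otimes>\<^bsub>B\<^esub> b')) Y) X,
       one = bimod_elem L M M \<one>\<^bsub>B\<^esub> \<one>\<^bsub>B\<^esub>,
       zero = \<zero>\<^bsub>T\<^esub>, add = add T, smult = smult T\<rparr>)"

locale right_bialgebroid =
  fixes K :: "'k ring" and L :: "('k, 'l) module" and B :: "('k, 'b) module"
    and s t :: "'l \<Rightarrow> 'b"
    and \<Delta> :: "'b \<Rightarrow> ('b, 'b) tens"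
    and \<epsilon> :: "'b \<Rightarrow> 'l"
    and M :: "('l, 'k, 'b) bimod"
  defines "M \<equiv> bialgebroid_bimodule B s t"
  assumes base: "assoc_algebra K L"
    and total: "assoc_algebra K B"
    and source_hom: "s \<in> algebra_homs K L B"
    and target_antihom: "t \<in> algebra_homs K (opposite L) B"
    and images_commute: "\<lbrakk>l \<in> carrier L; m \<in> carrier L\<rbrakk> \<Longrightarrow>
      s l \<otimes>\<^bsub>B\<^esub> t m = t m \<otimes>\<^bsub>B\<^esub> s l"
    and \<Delta>_bimodule_map: "\<Delta> \<in> bimodule_maps K L M (bimod_tensor L M M)"
    and \<Delta>_coassoc: "a \<in> carrier B \<Longrightarrow>
      bimod_assoc L M M M (bimod_tensor_map L (bimod_tensor L M M) M \<Delta> id (\<Delta> a)) =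
      bimod_tensor_map L M (bimod_tensor L M M) id \<Delta> (\<Delta> a)"
    and \<Delta>_hom: "\<Delta> \<in> algebra_homs K B (takeuchi_algebra L B s t)"
    and \<epsilon>_bimodule_map: "\<epsilon> \<in> bimodule_maps K L M (regular_bimodule L)"
    and \<epsilon>_one: "\<epsilon> \<one>\<^bsub>B\<^esub> = \<one>\<^bsub>L\<^esub>"
    and \<epsilon>_source: "\<lbrakk>a \<in> carrier B; b \<in> carrier B\<rbrakk> \<Longrightarrow>
      \<epsilon> (s (\<epsilon> a) \<otimes>\<^bsub>B\<^esub> b) = \<epsilon> (a \<otimes>\<^bsub>B\<^esub> b)"
    and \<epsilon>_target: "\<lbrakk>a \<in> carrier B; b \<in> carrier B\<rbrakk> \<Longrightarrow>
      \<epsilon> (t (\<epsilon> a) \<otimes>\<^bsub>B\<^esub> b) = \<epsilon> (a \<otimes>\<^bsub>B\<^esub> b)"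
    and \<epsilon>_left: "a \<in> carrier B \<Longrightarrow>
      tensor_lift B (\<lambda>b c. lsmul M (\<epsilon> b) c) (\<Delta> a) = a"
    and \<epsilon>_right: "a \<in> carrier B \<Longrightarrow>
      tensor_lift B (\<lambda>b c. rsmul M b (\<epsilon> c)) (\<Delta> a) = a"


section \<open>The algebra \<open>U\<^sup>* \<ltimes> (L \<otimes> L\<^sub>o\<^sub>p)\<close>\<close>

text \<open>The Hopf algebra \<open>V\<close> plays the role of \<open>U\<^sup>*\<close>. In Sweedler notation
  \<open>dual_act V pair x u = u\<^sup>1 \<langle>x, u\<^sup>2\<rangle>\<close> is the action of \<open>U\<close> and
  \<open>dual_act_op V pair y u = \<langle>y, u\<^sup>1\<rangle> u\<^sup>2\<close> that of its opposite.\<close>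

definition dual_act :: "('k, 'v) hopf \<Rightarrow> ('u \<Rightarrow> 'v \<Rightarrow> 'k) \<Rightarrow> 'u \<Rightarrow> 'v \<Rightarrow> 'v" where
  "dual_act V pair x u = tensor_lift V (\<lambda>u1 u2. pair x u2 \<odot>\<^bsub>V\<^esub> u1) (comult V u)"

definition dual_act_op :: "('k, 'v) hopf \<Rightarrow> ('u \<Rightarrow> 'v \<Rightarrow> 'k) \<Rightarrow> 'u \<Rightarrow> 'v \<Rightarrow> 'v" where
  "dual_act_op V pair y u = tensor_lift V (\<lambda>u1 u2. pair y u1 \<odot>\<^bsub>V\<^esub> u2) (comult V u)"

definition smash_elem ::
  "'k ring \<Rightarrow> ('k, 'v) hopf \<Rightarrow> ('k, 'l) module \<Rightarrow> 'v \<Rightarrow> 'l \<Rightarrow> 'l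
     \<Rightarrow> (('v, 'l) tens, 'l) tens" where
  "smash_elem K V L u l m =
     tensor_elem K (tensor_algebra K V L) (opposite L) (tensor_elem K V L u l) m"

definition triple_lift ::
  "('g, 'z) ring_scheme \<Rightarrow> ('a \<Rightarrow> 'b \<Rightarrow> 'c \<Rightarrow> 'g) \<Rightarrow> (('a, 'b) tens, 'c) tens \<Rightarrow> 'g" where
  "triple_lift G f = tensor_lift G (\<lambda>X c. tensor_lift G (\<lambda>a b. f a b c) X)"

definition smash_algebra ::
  "'k ring \<Rightarrow> ('k, 'v) hopf \<Rightarrow> ('k, 'l) module \<Rightarrow> ('u \<Rightarrow> 'v \<Rightarrow> 'k) \<Rightarrow> ('l \<Rightarrow> ('u, 'l) tens)
     \<Rightarrow> ('k, (('v, 'l) tens, 'l) tens) module" where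
  "smash_algebra K V L pair coact =
     (let T = tensor_algebra K (tensor_algebra K V L) (opposite L) in
      T\<lparr>monoid.mult := \<lambda>X Y.
          triple_lift T (\<lambda>u l m. triple_lift T (\<lambda>v a b.
            tensor_lift T (\<lambda>l1 l2. tensor_lift T (\<lambda>m1 m2.
              smash_elem K V L
                (u \<otimes>\<^bsub>V\<^esub> dual_act V pair l1 (dual_act_op V pair m1 v))
                (l2 \<otimes>\<^bsub>L\<^esub> a)
                (m2 \<otimes>\<^bsub>opposite L\<^esub> b))
            (coact m)) (coact l)) Y) X\<rparr>)"

definition smash_source ::
  "'k ring \<Rightarrow> ('k, 'v) hopf \<Rightarrow> ('k, 'l) module \<Rightarrow> 'l \<Rightarrow> (('v, 'l) tens, 'l) tens" where
  "smash_source K V L l = smash_elem K V L \<one>\<^bsub>V\<^esub> l \<one>\<^bsub>L\<^esub>"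

definition smash_target ::
  "'k ring \<Rightarrow> ('k, 'v) hopf \<Rightarrow> ('k, 'l) module \<Rightarrow> 'l \<Rightarrow> (('v, 'l) tens, 'l) tens" where
  "smash_target K V L l = smash_elem K V L \<one>\<^bsub>V\<^esub> \<one>\<^bsub>L\<^esub> l"

definition smash_bimodule ::
  "'k ring \<Rightarrow> ('k, 'v) hopf \<Rightarrow> ('k, 'l) module \<Rightarrow> ('u \<Rightarrow> 'v \<Rightarrow> 'k) \<Rightarrow> ('l \<Rightarrow> ('u, 'l) tens)
     \<Rightarrow> ('l, 'k, (('v, 'l) tens, 'l) tens) bimod" where
  "smash_bimodule K V L pair coact =
     bialgebroid_bimodule (smash_algebra K V L pair coact) (smash_source K V L)
       (smash_target K V L)"

definition smash_comult_elem ::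
  "'k ring \<Rightarrow> ('k, 'v) hopf \<Rightarrow> ('k, 'l) module \<Rightarrow> ('u \<Rightarrow> 'v \<Rightarrow> 'k) \<Rightarrow> ('l \<Rightarrow> ('u, 'l) tens)
     \<Rightarrow> 'v \<Rightarrow> 'l \<Rightarrow> 'l \<Rightarrow> ((('v, 'l) tens, 'l) tens, (('v, 'l) tens, 'l) tens) tens" where
  "smash_comult_elem K V L pair coact u l m =
     (let M = smash_bimodule K V L pair coact in
      tensor_lift (bimod_tensor L M M) (\<lambda>u1 u2.
        bimod_elem L M M (smash_elem K V L u1 \<one>\<^bsub>L\<^esub> m) (smash_elem K V L u2 l \<one>\<^bsub>L\<^esub>))
      (comult V u))"

definition smash_comult ::
  "'k ring \<Rightarrow> ('k, 'v) hopf \<Rightarrow> ('k, 'l) module \<Rightarrow> ('u \<Rightarrow> 'v \<Rightarrow> 'k) \<Rightarrow> ('l \<Rightarrow> ('u, 'l) tens)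
     \<Rightarrow> (('v, 'l) tens, 'l) tens
     \<Rightarrow> ((('v, 'l) tens, 'l) tens, (('v, 'l) tens, 'l) tens) tens" where
  "smash_comult K V L pair coact =
     (let M = smash_bimodule K V L pair coact in
      triple_lift (bimod_tensor L M M) (smash_comult_elem K V L pair coact))"

definition smash_counit ::
  "('k, 'v) hopf \<Rightarrow> ('k, 'l) module \<Rightarrow> (('v, 'l) tens, 'l) tens \<Rightarrow> 'l" where
  "smash_counit V L = triple_lift L (\<lambda>u l m. counit V u \<odot>\<^bsub>L\<^esub> (m \<otimes>\<^bsub>L\<^esub> l))"

end

theory Submission
  imports Defs
begin

text \<open>Left multiplication by \<open>u \<otimes> l \<otimes> m\<close> is the composite of three simpler operators: multiplication
  by \<open>u\<close>, by \<open>s l\<close> and by \<open>t m\<close>. Associativity, and later the multiplicativity of the coproduct,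
  reduce to the commutation rules of these operators, each of which is a short Sweedler
  computation. The elements \<open>s l\<close> and \<open>t l\<close> move through the coproduct by coassociativity, and
  \<open>\<epsilon> (s (\<epsilon> a) b) = \<epsilon> (a b) = \<epsilon> (t (\<epsilon> a) b)\<close> because the counit turns both actions of \<open>h\<close> on \<open>v\<close>
  into the number \<open>\<langle>h, v\<rangle>\<close>.\<close>

section \<open>Linear maps\<close>

text \<open>Every Sweedler sum is a \<open>tensor_lift\<close>, a definite description over the
  representatives of a coset. It can be evaluated only once its integrand is known to be linear in
  each variable and balanced. Hence the uniform pattern: both sides of an identity are shown linear,
  and then compared on elementary tensors. A second obstacle is that factorwise multiplication on B
  \<otimes>_L B is not well defined. In X Y the factor X may be rewritten along the tensor relation
  only if (s l \<otimes> 1) Y = (1 \<otimes> t l) Y. Multiplicativity of \<Delta> therefore has no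
  meaning before \<Delta> is known to satisfy this condition. The remaining leg of the coaction
  crosses the tensor sign, entering as s on one side and as t on the other. The coaction takes
  values in H \<otimes> L, which is why the pairing is restricted to H.\<close>

lemma linear_mapsI:
  assumes "\<And>x. x \<in> carrier M \<Longrightarrow> f x \<in> carrier N"
    and "\<And>x y. \<lbrakk>x \<in> carrier M; y \<in> carrier M\<rbrakk> \<Longrightarrow> f (x \<oplus>\<^bsub>M\<^esub> y) = f x \<oplus>\<^bsub>N\<^esub> f y"
    and "\<And>c x. \<lbrakk>c \<in> carrier K; x \<in> carrier M\<rbrakk> \<Longrightarrow> f (c \<odot>\<^bsub>M\<^esub> x) = c \<odot>\<^bsub>N\<^esub> f x"
  shows "f \<in> linear_maps K M N"
  using assms by (auto simp: linear_maps_def hom_def)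

lemma linear_maps_closed: "\<lbrakk>f \<in> linear_maps K M N; x \<in> carrier M\<rbrakk> \<Longrightarrow> f x \<in> carrier N"
  by (auto simp: linear_maps_def hom_def)

lemma linear_maps_add:
  "\<lbrakk>f \<in> linear_maps K M N; x \<in> carrier M; y \<in> carrier M\<rbrakk> \<Longrightarrow> f (x \<oplus>\<^bsub>M\<^esub> y) = f x \<oplus>\<^bsub>N\<^esub> f y"
  by (auto simp: linear_maps_def hom_def)

lemma linear_maps_smult:
  "\<lbrakk>f \<in> linear_maps K M N; c \<in> carrier K; x \<in> carrier M\<rbrakk> \<Longrightarrow> f (c \<odot>\<^bsub>M\<^esub> x) = c \<odot>\<^bsub>N\<^esub> f x"
  by (auto simp: linear_maps_def hom_def)

lemma linear_maps_zero:
  assumes "f \<in> linear_maps K M N" "module K M" "module K N"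
  shows "f \<zero>\<^bsub>M\<^esub> = \<zero>\<^bsub>N\<^esub>"
proof -
  interpret M: module K M by fact
  interpret N: module K N by fact
  have "f \<zero>\<^bsub>M\<^esub> = f (\<zero>\<^bsub>K\<^esub> \<odot>\<^bsub>M\<^esub> \<zero>\<^bsub>M\<^esub>)" by simp
  also have "\<dots> = \<zero>\<^bsub>K\<^esub> \<odot>\<^bsub>N\<^esub> f \<zero>\<^bsub>M\<^esub>"
    using assms(1) by (rule linear_maps_smult) auto
  also have "\<dots> = \<zero>\<^bsub>N\<^esub>"
    using linear_maps_closed[OF assms(1)] by simp
  finally show ?thesis .
qed

lemma linear_maps_id: "(\<lambda>x. x) \<in> linear_maps K M M"
  by (rule linear_mapsI) auto

lemma linear_maps_comp:
  assumes "g \<in> linear_maps K N P" "f \<in> linear_maps K M N"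
  shows "(\<lambda>x. g (f x)) \<in> linear_maps K M P"
  by (rule linear_mapsI) (use assms in \<open>auto simp: linear_maps_add linear_maps_smult linear_maps_closed\<close>)

text \<open>For maps that obey a convenient formula only on the carrier, such as the product of B
  after its rewriting into operators: linearity may be checked on the formula.\<close>

lemma linear_maps_cong:
  assumes "\<And>x. x \<in> carrier M \<Longrightarrow> f x = g x" "module K M"
  shows "f \<in> linear_maps K M N \<longleftrightarrow> g \<in> linear_maps K M N"
proof -
  interpret M: module K M by fact
  show ?thesis
    using assms(1) by (auto simp: linear_maps_def hom_def Pi_iff)
qed

lemma bilinear_mapI:
  assumes "\<And>m. m \<in> carrier M \<Longrightarrow> (\<lambda>n. f m n) \<in> linear_maps K N P"
    and "\<And>n. n \<in> carrier N \<Longrightarrow> (\<lambda>m. f m n) \<in> linear_maps K M P"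
  shows "bilinear_map K M N P f"
  using assms by (auto simp: bilinear_map_def)

lemma bilinear_map_right:
  "\<lbrakk>bilinear_map K M N P f; m \<in> carrier M\<rbrakk> \<Longrightarrow> f m \<in> linear_maps K N P"
  by (auto simp: bilinear_map_def)

lemma bilinear_map_left:
  "\<lbrakk>bilinear_map K M N P f; n \<in> carrier N\<rbrakk> \<Longrightarrow> (\<lambda>m. f m n) \<in> linear_maps K M P"
  by (auto simp: bilinear_map_def)

lemma bilinear_map_closed:
  "\<lbrakk>bilinear_map K M N P f; m \<in> carrier M; n \<in> carrier N\<rbrakk> \<Longrightarrow> f m n \<in> carrier P"
  by (meson bilinear_map_right linear_maps_closed)


section \<open>Balanced tensor products\<close>

abbreviation (input) "lift \<equiv> tensor_lift"

section \<open>Evaluation of formal integer combinations in an abelian group\<close>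

lemma foldSetD_cong:
  assumes "(A, y) \<in> foldSetD D f e" "\<And>x. x \<in> A \<Longrightarrow> f x = g x"
  shows "(A, y) \<in> foldSetD D g e"
  using assms
proof (induction A y rule: foldSetD.induct)
  case (insertI x A y)
  then show ?case by (metis foldSetD.insertI insert_iff)
qed (rule foldSetD.emptyI)

text \<open>The relation \<open>foldSetD\<close> behind \<open>finprod\<close> reads the integrand
  only at elements of \<open>A\<close>, so no closure assumption on \<open>f\<close> or
  \<open>g\<close> is made. This lets integrands be rewritten before anything is known about their
  values.\<close>

lemma finprod_cong_carrier_free:
  assumes "\<And>x. x \<in> A \<Longrightarrow> f x = g x"
  shows "finprod G f A = finprod G g A"
proof -
  have "(A, y) \<in> foldSetD (carrier G) (monoid.mult G \<circ> f) \<one>\<^bsub>G\<^esub> \<longleftrightarrow>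
      (A, y) \<in> foldSetD (carrier G) (monoid.mult G \<circ> g) \<one>\<^bsub>G\<^esub>" for y
    using assms foldSetD_cong[of A y _ "monoid.mult G \<circ> f" _ "monoid.mult G \<circ> g"]
      foldSetD_cong[of A y _ "monoid.mult G \<circ> g" _ "monoid.mult G \<circ> f"] by auto
  then show ?thesis
    by (simp add: finprod_def foldD_def)
qed

text \<open>The expression inside \<open>group_lift\<close>, isolated for a single formal sum: it is
  shown to be a homomorphism before representatives of a coset are compared.\<close>

definition formal_eval :: "('g, 'z) monoid_scheme \<Rightarrow> ('a \<Rightarrow> 'g) \<Rightarrow> ('a \<Rightarrow>\<^sub>0 int) \<Rightarrow> 'g" where
  "formal_eval G f c = (\<Otimes>\<^bsub>G\<^esub>p\<in>Poly_Mapping.keys c. f p [^]\<^bsub>G\<^esub> Poly_Mapping.lookup c p)"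

text \<open>A lift reads only the carrier, the operation and the unit of its target. The same
  additive group occurs below in several records (factor group, \<open>balanced_tensor\<close>,
  \<open>tensor_algebra\<close>, \<open>bimod_tensor\<close>, \<open>smash_algebra\<close>), and
  lifts into any of them may be exchanged.\<close>

lemma group_lift_transfer:
  fixes G :: "('g, 'y) monoid_scheme" and G' :: "('g, 'z) monoid_scheme" and f :: "'c \<Rightarrow> 'd \<Rightarrow> 'g"
  assumes eq: "carrier G' = carrier G" "monoid.mult G' = monoid.mult G" "one G' = one G"
  shows "group_lift G' f X = group_lift G f X"
proof -
  have inv: "m_inv G' = m_inv G"
    by (rule ext) (simp add: m_inv_def eq)
  have pow: "x [^]\<^bsub>G'\<^esub> (z::int) = x [^]\<^bsub>G\<^esub> z" for x z
    unfolding int_pow_def nat_pow_def inv by (simp add: eq)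
  have prod: "finprod G' g A = finprod G g A" for g :: "'c \<times> 'd \<Rightarrow> _" and A
    by (simp add: finprod_def eq)
  show ?thesis
    by (simp only: group_lift_def pow prod)
qed

context comm_group
begin

text \<open>The product in \<open>formal_eval\<close> runs over the support, which changes under
  addition. Written as a \<open>gfinprod\<close> over the fixed set \<open>S\<close> it visibly
  respects sums.\<close>

lemma formal_eval_hom:
  assumes f: "f ` S \<subseteq> carrier G"
  shows "formal_eval G f \<in> hom (free_Abelian_group S) G"
proof -
  let ?h = "\<lambda>x. gfinprod G (\<lambda>a. f a [^] Poly_Mapping.lookup x a) S"
  have eq: "formal_eval G f c = ?h c" if "c \<in> carrier (free_Abelian_group S)" for c
  proof -
    have k: "Poly_Mapping.keys c \<subseteq> S" using that by simp
    have "?h c = gfinprod G (\<lambda>a. f a [^] Poly_Mapping.lookup c a) (Poly_Mapping.keys c)"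
      by (rule gfinprod_mono_neutral_cong_right) (use k f in \<open>auto simp: in_keys_iff\<close>)
    also have "\<dots> = formal_eval G f c"
      unfolding formal_eval_def by (rule gfinprod_eq_finprod) (use k f in auto)
    finally show ?thesis by simp
  qed
  have fin: "finite {x \<in> S. f x [^] Poly_Mapping.lookup u x \<noteq> \<one>}" for u :: "'c \<Rightarrow>\<^sub>0 int"
    by (rule finite_subset [OF _ finite_keys [of u]]) (auto simp: in_keys_iff)
  have "?h \<in> hom (free_Abelian_group S) G"
  proof (rule homI)
    fix x y
    assume "x \<in> carrier (free_Abelian_group S)" "y \<in> carrier (free_Abelian_group S)"
    then show "?h (x \<otimes>\<^bsub>free_Abelian_group S\<^esub> y) = ?h x \<otimes> ?h y"
      using f by (simp add: fin gfinprod_distrib image_subset_iff Poly_Mapping.lookup_add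
          int_pow_mult cong: gfinprod_cong)
  qed (use f in \<open>force intro: gfinprod_closed\<close>)
  moreover have "group (free_Abelian_group S)" by simp
  ultimately show ?thesis
    using eq group.is_monoid monoid.m_closed
    unfolding hom_def by (smt (verit, best) Pi_iff mem_Collect_eq)
qed

lemma formal_eval_frag_of:
  assumes "f p \<in> carrier G"
  shows "formal_eval G f (frag_of p) = f p"
  using assms by (simp add: formal_eval_def)

end

text \<open>One construction for tensor products over K and over the noncommutative base L. The
  assumption \<open>scalars\<close> lets each element of K act on both modules through one element
  of \<open>S\<close>; it makes the K-actions through the first and through the second factor
  agree.\<close>

locale balanced_product = M: module K M + N: module K N
  for K (structure) and M :: "('k, 'm, 'x) module_scheme" and N :: "('k, 'n, 'y) module_scheme" +
  fixes S :: "'s set" and ra :: "'m \<Rightarrow> 's \<Rightarrow> 'm" and la :: "'s \<Rightarrow> 'n \<Rightarrow> 'n"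
  assumes ra_linear: "r \<in> S \<Longrightarrow> (\<lambda>m. ra m r) \<in> linear_maps K M M"
    and la_linear: "r \<in> S \<Longrightarrow> la r \<in> linear_maps K N N"
    and scalars: "c \<in> carrier K \<Longrightarrow>
      \<exists>r\<in>S. (\<forall>m\<in>carrier M. ra m r = c \<odot>\<^bsub>M\<^esub> m) \<and> (\<forall>n\<in>carrier N. la r n = c \<odot>\<^bsub>N\<^esub> n)"
begin

abbreviation "T \<equiv> balanced_tensor S ra la M N"
abbreviation "el \<equiv> balanced_elem S ra la M N"

definition balanced_maps :: "('k, 'p, 'z) module_scheme \<Rightarrow> ('m \<Rightarrow> 'n \<Rightarrow> 'p) set" where
  "balanced_maps P = {f. bilinear_map K M N P f \<and>
     (\<forall>m\<in>carrier M. \<forall>r\<in>S. \<forall>n\<in>carrier N. f (ra m r) n = f m (la r n))}"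

text \<open>The additive half of balance. It is separated because the scalar action on
  \<open>T\<close> is itself a lift, to be evaluated before \<open>T\<close> is known to be a
  K-module.\<close>

definition balanced_additive :: "('p, 'z) ring_scheme \<Rightarrow> ('m \<Rightarrow> 'n \<Rightarrow> 'p) \<Rightarrow> bool" where
  "balanced_additive P f \<longleftrightarrow>
     (\<forall>m\<in>carrier M. \<forall>n\<in>carrier N. f m n \<in> carrier P) \<and>
     (\<forall>m\<in>carrier M. \<forall>m'\<in>carrier M. \<forall>n\<in>carrier N. f (m \<oplus>\<^bsub>M\<^esub> m') n = f m n \<oplus>\<^bsub>P\<^esub> f m' n) \<and>
     (\<forall>m\<in>carrier M. \<forall>n\<in>carrier N. \<forall>n'\<in>carrier N. f m (n \<oplus>\<^bsub>N\<^esub> n') = f m n \<oplus>\<^bsub>P\<^esub> f m n') \<and>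
     (\<forall>m\<in>carrier M. \<forall>r\<in>S. \<forall>n\<in>carrier N. f (ra m r) n = f m (la r n))"

lemma balanced_maps_additive:
  assumes "f \<in> balanced_maps P"
  shows "balanced_additive P f"
proof -
  have bil: "bilinear_map K M N P f" using assms by (simp add: balanced_maps_def)
  show ?thesis
    using assms bilinear_map_closed[OF bil] linear_maps_add[OF bilinear_map_left[OF bil]]
      linear_maps_add[OF bilinear_map_right[OF bil]]
    by (auto simp: balanced_additive_def balanced_maps_def)
qed

lemma balanced_mapsI:
  assumes "bilinear_map K M N P f"
    and "\<And>m r n. \<lbrakk>m \<in> carrier M; r \<in> S; n \<in> carrier N\<rbrakk> \<Longrightarrow> f (ra m r) n = f m (la r n)"
  shows "f \<in> balanced_maps P"
  using assms by (auto simp: balanced_maps_def)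

abbreviation (input) "F0 \<equiv> formal_sums M N"
abbreviation (input) "N0 \<equiv> tensor_null S ra la M N"
abbreviation (input) "cls c \<equiv> N0 #>\<^bsub>F0\<^esub> c"

lemma ra_closed: "\<lbrakk>r \<in> S; m \<in> carrier M\<rbrakk> \<Longrightarrow> ra m r \<in> carrier M"
  using linear_maps_closed[OF ra_linear] by auto

lemma la_closed: "\<lbrakk>r \<in> S; n \<in> carrier N\<rbrakk> \<Longrightarrow> la r n \<in> carrier N"
  using linear_maps_closed[OF la_linear] by auto

lemma diff_closed: "\<lbrakk>a \<in> carrier F0; b \<in> carrier F0\<rbrakk> \<Longrightarrow> a - b \<in> carrier F0"
  using keys_diff[of a b] by auto

lemma relators_closed: "tensor_relators S ra la M N \<subseteq> carrier F0"
proof -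
  have frag: "frag_of p \<in> carrier F0" if "p \<in> carrier M \<times> carrier N" for p
    using that by auto
  show ?thesis
    unfolding tensor_relators_def
    by (auto intro!: diff_closed frag simp: ra_closed la_closed simp del: carrier_free_Abelian_group_iff)
qed

lemma null_subgroup: "subgroup N0 F0"
  unfolding tensor_null_def
  by (rule group.generate_is_subgroup) (auto simp: relators_closed simp del: carrier_free_Abelian_group_iff)

lemma null_normal: "N0 \<lhd> F0"
  using comm_group.normal_iff_subgroup[OF abelian_free_Abelian_group] null_subgroup by blast

lemma T_simps:
  "carrier T = carrier (F0 Mod N0)" "add T = monoid.mult (F0 Mod N0)" "zero T = one (F0 Mod N0)"
  by (simp_all add: balanced_tensor_def Let_def)

lemma T_abelian: "abelian_group T"
proof -
  interpret F: comm_group "F0 Mod N0"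
    by (rule comm_group.abelian_FactGroup[OF abelian_free_Abelian_group null_subgroup])
  have "comm_group (add_monoid T)"
  proof (rule comm_groupI)
    fix x assume "x \<in> carrier (add_monoid T)"
    then show "\<exists>y\<in>carrier (add_monoid T). y \<otimes>\<^bsub>add_monoid T\<^esub> x = \<one>\<^bsub>add_monoid T\<^esub>"
      using F.l_inv_ex by (simp add: T_simps del: mult_FactGroup one_FactGroup)
  qed (use F.m_assoc F.m_comm F.m_closed F.l_one F.one_closed in \<open>simp_all add: T_simps del: mult_FactGroup one_FactGroup\<close>)
  then show ?thesis
    unfolding abelian_group_def abelian_monoid_def comm_group_def abelian_group_axioms_def by blast
qed

sublocale T: abelian_group T by (rule T_abelian)

lemma coset_hom: "(\<lambda>c. cls c) \<in> hom F0 (add_monoid T)"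
  using normal.r_coset_hom_Mod[OF null_normal] by (simp add: hom_def T_simps del: mult_FactGroup one_FactGroup)

lemma coset_add: "\<lbrakk>a \<in> carrier F0; b \<in> carrier F0\<rbrakk> \<Longrightarrow>
    cls (a + b) = cls a \<oplus>\<^bsub>T\<^esub> cls b"
  using hom_mult[OF coset_hom, of a b] by simp

lemma coset_closed: "a \<in> carrier F0 \<Longrightarrow> cls a \<in> carrier T"
  using hom_in_carrier[OF coset_hom] by simp

lemma coset_zero: "cls 0 = \<zero>\<^bsub>T\<^esub>"
  using hom_one[OF coset_hom] T.a_group by simp

lemma coset_minus: "a \<in> carrier F0 \<Longrightarrow> cls (- a) = \<ominus>\<^bsub>T\<^esub> cls a"
  using coset_add[of a "- a"] coset_closed[of a] coset_closed[of "- a"] coset_zero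
    T.minus_equality[of "cls (- a)" "cls a"]
  by (simp add: T.a_comm)

lemma coset_eqI:
  assumes "a \<in> carrier F0" "b \<in> carrier F0" "a - b \<in> N0"
  shows "cls a = cls b"
proof -
  have "cls ((a - b) + b) = (cls (a - b)) \<oplus>\<^bsub>T\<^esub> cls b"
    using assms(2) subgroup.subset[OF null_subgroup] assms(3) by (intro coset_add) blast+
  also have "cls (a - b) = \<zero>\<^bsub>T\<^esub>"
    unfolding T_simps one_FactGroup
    by (rule group.coset_join2[OF group_free_Abelian_group _ null_subgroup assms(3)])
      (rule subsetD[OF subgroup.subset[OF null_subgroup] assms(3)])
  finally have "cls ((a - b) + b) = cls b"
    using coset_closed[OF assms(2)] by (simp only: T.l_zero)
  then show ?thesis by simp
qed

lemma T_cases: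
  assumes "X \<in> carrier T"
  obtains c where "c \<in> carrier F0" "X = cls c"
  using assms by (auto simp: T_simps carrier_FactGroup)

lemma elem_closed: "\<lbrakk>m \<in> carrier M; n \<in> carrier N\<rbrakk> \<Longrightarrow> el m n \<in> carrier T"
  unfolding balanced_elem_def by (rule coset_closed) simp

lemma relator_null: "a \<in> tensor_relators S ra la M N \<Longrightarrow> a \<in> N0"
  unfolding tensor_null_def by (rule generate.incl)

lemma relator_add:
  assumes "frag_of p - frag_of q - frag_of r \<in> tensor_relators S ra la M N"
    and pqr: "{p, q, r} \<subseteq> carrier M \<times> carrier N"
  shows "cls (frag_of p) = cls (frag_of q) \<oplus>\<^bsub>T\<^esub> cls (frag_of r)"
proof -
  have "cls (frag_of p) = cls (frag_of q + frag_of r)"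
  proof (rule coset_eqI)
    show "frag_of p - (frag_of q + frag_of r) \<in> N0"
      unfolding diff_diff_eq[symmetric] by (rule relator_null) (rule assms)
    show "frag_of q + frag_of r \<in> carrier F0"
      using pqr keys_add[of "frag_of q" "frag_of r"] by auto
  qed (use pqr in auto)
  also have "\<dots> = cls (frag_of q) \<oplus>\<^bsub>T\<^esub> cls (frag_of r)"
    by (rule coset_add) (use pqr in auto)
  finally show ?thesis .
qed

lemma elem_add_left: "\<lbrakk>m \<in> carrier M; m' \<in> carrier M; n \<in> carrier N\<rbrakk> \<Longrightarrow>
    el (m \<oplus>\<^bsub>M\<^esub> m') n = el m n \<oplus>\<^bsub>T\<^esub> el m' n"
  unfolding balanced_elem_def by (rule relator_add) (auto simp: tensor_relators_def)

lemma elem_add_right: "\<lbrakk>m \<in> carrier M; n \<in> carrier N; n' \<in> carrier N\<rbrakk> \<Longrightarrow>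
    el m (n \<oplus>\<^bsub>N\<^esub> n') = el m n \<oplus>\<^bsub>T\<^esub> el m n'"
  unfolding balanced_elem_def by (rule relator_add) (auto simp: tensor_relators_def)

lemma elem_balanced:
  assumes "m \<in> carrier M" "r \<in> S" "n \<in> carrier N"
  shows "el (ra m r) n = el m (la r n)"
  unfolding balanced_elem_def
proof (rule coset_eqI)
  show "frag_of (ra m r, n) - frag_of (m, la r n) \<in> N0"
    by (rule relator_null) (use assms in \<open>auto simp: tensor_relators_def\<close>)
qed (use assms in \<open>auto simp: ra_closed la_closed\<close>)

lemma elem_smult:
  assumes "c \<in> carrier K" "m \<in> carrier M" "n \<in> carrier N"
  shows "el (c \<odot>\<^bsub>M\<^esub> m) n = el m (c \<odot>\<^bsub>N\<^esub> n)"
proof -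
  obtain r where r: "r \<in> S" "\<forall>m\<in>carrier M. ra m r = c \<odot>\<^bsub>M\<^esub> m" "\<forall>n\<in>carrier N. la r n = c \<odot>\<^bsub>N\<^esub> n"
    using scalars[OF assms(1)] by blast
  show ?thesis using elem_balanced[OF assms(2) r(1) assms(3)] r(2,3) assms(2,3) by simp
qed

lemma elem_zero_left: "n \<in> carrier N \<Longrightarrow> el \<zero>\<^bsub>M\<^esub> n = \<zero>\<^bsub>T\<^esub>"
  using elem_add_left[of "\<zero>\<^bsub>M\<^esub>" "\<zero>\<^bsub>M\<^esub>" n] elem_closed[of "\<zero>\<^bsub>M\<^esub>" n]
    T.add.r_cancel_one'[of "el \<zero>\<^bsub>M\<^esub> n" "el \<zero>\<^bsub>M\<^esub> n"] by simp

lemma elem_minus_left: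
  assumes "m \<in> carrier M" "n \<in> carrier N"
  shows "el (\<ominus>\<^bsub>M\<^esub> m) n = \<ominus>\<^bsub>T\<^esub> el m n"
  using elem_add_left[of "\<ominus>\<^bsub>M\<^esub> m" m n] elem_zero_left assms elem_closed
  by (intro T.minus_equality[symmetric]) (simp_all add: M.l_neg)

text \<open>No case for negatives is needed, since the negative of an elementary tensor is
  elementary: the sign is absorbed by the first factor.\<close>

lemma T_induct [consumes 1, case_names zero elem add]:
  assumes X: "X \<in> carrier T"
    and zero: "P \<zero>\<^bsub>T\<^esub>"
    and elem: "\<And>m n. \<lbrakk>m \<in> carrier M; n \<in> carrier N\<rbrakk> \<Longrightarrow> P (el m n)"
    and add: "\<And>X Y. \<lbrakk>X \<in> carrier T; Y \<in> carrier T; P X; P Y\<rbrakk> \<Longrightarrow> P (X \<oplus>\<^bsub>T\<^esub> Y)"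
  shows "P X"
proof -
  \<comment> \<open>Formal sums are generated by differences in \<open>frag_induction\<close>, so
    the claim is carried for a formal sum and its negative together.\<close>
  let ?Q = "\<lambda>c. c \<in> carrier F0 \<and> P (cls c) \<and> P (cls (- c))"
  obtain c where c: "c \<in> carrier F0" "X = cls c"
    using T_cases[OF X] .
  have "?Q c"
  proof (rule frag_induction[where P = ?Q and S = "carrier M \<times> carrier N"])
    show "Poly_Mapping.keys c \<subseteq> carrier M \<times> carrier N" using c by simp
    show "?Q 0" using zero coset_zero by auto
    show "?Q (frag_of p)" if "p \<in> carrier M \<times> carrier N" for p
    proof -
      obtain m n where p: "p = (m, n)" "m \<in> carrier M" "n \<in> carrier N"
        using \<open>p \<in> _\<close> by auto
      have "cls (- frag_of p) = el (\<ominus>\<^bsub>M\<^esub> m) n"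
        using p coset_minus[of "frag_of p"] by (simp add: elem_minus_left) (simp add: balanced_elem_def)
      moreover have "cls (frag_of p) = el m n"
        using p by (simp add: balanced_elem_def)
      ultimately show ?thesis using p elem by simp
    qed
    show "?Q (a - b)" if a: "?Q a" and b: "?Q b" for a b
    proof -
      have cl: "- a \<in> carrier F0" "- b \<in> carrier F0" using a b by auto
      have "cls (a + - b) = cls a \<oplus>\<^bsub>T\<^esub> (cls (- b))"
        "cls (- a + b) = (cls (- a)) \<oplus>\<^bsub>T\<^esub> cls b"
        using a b cl coset_add by blast+
      moreover have "a + - b \<in> carrier F0"
        using a cl(2) keys_add[of a "- b"] by auto
      ultimately show ?thesis
        using a b cl add coset_closed by auto
    qed
  qed
  then show ?thesis using c by simp
qed

text \<open>Evaluation of formal sums kills every relator, hence is constant on the coset, and the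
  description in \<open>group_lift\<close> has exactly one solution.\<close>

lemma lift_coset:
  assumes G: "abelian_group G" and f: "balanced_additive G f" and c: "c \<in> carrier F0"
  shows "lift G f (cls c) = formal_eval (add_monoid G) (\<lambda>p. f (fst p) (snd p)) c"
proof -
  interpret G: abelian_group G by fact
  define g where "g p = f (fst p) (snd p)" for p
  let ?ev = "formal_eval (add_monoid G) g"
  note f' = f[unfolded balanced_additive_def]
  have f_closed: "f m n \<in> carrier G" if "m \<in> carrier M" "n \<in> carrier N" for m n
    using f' that by simp
  have g_closed: "g ` (carrier M \<times> carrier N) \<subseteq> carrier (add_monoid G)"
    using f_closed by (auto simp: g_def)
  have ev: "?ev \<in> hom F0 (add_monoid G)"
    by (rule comm_group.formal_eval_hom[OF G.a_comm_group g_closed])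
  have ev_frag: "?ev (frag_of (m, n)) = f m n" if "m \<in> carrier M" "n \<in> carrier N" for m n
    using comm_group.formal_eval_frag_of[OF G.a_comm_group, of g "(m, n)"] g_closed that f_closed
    by (auto simp: g_def)
  interpret ev: group_hom F0 "add_monoid G" ?ev
    by (rule group_hom.intro) (use ev in \<open>auto simp: group_hom_axioms_def G.a_group\<close>)
  have ev_diff: "?ev (a - b) = ?ev a \<oplus>\<^bsub>G\<^esub> \<ominus>\<^bsub>G\<^esub> ?ev b" if "a \<in> carrier F0" "b \<in> carrier F0" for a b
  proof -
    have "?ev (a + - b) = ?ev a \<oplus>\<^bsub>G\<^esub> ?ev (- b)"
      using ev.hom_mult[of a "- b"] that by simp
    also have "?ev (- b) = \<ominus>\<^bsub>G\<^esub> ?ev b"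
      using ev.hom_inv[of b] that by (simp add: a_inv_def)
    finally show ?thesis by simp
  qed
  have frag: "frag_of (m, n) \<in> carrier F0" if "m \<in> carrier M" "n \<in> carrier N" for m n
    using that by auto
  \<comment> \<open>The form in which the image of an additivity relator is left after sorting its
    summands.\<close>
  have cancel: "x \<oplus>\<^bsub>G\<^esub> (y \<oplus>\<^bsub>G\<^esub> (\<ominus>\<^bsub>G\<^esub> x \<oplus>\<^bsub>G\<^esub> \<ominus>\<^bsub>G\<^esub> y)) = \<zero>\<^bsub>G\<^esub>"
    if "x \<in> carrier G" "y \<in> carrier G" for x y
    using G.r_neg[of "x \<oplus>\<^bsub>G\<^esub> y"] that by (simp add: G.minus_add G.a_ac)
  have "tensor_relators S ra la M N \<subseteq> kernel F0 (add_monoid G) ?ev"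
  proof
    fix a assume a: "a \<in> tensor_relators S ra la M N"
    have "?ev a = \<zero>\<^bsub>G\<^esub>"
      using a f_closed f'
      by (auto simp: tensor_relators_def ev_diff frag diff_closed ev_frag ra_closed la_closed G.a_ac
          cancel G.r_neg simp del: carrier_free_Abelian_group_iff)
    then show "a \<in> kernel F0 (add_monoid G) ?ev"
      using subsetD[OF relators_closed a] by (simp only: kernel_def mem_Collect_eq) simp
  qed
  then have ker: "N0 \<subseteq> kernel F0 (add_monoid G) ?ev"
    unfolding tensor_null_def
    by (rule group.generate_subgroup_incl[rotated 1, OF _ ev.subgroup_kernel]) simp
  have ev_eq: "?ev d = ?ev c" if d: "d \<in> cls c" for d
  proof -
    obtain n where n: "n \<in> N0" "d = n + c"
      using d by (auto simp: r_coset_def)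
    have "n \<in> carrier F0" "?ev n = \<zero>\<^bsub>G\<^esub>"
      using n(1) ker by (auto simp: kernel_def)
    then show ?thesis
      using n(2) ev.hom_mult[of n c] c ev.hom_closed[OF c] by simp
  qed
  have self: "c \<in> cls c"
    by (rule group.rcos_self[OF _ c null_subgroup]) simp
  have "(THE x. \<exists>d\<in>cls c. x = ?ev d) = ?ev c"
  proof (rule the_equality)
    show "\<exists>d\<in>cls c. ?ev c = ?ev d" using self by blast
  qed (elim bexE, simp only: ev_eq)
  then show ?thesis
    unfolding tensor_lift_def group_lift_def formal_eval_def g_def .
qed

lemma lift_elem:
  assumes G: "abelian_group G" and f: "balanced_additive G f" and "m \<in> carrier M" "n \<in> carrier N"
  shows "lift G f (el m n) = f m n"
proof -
  interpret G: abelian_group G by fact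
  note f' = f[unfolded balanced_additive_def]
  have f_closed: "f m n \<in> carrier G" if "m \<in> carrier M" "n \<in> carrier N" for m n
    using f' that by simp
  show ?thesis
    unfolding balanced_elem_def
    using lift_coset[OF G f, of "frag_of (m, n)"] assms
      comm_group.formal_eval_frag_of[OF G.a_comm_group, of "\<lambda>p. f (fst p) (snd p)" "(m, n)"]
      f_closed
    by simp
qed

lemma lift_add_closed:
  assumes G: "abelian_group G" and f: "balanced_additive G f"
  shows "lift G f \<in> hom (add_monoid T) (add_monoid G)"
proof -
  interpret G: abelian_group G by fact
  note f' = f[unfolded balanced_additive_def]
  have f_closed: "f m n \<in> carrier G" if "m \<in> carrier M" "n \<in> carrier N" for m n
    using f' that by simp
  have ev: "formal_eval (add_monoid G) (\<lambda>p. f (fst p) (snd p)) \<in> hom F0 (add_monoid G)"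
    by (rule comm_group.formal_eval_hom[OF G.a_comm_group])
      (use f_closed in auto)
  show ?thesis
  proof (rule homI)
    fix X assume "X \<in> carrier (add_monoid T)"
    then obtain c where "c \<in> carrier F0" "X = cls c" using T_cases by auto
    then show "lift G f X \<in> carrier (add_monoid G)"
      using lift_coset[OF G f, of c] hom_in_carrier[OF ev, of c] by (simp only:)
  next
    fix X Y assume "X \<in> carrier (add_monoid T)" "Y \<in> carrier (add_monoid T)"
    then have "X \<in> carrier T" "Y \<in> carrier T" by simp_all
    then obtain c d where *: "c \<in> carrier F0" "X = cls c" "d \<in> carrier F0" "Y = cls d"
      by (elim T_cases)
    have "X \<otimes>\<^bsub>add_monoid T\<^esub> Y = cls (c + d)"
      using coset_add * by simp
    moreover have "c + d \<in> carrier F0"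
      using * keys_add[of c d] by auto
    ultimately show "lift G f (X \<otimes>\<^bsub>add_monoid T\<^esub> Y) =
        lift G f X \<otimes>\<^bsub>add_monoid G\<^esub> lift G f Y"
      using lift_coset[OF G f] * hom_mult[OF ev, of c d] by simp
  qed
qed


lemma group_lift_T:
  fixes f :: "'m \<Rightarrow> 'n \<Rightarrow> ('m, 'n) tens"
  shows "group_lift (F0 Mod N0) f X = lift T f X"
  unfolding tensor_lift_def
  by (rule group_lift_transfer) (simp_all add: T_simps del: mult_FactGroup one_FactGroup)

lemma smult_T: "c \<odot>\<^bsub>T\<^esub> X = lift T (\<lambda>m n. el (c \<odot>\<^bsub>M\<^esub> m) n) X"
proof -
  have "c \<odot>\<^bsub>T\<^esub> X = group_lift (F0 Mod N0) (\<lambda>m n. el (c \<odot>\<^bsub>M\<^esub> m) n) X"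
    by (simp add: balanced_tensor_def Let_def)
  then show ?thesis by (simp only: group_lift_T)
qed

text \<open>A scalar acting on the first factor passes the balancing action because
  \<open>ra\<close> is K-linear.\<close>

lemma smult_balanced:
  assumes "c \<in> carrier K"
  shows "balanced_additive T (\<lambda>m n. el (c \<odot>\<^bsub>M\<^esub> m) n)"
  using assms elem_balanced[symmetric] linear_maps_smult[OF ra_linear, symmetric]
  by (auto simp: balanced_additive_def elem_closed elem_add_left elem_add_right M.smult_r_distr
      la_closed ra_closed elem_balanced[symmetric])

lemma smult_elem:
  assumes "c \<in> carrier K" "m \<in> carrier M" "n \<in> carrier N"
  shows "c \<odot>\<^bsub>T\<^esub> el m n = el (c \<odot>\<^bsub>M\<^esub> m) n"
  unfolding smult_T by (rule lift_elem[OF T_abelian smult_balanced]) (use assms in auto)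

lemma smult_T_closed: "\<lbrakk>c \<in> carrier K; X \<in> carrier T\<rbrakk> \<Longrightarrow> c \<odot>\<^bsub>T\<^esub> X \<in> carrier T"
  unfolding smult_T using lift_add_closed[OF T_abelian smult_balanced] by (auto simp: hom_def)

lemma smult_T_add: "\<lbrakk>c \<in> carrier K; X \<in> carrier T; Y \<in> carrier T\<rbrakk> \<Longrightarrow>
    c \<odot>\<^bsub>T\<^esub> (X \<oplus>\<^bsub>T\<^esub> Y) = c \<odot>\<^bsub>T\<^esub> X \<oplus>\<^bsub>T\<^esub> c \<odot>\<^bsub>T\<^esub> Y"
  unfolding smult_T using lift_add_closed[OF T_abelian smult_balanced] by (auto simp: hom_def)

lemma smult_T_zero:
  assumes c: "c \<in> carrier K"
  shows "c \<odot>\<^bsub>T\<^esub> \<zero>\<^bsub>T\<^esub> = \<zero>\<^bsub>T\<^esub>"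
  using smult_T_add[OF c T.zero_closed T.zero_closed] smult_T_closed[OF c T.zero_closed]
    T.add.r_cancel_one'[of "c \<odot>\<^bsub>T\<^esub> \<zero>\<^bsub>T\<^esub>" "c \<odot>\<^bsub>T\<^esub> \<zero>\<^bsub>T\<^esub>"] by simp

lemma T_module: "module K T"
proof (rule moduleI)
  show "cring K" by (rule M.is_cring)
  show "abelian_group T" by (rule T_abelian)
next
  fix a b X assume *: "a \<in> carrier K" "b \<in> carrier K" and X: "X \<in> carrier T"
  show "(a \<oplus> b) \<odot>\<^bsub>T\<^esub> X = a \<odot>\<^bsub>T\<^esub> X \<oplus>\<^bsub>T\<^esub> b \<odot>\<^bsub>T\<^esub> X"
    using X
  proof (induction rule: T_induct)
    case (elem m n)
    then show ?case using * by (simp add: smult_elem M.smult_l_distr elem_add_left)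
  next
    case (add X Y)
    then show ?case
      using * by (simp add: smult_T_add smult_T_closed T.a_ac)
  qed (use * in \<open>simp add: smult_T_zero\<close>)
  show "(a \<otimes> b) \<odot>\<^bsub>T\<^esub> X = a \<odot>\<^bsub>T\<^esub> (b \<odot>\<^bsub>T\<^esub> X)"
    using X
  proof (induction rule: T_induct)
    case (elem m n)
    then show ?case using * by (simp add: smult_elem M.smult_assoc1)
  next
    case (add X Y)
    then show ?case
      using * by (simp add: smult_T_add smult_T_closed)
  qed (use * in \<open>simp add: smult_T_zero\<close>)
next
  fix X assume X: "X \<in> carrier T"
  show "\<one> \<odot>\<^bsub>T\<^esub> X = X"
    using X
    by (induction rule: T_induct) (simp_all add: smult_T_zero smult_elem smult_T_add)
qed (simp_all add: smult_T_closed smult_T_add)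

lemma tensor_lift_elem:
  assumes "module K G" "f \<in> balanced_maps G" "m \<in> carrier M" "n \<in> carrier N"
  shows "lift G f (el m n) = f m n"
proof -
  interpret G: module K G by fact
  show ?thesis
    using assms by (intro lift_elem balanced_maps_additive G.abelian_group_axioms)
qed

lemma tensor_lift_linear:
  assumes G: "module K G" and f: "f \<in> balanced_maps G"
  shows "lift G f \<in> linear_maps K T G"
proof -
  interpret G: module K G by fact
  interpret T: module K T by (rule T_module)
  have hom: "lift G f \<in> hom (add_monoid T) (add_monoid G)"
    using f by (intro lift_add_closed balanced_maps_additive G.abelian_group_axioms)
  have bil: "bilinear_map K M N G f" using f by (simp add: balanced_maps_def)
  have add: "lift G f (X \<oplus>\<^bsub>T\<^esub> Y) = lift G f X \<oplus>\<^bsub>G\<^esub> lift G f Y"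
    if "X \<in> carrier T" "Y \<in> carrier T" for X Y
    using hom_mult[OF hom, of X Y] that by simp
  have cl: "lift G f X \<in> carrier G" if "X \<in> carrier T" for X
    using hom_in_carrier[OF hom, of X] that by simp
  have zero: "lift G f \<zero>\<^bsub>T\<^esub> = \<zero>\<^bsub>G\<^esub>"
    using hom_one[OF hom T.a_group G.a_group] by simp
  show ?thesis
  proof (rule linear_mapsI)
    fix c X assume c: "c \<in> carrier K" and X: "X \<in> carrier T"
    show "lift G f (c \<odot>\<^bsub>T\<^esub> X) = c \<odot>\<^bsub>G\<^esub> lift G f X"
      using X
    proof (induction rule: T_induct)
      case (elem m n)
      then show ?case
        using c linear_maps_smult[OF bilinear_map_left[OF bil]]
        by (simp add: smult_elem tensor_lift_elem[OF G f])
    qed (simp_all add: zero c add cl T.smult_r_distr G.smult_r_distr)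
  qed (use add cl in auto)
qed

text \<open>Elementary tensors generate the tensor product. This is the uniqueness half of the
  universal property.\<close>

lemma tensor_eqI:
  assumes G: "module K G" and fg: "f \<in> linear_maps K T G" "g \<in> linear_maps K T G"
    and eq: "\<And>m n. \<lbrakk>m \<in> carrier M; n \<in> carrier N\<rbrakk> \<Longrightarrow> f (el m n) = g (el m n)"
    and X: "X \<in> carrier T"
  shows "f X = g X"
  using X
proof (induction rule: T_induct)
  case zero
  then show ?case using linear_maps_zero[OF fg(1) T_module G] linear_maps_zero[OF fg(2) T_module G] by simp
qed (simp_all add: eq linear_maps_add[OF fg(1)] linear_maps_add[OF fg(2)])

lemma elem_bilinear: "bilinear_map K M N T el"
  by (intro bilinear_mapI linear_mapsI)
    (simp_all add: elem_closed elem_add_left elem_add_right smult_elem elem_smult)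

text \<open>Nothing is assumed about balance: every representative of \<open>X\<close> is supported
  on pairs from the carriers, so the two descriptions coincide whether or not they are
  meaningful.\<close>

lemma tensor_lift_cong:
  assumes X: "X \<in> carrier T" and eq: "\<And>m n. \<lbrakk>m \<in> carrier M; n \<in> carrier N\<rbrakk> \<Longrightarrow> f m n = g m n"
  shows "lift G f X = lift G g X"
proof -
  obtain c where c: "c \<in> carrier F0" "X = cls c"
    using T_cases[OF X] .
  have keys: "Poly_Mapping.keys d \<subseteq> carrier M \<times> carrier N" if "d \<in> X" for d
  proof -
    have "cls c \<subseteq> carrier F0"
      by (rule monoid.r_coset_subset_G[OF group.is_monoid[OF group_free_Abelian_group]
            subgroup.subset[OF null_subgroup] c(1)])
    from subsetD[OF this that[unfolded c(2)]] show ?thesis by simp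
  qed
  have prod_eq: "finprod (add_monoid G) (\<lambda>p. f (fst p) (snd p) [^]\<^bsub>add_monoid G\<^esub> Poly_Mapping.lookup d p) (Poly_Mapping.keys d) =
      finprod (add_monoid G) (\<lambda>p. g (fst p) (snd p) [^]\<^bsub>add_monoid G\<^esub> Poly_Mapping.lookup d p) (Poly_Mapping.keys d)"
    if "d \<in> X" for d
  proof (rule finprod_cong_carrier_free)
    fix p assume "p \<in> Poly_Mapping.keys d"
    then have "fst p \<in> carrier M" "snd p \<in> carrier N" using keys[OF that] by auto
    then show "f (fst p) (snd p) [^]\<^bsub>add_monoid G\<^esub> Poly_Mapping.lookup d p =
        g (fst p) (snd p) [^]\<^bsub>add_monoid G\<^esub> Poly_Mapping.lookup d p"
      by (simp add: eq)
  qed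
  show ?thesis
    unfolding tensor_lift_def group_lift_def by (simp add: prod_eq cong: bex_cong)
qed

text \<open>A linear map may be applied inside a Sweedler sum.\<close>

lemma linear_tensor_lift:
  assumes G: "module K G" "module K G'" and \<phi>: "\<phi> \<in> linear_maps K G G'"
    and f: "f \<in> balanced_maps G" and X: "X \<in> carrier T"
  shows "\<phi> (lift G f X) = lift G' (\<lambda>a b. \<phi> (f a b)) X"
proof (rule tensor_eqI[OF G(2) _ _ _ X])
  have bil: "bilinear_map K M N G f" using f by (simp add: balanced_maps_def)
  have "bilinear_map K M N G' (\<lambda>a b. \<phi> (f a b))"
    using linear_maps_comp[OF \<phi> bilinear_map_left[OF bil]] linear_maps_comp[OF \<phi> bilinear_map_right[OF bil]]
    by (intro bilinear_mapI)
  then have f': "(\<lambda>a b. \<phi> (f a b)) \<in> balanced_maps G'"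
    using f by (simp add: balanced_maps_def)
  show "(\<lambda>X. \<phi> (lift G f X)) \<in> linear_maps K T G'"
    using linear_maps_comp[OF \<phi> tensor_lift_linear] G f by blast
  show "lift G' (\<lambda>a b. \<phi> (f a b)) \<in> linear_maps K T G'"
    using tensor_lift_linear[OF G(2) f'] .
  show "\<phi> (lift G f (el a b)) = lift G' (\<lambda>a b. \<phi> (f a b)) (el a b)"
    if "a \<in> carrier M" "b \<in> carrier N" for a b
    using that by (simp add: tensor_lift_elem[OF G(2) f'] tensor_lift_elem[OF G(1) f])
qed

text \<open>Here the integrand depends on the variable and \<open>X\<close> is fixed. Additivity and
  homogeneity in the variable are identities between linear functions of \<open>X\<close>, so they
  too can be tested on elementary tensors.\<close>

lemma linear_tensor_lift_fun:
  assumes G: "module K G" and P: "module K P" and X: "X \<in> carrier T"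
    and F: "\<And>a b. \<lbrakk>a \<in> carrier M; b \<in> carrier N\<rbrakk> \<Longrightarrow> (\<lambda>x. F x a b) \<in> linear_maps K P G"
    and bal: "\<And>x. x \<in> carrier P \<Longrightarrow> F x \<in> balanced_maps G"
  shows "(\<lambda>x. lift G (F x) X) \<in> linear_maps K P G"
proof (rule linear_mapsI)
  interpret G: module K G by fact
  interpret P: module K P by fact
  have Fl: "lift G (F x) \<in> linear_maps K T G" if "x \<in> carrier P" for x
    using tensor_lift_linear[OF G bal[OF that]] .
  fix x assume x: "x \<in> carrier P"
  show "lift G (F x) X \<in> carrier G"
    using linear_maps_closed[OF Fl[OF x] X] .
  {
    fix y assume y: "y \<in> carrier P"
    show "lift G (F (x \<oplus>\<^bsub>P\<^esub> y)) X = lift G (F x) X \<oplus>\<^bsub>G\<^esub> lift G (F y) X"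
    proof (rule tensor_eqI[OF G _ _ _ X])
      show "(\<lambda>X. lift G (F x) X \<oplus>\<^bsub>G\<^esub> lift G (F y) X) \<in> linear_maps K T G"
        using Fl[OF x] Fl[OF y]
        by (intro linear_mapsI) (auto simp: linear_maps_add linear_maps_smult linear_maps_closed
            G.smult_r_distr G.a_ac)
      fix a b assume "a \<in> carrier M" "b \<in> carrier N"
      then show "lift G (F (x \<oplus>\<^bsub>P\<^esub> y)) (el a b) =
          lift G (F x) (el a b) \<oplus>\<^bsub>G\<^esub> lift G (F y) (el a b)"
        using x y linear_maps_add[OF F] by (simp add: tensor_lift_elem[OF G bal])
    qed (use Fl x y in auto)
  next
    fix c assume c: "c \<in> carrier K"
    show "lift G (F (c \<odot>\<^bsub>P\<^esub> x)) X = c \<odot>\<^bsub>G\<^esub> lift G (F x) X"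
    proof (rule tensor_eqI[OF G _ _ _ X])
      show "(\<lambda>X. c \<odot>\<^bsub>G\<^esub> lift G (F x) X) \<in> linear_maps K T G"
        using Fl[OF x] c
        by (intro linear_mapsI) (auto simp: linear_maps_add linear_maps_smult linear_maps_closed
            G.smult_r_distr G.smult_assoc1[symmetric] M.R.m_comm)
      fix a b assume "a \<in> carrier M" "b \<in> carrier N"
      then show "lift G (F (c \<odot>\<^bsub>P\<^esub> x)) (el a b) = c \<odot>\<^bsub>G\<^esub> lift G (F x) (el a b)"
        using x c linear_maps_smult[OF F] by (simp add: tensor_lift_elem[OF G bal])
    qed (use Fl x c in auto)
  }
qed

end


section \<open>Tensor products over the ground ring\<close>

text \<open>The rules \<open>lin\<close> decide linearity of a map \<open>\<lambda>x. t\<close> by following the occurrence of \<open>x\<close>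
  down the term \<open>t\<close>.\<close>

named_theorems lin

lemma tensor_balanced_product:
  assumes "module K A" "module K B"
  shows "balanced_product K A B (carrier K) (\<lambda>a c. c \<odot>\<^bsub>A\<^esub> a) (\<lambda>c b. c \<odot>\<^bsub>B\<^esub> b)"
proof -
  interpret A: module K A by fact
  interpret B: module K B by fact
  have A: "(\<lambda>x. c \<odot>\<^bsub>A\<^esub> x) \<in> linear_maps K A A" if "c \<in> carrier K" for c
    using that by (intro linear_mapsI)
      (auto simp: A.smult_r_distr A.smult_assoc1[symmetric] A.R.m_comm)
  have B: "(\<lambda>x. c \<odot>\<^bsub>B\<^esub> x) \<in> linear_maps K B B" if "c \<in> carrier K" for c
    using that by (intro linear_mapsI)
      (auto simp: B.smult_r_distr B.smult_assoc1[symmetric] A.R.m_comm)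
  show ?thesis
    by unfold_locales (use A B in auto)
qed

lemma tensor_algebra_simps:
  fixes K A B
  defines "T \<equiv> balanced_tensor (carrier K) (\<lambda>a c. c \<odot>\<^bsub>A\<^esub> a) (\<lambda>c b. c \<odot>\<^bsub>B\<^esub> b) A B"
  shows "carrier (tensor_algebra K A B) = carrier T"
    and "add (tensor_algebra K A B) = add T"
    and "zero (tensor_algebra K A B) = zero T"
    and "smult (tensor_algebra K A B) = smult T"
  by (simp_all add: tensor_algebra_def Let_def T_def)

lemma module_transfer:
  fixes M :: "('k, 'm, 'x) module_scheme" and N :: "('k, 'm, 'y) module_scheme"
  assumes "module K M" "carrier N = carrier M" "add N = add M" "zero N = zero M" "smult N = smult M"
  shows "module K N"
proof -
  interpret M: module K M by fact
  show ?thesis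
  proof (rule moduleI)
    show "abelian_group N"
      by (rule abelian_groupI)
        (use assms M.a_assoc M.a_comm M.add.l_inv_ex in auto)
  qed (use assms M.smult_l_distr M.smult_r_distr M.smult_assoc1 M.is_cring in auto)
qed

lemma linear_maps_transfer:
  assumes "carrier M' = carrier M" "add M' = add M" "smult M' = smult M"
    and "carrier N' = carrier N" "add N' = add N" "smult N' = smult N"
  shows "linear_maps K M' N' = linear_maps K M N"
  using assms by (simp add: linear_maps_def hom_def)

lemma tensor_lift_transfer:
  fixes f :: "'c \<Rightarrow> 'd \<Rightarrow> 'g"
  assumes "carrier G' = carrier G" "add G' = add G" "zero G' = zero G"
  shows "lift G' f X = lift G f X"
  unfolding tensor_lift_def by (rule group_lift_transfer) (simp_all add: assms)

context
  fixes K :: "('k, 'r) ring_scheme" and A :: "('k, 'a, 'x) module_scheme"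
    and B :: "('k, 'b, 'y) module_scheme"
  assumes A: "module K A" and B: "module K B"
begin

interpretation bp: balanced_product K A B "carrier K" "\<lambda>a c. c \<odot>\<^bsub>A\<^esub> a" "\<lambda>c b. c \<odot>\<^bsub>B\<^esub> b"
  by (rule tensor_balanced_product[OF A B])

text \<open>Over the ground ring balance is automatic: both sides are the scalar times the value of
  \<open>f\<close>.\<close>

lemma tensor_balanced:
  assumes "bilinear_map K A B G f"
  shows "f \<in> bp.balanced_maps G"
  using assms linear_maps_smult[OF bilinear_map_left[OF assms]]
    linear_maps_smult[OF bilinear_map_right[OF assms]]
  by (intro bp.balanced_mapsI) auto

lemma tensor_module [simp, intro]: "module K (tensor_algebra K A B)"
  by (rule module_transfer[OF bp.T_module]) (simp_all add: tensor_algebra_simps)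

lemma tensor_linear_dom: "linear_maps K (tensor_algebra K A B) G = linear_maps K bp.T G"
  by (rule linear_maps_transfer) (simp_all add: tensor_algebra_simps)

lemma tensor_linear_cod: "linear_maps K G (tensor_algebra K A B) = linear_maps K G bp.T"
  by (rule linear_maps_transfer) (simp_all add: tensor_algebra_simps)

lemma tensor_elem_closed [simp, intro]:
  "\<lbrakk>a \<in> carrier A; b \<in> carrier B\<rbrakk> \<Longrightarrow> tensor_elem K A B a b \<in> carrier (tensor_algebra K A B)"
  using bp.elem_closed by (simp add: tensor_algebra_simps tensor_elem_def)

lemma lift_tensor_elem:
  assumes "module K G" "bilinear_map K A B G f" "a \<in> carrier A" "b \<in> carrier B"
  shows "lift G f (tensor_elem K A B a b) = f a b"
  using assms by (simp add: tensor_elem_def bp.tensor_lift_elem tensor_balanced)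

lemma lift_linear:
  assumes "module K G" "bilinear_map K A B G f"
  shows "lift G f \<in> linear_maps K (tensor_algebra K A B) G"
  unfolding tensor_linear_dom using assms by (intro bp.tensor_lift_linear tensor_balanced)

lemma lift_closed:
  assumes "module K G" "bilinear_map K A B G f" "X \<in> carrier (tensor_algebra K A B)"
  shows "lift G f X \<in> carrier G"
  using linear_maps_closed[OF lift_linear] assms by blast

lemma tensor_linear_eqI:
  assumes "module K G" "f \<in> linear_maps K (tensor_algebra K A B) G"
    "g \<in> linear_maps K (tensor_algebra K A B) G"
    and "\<And>a b. \<lbrakk>a \<in> carrier A; b \<in> carrier B\<rbrakk> \<Longrightarrow> f (tensor_elem K A B a b) = g (tensor_elem K A B a b)"
    and "X \<in> carrier (tensor_algebra K A B)"
  shows "f X = g X"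
  by (rule bp.tensor_eqI[OF assms(1), of f g])
    (use assms in \<open>simp_all add: tensor_linear_dom tensor_algebra_simps tensor_elem_def\<close>)

lemma tensor_elem_bilinear: "bilinear_map K A B (tensor_algebra K A B) (tensor_elem K A B)"
  using bp.elem_bilinear by (simp add: bilinear_map_def tensor_linear_cod tensor_elem_def)

lemma tensor_lift_cong:
  assumes "X \<in> carrier (tensor_algebra K A B)"
    and "\<And>a b. \<lbrakk>a \<in> carrier A; b \<in> carrier B\<rbrakk> \<Longrightarrow> f a b = g a b"
  shows "lift G f X = lift G g X"
  using assms by (intro bp.tensor_lift_cong) (auto simp: tensor_algebra_simps)

lemma linear_lift:
  assumes G: "module K G" "module K G'" and \<phi>: "\<phi> \<in> linear_maps K G G'"
    and f: "bilinear_map K A B G f" and X: "X \<in> carrier (tensor_algebra K A B)"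
  shows "\<phi> (lift G f X) = lift G' (\<lambda>a b. \<phi> (f a b)) X"
  by (rule bp.linear_tensor_lift[OF G \<phi> tensor_balanced[OF f]])
    (use X in \<open>simp add: tensor_algebra_simps\<close>)

lemma linear_lift_fun:
  assumes G: "module K G" and M: "module K M" and X: "X \<in> carrier (tensor_algebra K A B)"
    and F: "\<And>a b. \<lbrakk>a \<in> carrier A; b \<in> carrier B\<rbrakk> \<Longrightarrow> (\<lambda>x. F x a b) \<in> linear_maps K M G"
    and bil: "\<And>x. x \<in> carrier M \<Longrightarrow> bilinear_map K A B G (F x)"
  shows "(\<lambda>x. lift G (F x) X) \<in> linear_maps K M G"
  by (rule bp.linear_tensor_lift_fun[OF G M _ F tensor_balanced[OF bil]])
    (use X in \<open>simp_all add: tensor_algebra_simps\<close>)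

lemma lin_lift_var [lin]:
  assumes "module K G"
    and "\<And>a. a \<in> carrier A \<Longrightarrow> (\<lambda>b. f a b) \<in> linear_maps K B G"
    and "\<And>b. b \<in> carrier B \<Longrightarrow> (\<lambda>a. f a b) \<in> linear_maps K A G"
  shows "lift G f \<in> linear_maps K (tensor_algebra K A B) G"
  using assms by (intro lift_linear bilinear_mapI)

lemma lin_elem_left [lin]:
  "\<lbrakk>f \<in> linear_maps K M A; b \<in> carrier B\<rbrakk> \<Longrightarrow>
    (\<lambda>x. tensor_elem K A B (f x) b) \<in> linear_maps K M (tensor_algebra K A B)"
  by (rule linear_maps_comp[OF bilinear_map_left[OF tensor_elem_bilinear]])

lemma lin_elem_right [lin]:
  "\<lbrakk>f \<in> linear_maps K M B; a \<in> carrier A\<rbrakk> \<Longrightarrow>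
    (\<lambda>x. tensor_elem K A B a (f x)) \<in> linear_maps K M (tensor_algebra K A B)"
  by (rule linear_maps_comp[OF bilinear_map_right[OF tensor_elem_bilinear]])

end

text \<open>Interchange of two independent Sweedler sums. For fixed \<open>Y\<close> both sides are
  linear in \<open>X\<close>, and at an elementary \<open>X\<close> the inner sum is the
  same.\<close>

lemma lift_swap:
  assumes "module K A" "module K B" "module K C" "module K D" "module K G"
    and X: "X \<in> carrier (tensor_algebra K A B)" and Y: "Y \<in> carrier (tensor_algebra K C D)"
    and F1: "\<And>b c d. \<lbrakk>b \<in> carrier B; c \<in> carrier C; d \<in> carrier D\<rbrakk> \<Longrightarrow>
        (\<lambda>a. F a b c d) \<in> linear_maps K A G"
    and F2: "\<And>a c d. \<lbrakk>a \<in> carrier A; c \<in> carrier C; d \<in> carrier D\<rbrakk> \<Longrightarrow>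
        (\<lambda>b. F a b c d) \<in> linear_maps K B G"
    and F3: "\<And>a b d. \<lbrakk>a \<in> carrier A; b \<in> carrier B; d \<in> carrier D\<rbrakk> \<Longrightarrow>
        (\<lambda>c. F a b c d) \<in> linear_maps K C G"
    and F4: "\<And>a b c. \<lbrakk>a \<in> carrier A; b \<in> carrier B; c \<in> carrier C\<rbrakk> \<Longrightarrow>
        (\<lambda>d. F a b c d) \<in> linear_maps K D G"
  shows "lift G (\<lambda>a b. lift G (\<lambda>c d. F a b c d) Y) X =
    lift G (\<lambda>c d. lift G (\<lambda>a b. F a b c d) X) Y" (is "?f X = ?g X")
proof (rule tensor_linear_eqI[of K A B G ?f ?g, OF assms(1,2,5) _ _ _ X])
  note mods = assms(1-5)
  have bil: "bilinear_map K A B G (\<lambda>a b. lift G (\<lambda>c d. F a b c d) Y)"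
    using mods by (intro bilinear_mapI linear_lift_fun[OF mods(3,4,5) _ Y]) (auto intro: F1 F2 F3 F4)
  show "?f \<in> linear_maps K (tensor_algebra K A B) G"
    by (rule lift_linear[OF mods(1,2,5) bil])
  show "?g \<in> linear_maps K (tensor_algebra K A B) G"
    using mods by (intro linear_lift_fun[OF mods(3,4,5) _ Y] lift_linear[OF mods(1,2,5)]
        bilinear_mapI linear_lift_fun[OF mods(1,2,5)]) (auto intro: F1 F2 F3 F4)
  fix a b assume ab: "a \<in> carrier A" "b \<in> carrier B"
  show "?f (tensor_elem K A B a b) = ?g (tensor_elem K A B a b)"
    unfolding lift_tensor_elem[OF mods(1,2,5) bil ab]
    using ab by (intro tensor_lift_cong[OF mods(3,4) Y] lift_tensor_elem[OF mods(1,2,5), symmetric]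
        bilinear_mapI F1 F2) auto
qed

text \<open>Together with the next lemma it turns the coassociativity axiom, an equation between
  cosets, into a rule for iterated sums.\<close>

lemma lift_tensor_map:
  assumes mods: "module K A" "module K B" "module K C" "module K D" "module K G"
    and f: "f \<in> linear_maps K A C" and g: "g \<in> linear_maps K B D"
    and F: "bilinear_map K C D G F" and X: "X \<in> carrier (tensor_algebra K A B)"
  shows "lift G F (tensor_map K C D f g X) = lift G (\<lambda>a b. F (f a) (g b)) X"
proof -
  have "lift G F (tensor_map K C D f g X) =
      lift G (\<lambda>a b. lift G F (tensor_elem K C D (f a) (g b))) X"
    unfolding tensor_map_def using mods f g
    by (intro linear_lift[OF mods(1,2) _ mods(5) _ _ X] lift_linear F bilinear_mapI lin)
      (auto intro: linear_maps_closed)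
  also have "\<dots> = lift G (\<lambda>a b. F (f a) (g b)) X"
    by (rule tensor_lift_cong[OF mods(1,2) X], rule lift_tensor_elem[OF mods(3-5) F])
      (use f g in \<open>auto intro: linear_maps_closed\<close>)
  finally show ?thesis .
qed

lemma lift_tensor_assoc:
  assumes mods: "module K A" "module K B" "module K C" "module K G"
    and F1: "\<And>b c. \<lbrakk>b \<in> carrier B; c \<in> carrier C\<rbrakk> \<Longrightarrow> (\<lambda>a. F a b c) \<in> linear_maps K A G"
    and F2: "\<And>a c. \<lbrakk>a \<in> carrier A; c \<in> carrier C\<rbrakk> \<Longrightarrow> (\<lambda>b. F a b c) \<in> linear_maps K B G"
    and F3: "\<And>a b. \<lbrakk>a \<in> carrier A; b \<in> carrier B\<rbrakk> \<Longrightarrow> (\<lambda>c. F a b c) \<in> linear_maps K C G"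
    and X: "X \<in> carrier (tensor_algebra K (tensor_algebra K A B) C)"
  shows "lift G (\<lambda>a Y. lift G (\<lambda>b c. F a b c) Y) (tensor_assoc K A B C X) =
    lift G (\<lambda>Y c. lift G (\<lambda>a b. F a b c) Y) X"
proof -
  let ?AB = "tensor_algebra K A B" and ?BC = "tensor_algebra K B C"
  let ?T = "tensor_algebra K A ?BC"
  let ?f = "lift G (\<lambda>a Y. lift G (\<lambda>b c. F a b c) Y)"
  let ?e = "\<lambda>c. lift ?T (\<lambda>a b. tensor_elem K A ?BC a (tensor_elem K B C b c))"
  have AB: "module K ?AB" and BC: "module K ?BC" and T: "module K ?T"
    using mods by auto
  have bil: "bilinear_map K A ?BC G (\<lambda>a Y. lift G (\<lambda>b c. F a b c) Y)"
    using mods BC by (intro bilinear_mapI linear_lift_fun[OF mods(2-4)] lift_linear)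
      (auto intro: F1 F2 F3)
  have bil1: "bilinear_map K ?AB C ?T (\<lambda>Y c. lift ?T (\<lambda>a b.
      tensor_elem K A ?BC a (tensor_elem K B C b c)) Y)"
    using mods BC T AB by (intro bilinear_mapI linear_lift_fun[OF mods(1,2)] lift_linear lin linear_maps_id) auto
  have bil2: "bilinear_map K A B ?T (\<lambda>a b. tensor_elem K A ?BC a (tensor_elem K B C b c))"
    if "c \<in> carrier C" for c
    using mods BC T AB that by (intro bilinear_mapI lin linear_maps_id) auto
  have \<phi>: "?f \<in> linear_maps K ?T G"
    using lift_linear[OF mods(1) BC mods(4) bil] .
  have "?f (tensor_assoc K A B C X) =
      lift G (\<lambda>Y c. ?f
        (?e c Y)) X"
    unfolding tensor_assoc_def Let_def
    by (rule linear_lift[OF AB mods(3) T mods(4) \<phi> bil1 X])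
  also have "\<dots> = lift G (\<lambda>Y c. lift G (\<lambda>a b. F a b c) Y) X"
  proof (rule tensor_lift_cong[OF AB mods(3) X])
    fix Y c assume Y: "Y \<in> carrier ?AB" and c: "c \<in> carrier C"
    have "?f
        (?e c Y) =
      lift G (\<lambda>a b. ?f
        (tensor_elem K A ?BC a (tensor_elem K B C b c))) Y"
      by (rule linear_lift[OF mods(1,2) T mods(4) \<phi> bil2[OF c] Y])
    also have "\<dots> = lift G (\<lambda>a b. F a b c) Y"
    proof (rule tensor_lift_cong[OF mods(1,2) Y])
      fix a b assume ab: "a \<in> carrier A" "b \<in> carrier B"
      have "?f
          (tensor_elem K A ?BC a (tensor_elem K B C b c)) =
        lift G (\<lambda>b c. F a b c) (tensor_elem K B C b c)"
        using mods ab c by (intro lift_tensor_elem[OF mods(1) BC mods(4) bil]) auto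
      also have "\<dots> = F a b c"
        using ab c by (intro lift_tensor_elem[OF mods(2-4)] bilinear_mapI F2 F3)
      finally show "?f
          (tensor_elem K A ?BC a (tensor_elem K B C b c)) = F a b c" .
    qed
    finally show "?f
        (?e c Y) =
      lift G (\<lambda>a b. F a b c) Y" .
  qed
  finally show ?thesis .
qed


text \<open>This makes the multiplicativity of a coproduct or coaction usable: a sum over the legs
  of a product becomes a double sum over the legs of its factors.\<close>

lemma lift_tensor_mult:
  assumes alg: "assoc_algebra K A" "assoc_algebra K B" and G: "module K G"
    and F: "bilinear_map K A B G F"
    and X: "X \<in> carrier (tensor_algebra K A B)" and Y: "Y \<in> carrier (tensor_algebra K A B)"
  shows "lift G F (X \<otimes>\<^bsub>tensor_algebra K A B\<^esub> Y) =
    lift G (\<lambda>a b. lift G (\<lambda>a' b'. F (a \<otimes>\<^bsub>A\<^esub> a') (b \<otimes>\<^bsub>B\<^esub> b')) Y) X"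
proof -
  interpret A: assoc_algebra K A by fact
  interpret B: assoc_algebra K B by fact
  have mods: "module K A" "module K B" by unfold_locales
  let ?T = "tensor_algebra K A B"
  have T: "module K ?T" using mods by auto
  have A1: "(\<lambda>x. x \<otimes>\<^bsub>A\<^esub> y) \<in> linear_maps K A A" "(\<lambda>x. y \<otimes>\<^bsub>A\<^esub> x) \<in> linear_maps K A A"
    if "y \<in> carrier A" for y
    using that by (auto intro!: linear_mapsI simp: A.smult_mult_left A.smult_mult_right A.l_distr A.r_distr)
  have B1: "(\<lambda>x. x \<otimes>\<^bsub>B\<^esub> y) \<in> linear_maps K B B" "(\<lambda>x. y \<otimes>\<^bsub>B\<^esub> x) \<in> linear_maps K B B"
    if "y \<in> carrier B" for y
    using that by (auto intro!: linear_mapsI simp: B.smult_mult_left B.smult_mult_right B.l_distr B.r_distr)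
  define P where "P = (\<lambda>a b a' b'. tensor_elem K A B (a \<otimes>\<^bsub>A\<^esub> a') (b \<otimes>\<^bsub>B\<^esub> b'))"
  have P: "bilinear_map K A B ?T (P a b)" if "a \<in> carrier A" "b \<in> carrier B" for a b
    unfolding P_def using that mods by (auto intro!: bilinear_mapI lin A1 B1)
  have P': "bilinear_map K A B ?T (\<lambda>a b. P a b a' b')" if "a' \<in> carrier A" "b' \<in> carrier B" for a' b'
    unfolding P_def using that mods by (auto intro!: bilinear_mapI lin A1 B1)
  have bil: "bilinear_map K A B ?T (\<lambda>a b. lift ?T (P a b) Y)"
    by (intro bilinear_mapI linear_lift_fun[OF mods T _ Y] bilinear_map_left[OF P'] bilinear_map_right[OF P'] P)
      (use mods in auto)
  have \<phi>: "lift G F \<in> linear_maps K ?T G"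
    by (rule lift_linear[OF mods G F])
  have mult: "X \<otimes>\<^bsub>?T\<^esub> Y = lift ?T (\<lambda>a b. lift ?T (P a b) Y) X"
    unfolding P_def by (simp add: tensor_algebra_def Let_def tensor_lift_def)
  have "lift G F (X \<otimes>\<^bsub>?T\<^esub> Y) = lift G (\<lambda>a b. lift G F (lift ?T (P a b) Y)) X"
    unfolding mult by (rule linear_lift[OF mods T G \<phi> bil X])
  also have "\<dots> = lift G (\<lambda>a b. lift G (\<lambda>a' b'. lift G F (P a b a' b')) Y) X"
    by (intro tensor_lift_cong[OF mods X] linear_lift[OF mods T G \<phi> P Y])
  also have "\<dots> = lift G (\<lambda>a b. lift G (\<lambda>a' b'. F (a \<otimes>\<^bsub>A\<^esub> a') (b \<otimes>\<^bsub>B\<^esub> b')) Y) X"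
    unfolding P_def by (intro tensor_lift_cong[OF mods] X Y lift_tensor_elem[OF mods G F]) auto
  finally show ?thesis .
qed

section \<open>Maps out of a threefold tensor product over the ground ring\<close>

definition trilinear_map ::
  "('k, 'r) ring_scheme \<Rightarrow> ('k, 'a, 'x) module_scheme \<Rightarrow> ('k, 'b, 'y) module_scheme \<Rightarrow>
    ('k, 'c, 'z) module_scheme \<Rightarrow> ('k, 'g, 'w) module_scheme \<Rightarrow> ('a \<Rightarrow> 'b \<Rightarrow> 'c \<Rightarrow> 'g) \<Rightarrow> bool" where
  "trilinear_map K A B C G F \<longleftrightarrow>
     (\<forall>b\<in>carrier B. \<forall>c\<in>carrier C. (\<lambda>a. F a b c) \<in> linear_maps K A G) \<and>
     (\<forall>a\<in>carrier A. \<forall>c\<in>carrier C. (\<lambda>b. F a b c) \<in> linear_maps K B G) \<and>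
     (\<forall>a\<in>carrier A. \<forall>b\<in>carrier B. (\<lambda>c. F a b c) \<in> linear_maps K C G)"

lemma trilinear_mapI:
  assumes "\<And>b c. \<lbrakk>b \<in> carrier B; c \<in> carrier C\<rbrakk> \<Longrightarrow> (\<lambda>a. F a b c) \<in> linear_maps K A G"
    and "\<And>a c. \<lbrakk>a \<in> carrier A; c \<in> carrier C\<rbrakk> \<Longrightarrow> (\<lambda>b. F a b c) \<in> linear_maps K B G"
    and "\<And>a b. \<lbrakk>a \<in> carrier A; b \<in> carrier B\<rbrakk> \<Longrightarrow> (\<lambda>c. F a b c) \<in> linear_maps K C G"
  shows "trilinear_map K A B C G F"
  using assms by (simp add: trilinear_map_def)

lemma trilinear_map_slice:
  assumes "trilinear_map K A B C G F" "c \<in> carrier C"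
  shows "bilinear_map K A B G (\<lambda>a b. F a b c)"
  using assms by (auto simp: trilinear_map_def intro: bilinear_mapI)

context
  fixes K :: "('k, 'r) ring_scheme" and A :: "('k, 'a, 'x) module_scheme"
    and B :: "('k, 'b, 'y) module_scheme" and C :: "('k, 'c, 'z) module_scheme"
  assumes A: "module K A" and B: "module K B" and C: "module K C"
begin

abbreviation (input) "ABC \<equiv> tensor_algebra K (tensor_algebra K A B) C"

lemma trilinear_lift_bilinear:
  assumes G: "module K G" and F: "trilinear_map K A B C G F"
  shows "bilinear_map K (tensor_algebra K A B) C G (\<lambda>X c. lift G (\<lambda>a b. F a b c) X)"
proof (rule bilinear_mapI)
  fix X assume X: "X \<in> carrier (tensor_algebra K A B)"
  show "(\<lambda>c. lift G (\<lambda>a b. F a b c) X) \<in> linear_maps K C G"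
    by (rule linear_lift_fun[OF A B G C X])
      (use F trilinear_map_slice[OF F] in \<open>auto simp: trilinear_map_def\<close>)
next
  fix c assume "c \<in> carrier C"
  then show "(\<lambda>X. lift G (\<lambda>a b. F a b c) X) \<in> linear_maps K (tensor_algebra K A B) G"
    using lift_linear[OF A B G trilinear_map_slice[OF F]] by blast
qed

lemma triple_lift_elem:
  assumes "module K G" "trilinear_map K A B C G F" "a \<in> carrier A" "b \<in> carrier B" "c \<in> carrier C"
  shows "triple_lift G F (tensor_elem K (tensor_algebra K A B) C (tensor_elem K A B a b) c) = F a b c"
  using assms A B C
  by (simp add: triple_lift_def lift_tensor_elem[OF tensor_module[OF A B] C] trilinear_lift_bilinear
      lift_tensor_elem[OF A B] trilinear_map_slice)

lemma triple_lift_linear: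
  assumes "module K G" "trilinear_map K A B C G F"
  shows "triple_lift G F \<in> linear_maps K (ABC) G"
  unfolding triple_lift_def
  by (rule lift_linear[OF tensor_module[OF A B] C assms(1) trilinear_lift_bilinear[OF assms]])

lemma triple_linear_eqI:
  assumes G: "module K G"
    and fg: "f \<in> linear_maps K (ABC) G"
      "g \<in> linear_maps K (ABC) G"
    and eq: "\<And>a b c. \<lbrakk>a \<in> carrier A; b \<in> carrier B; c \<in> carrier C\<rbrakk> \<Longrightarrow>
      f (tensor_elem K (tensor_algebra K A B) C (tensor_elem K A B a b) c) =
      g (tensor_elem K (tensor_algebra K A B) C (tensor_elem K A B a b) c)"
    and X: "X \<in> carrier (ABC)"
  shows "f X = g X"
proof (rule tensor_linear_eqI[OF tensor_module[OF A B] C G fg _ X])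
  fix Y c assume Y: "Y \<in> carrier (tensor_algebra K A B)" and c: "c \<in> carrier C"
  have l: "(\<lambda>Y. tensor_elem K (tensor_algebra K A B) C Y c) \<in>
      linear_maps K (tensor_algebra K A B) (ABC)"
    using lin_elem_left[OF tensor_module[OF A B] C linear_maps_id c] .
  show "f (tensor_elem K (tensor_algebra K A B) C Y c) = g (tensor_elem K (tensor_algebra K A B) C Y c)"
    by (rule tensor_linear_eqI[OF A B G linear_maps_comp[OF fg(1) l] linear_maps_comp[OF fg(2) l] _ Y])
      (use eq c in auto)
qed

lemma triple_lift_cong:
  assumes X: "X \<in> carrier (ABC)"
    and eq: "\<And>a b c. \<lbrakk>a \<in> carrier A; b \<in> carrier B; c \<in> carrier C\<rbrakk> \<Longrightarrow> F a b c = F' a b c"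
  shows "triple_lift G F X = triple_lift G F' X"
  unfolding triple_lift_def
  by (intro tensor_lift_cong[OF tensor_module[OF A B] C X] tensor_lift_cong[OF A B] eq)

lemma triple_linear_lift_fun:
  assumes G: "module K G" and M: "module K M"
    and X: "X \<in> carrier (ABC)"
    and F: "\<And>a b c. \<lbrakk>a \<in> carrier A; b \<in> carrier B; c \<in> carrier C\<rbrakk> \<Longrightarrow> (\<lambda>x. F x a b c) \<in> linear_maps K M G"
    and tri: "\<And>x. x \<in> carrier M \<Longrightarrow> trilinear_map K A B C G (F x)"
  shows "(\<lambda>x. triple_lift G (F x) X) \<in> linear_maps K M G"
  unfolding triple_lift_def
  by (intro linear_lift_fun[OF tensor_module[OF A B] C G M X] linear_lift_fun[OF A B G M]
      trilinear_lift_bilinear[OF G] tri F) (auto intro: trilinear_map_slice[OF tri])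

end


section \<open>Linearity of algebra operations\<close>

lemma lin_mult_left [lin]:
  assumes "assoc_algebra K A" "f \<in> linear_maps K M A" "b \<in> carrier A"
  shows "(\<lambda>x. f x \<otimes>\<^bsub>A\<^esub> b) \<in> linear_maps K M A"
proof -
  interpret A: assoc_algebra K A by fact
  show ?thesis
    using assms(2,3) by (intro linear_mapsI)
      (auto simp: linear_maps_add linear_maps_smult linear_maps_closed A.l_distr A.smult_mult_left)
qed

lemma lin_mult_right [lin]:
  assumes "assoc_algebra K A" "f \<in> linear_maps K M A" "b \<in> carrier A"
  shows "(\<lambda>x. b \<otimes>\<^bsub>A\<^esub> f x) \<in> linear_maps K M A"
proof -
  interpret A: assoc_algebra K A by fact
  show ?thesis
    using assms(2,3) by (intro linear_mapsI)
      (auto simp: linear_maps_add linear_maps_smult linear_maps_closed A.r_distr A.smult_mult_right)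
qed

lemma ground_algebra_simps [simp]:
  "carrier (ground_algebra K) = carrier K"
  "a \<otimes>\<^bsub>ground_algebra K\<^esub> b = a \<otimes>\<^bsub>K\<^esub> b"
  "a \<oplus>\<^bsub>ground_algebra K\<^esub> b = a \<oplus>\<^bsub>K\<^esub> b"
  "a \<odot>\<^bsub>ground_algebra K\<^esub> b = a \<otimes>\<^bsub>K\<^esub> b"
  "\<one>\<^bsub>ground_algebra K\<^esub> = \<one>\<^bsub>K\<^esub>"
  "\<zero>\<^bsub>ground_algebra K\<^esub> = \<zero>\<^bsub>K\<^esub>"
  by (simp_all add: ground_algebra_def ring.defs module.defs)

text \<open>The pairing axioms sum in the ring K, the linear calculus needs K as a module over
  itself; the additive groups are the same.\<close>

lemma tensor_lift_ground:
  fixes f :: "'c \<Rightarrow> 'd \<Rightarrow> 'k"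
  shows "lift (ground_algebra K) f X = lift K f X"
  by (rule tensor_lift_transfer) (auto simp: fun_eq_iff)

lemma ground_module:
  assumes "cring K"
  shows "module K (ground_algebra K)"
proof -
  interpret K: cring K by fact
  show ?thesis
  proof (rule moduleI)
    show "abelian_group (ground_algebra K)"
      by (rule abelian_groupI) (auto simp: K.a_ac intro: K.add.l_inv_ex)
  qed (auto simp: K.is_cring K.l_distr K.r_distr K.m_assoc)
qed

lemma lin_smult_left [lin]:
  assumes "module K A" "f \<in> linear_maps K M (ground_algebra K)" "a \<in> carrier A"
  shows "(\<lambda>x. f x \<odot>\<^bsub>A\<^esub> a) \<in> linear_maps K M A"
proof -
  interpret A: module K A by fact
  show ?thesis
    using assms(2,3) linear_maps_closed[OF assms(2)] by (intro linear_mapsI)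
      (auto simp: linear_maps_add linear_maps_smult A.smult_l_distr A.smult_assoc1)
qed

lemma lin_smult_right [lin]:
  assumes "module K A" "f \<in> linear_maps K M A" "c \<in> carrier K"
  shows "(\<lambda>x. c \<odot>\<^bsub>A\<^esub> f x) \<in> linear_maps K M A"
proof -
  interpret A: module K A by fact
  show ?thesis
    using assms(2,3) linear_maps_closed[OF assms(2)] by (intro linear_mapsI)
      (auto simp: linear_maps_add linear_maps_smult A.smult_r_distr A.smult_assoc1[symmetric] A.R.m_comm)
qed

lemma lin_ground_mult_left [lin]:
  assumes "cring K" "f \<in> linear_maps K M (ground_algebra K)" "c \<in> carrier K"
  shows "(\<lambda>x. f x \<otimes>\<^bsub>K\<^esub> c) \<in> linear_maps K M (ground_algebra K)"
proof -
  interpret R: cring K by fact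
  show ?thesis
    using assms(2,3) linear_maps_closed[OF assms(2)] by (intro linear_mapsI)
      (auto simp: linear_maps_add linear_maps_smult R.l_distr R.m_assoc)
qed

lemma lin_ground_mult_right [lin]:
  assumes "cring K" "f \<in> linear_maps K M (ground_algebra K)" "c \<in> carrier K"
  shows "(\<lambda>x. c \<otimes>\<^bsub>K\<^esub> f x) \<in> linear_maps K M (ground_algebra K)"
proof -
  interpret R: cring K by fact
  show ?thesis
    using assms(2,3) linear_maps_closed[OF assms(2)] by (intro linear_mapsI)
      (auto simp: linear_maps_add linear_maps_smult R.r_distr R.m_lcomm)
qed


section \<open>Sweedler calculus\<close>

text \<open>The double-sum version, in the shape of a product in B, where the legs of two coactions
  are summed independently.\<close>

lemma linear_lift2:
  assumes mods: "module K A" "module K B" "module K C" "module K D" "module K G" "module K G'"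
    and \<phi>: "\<phi> \<in> linear_maps K G G'"
    and X: "X \<in> carrier (tensor_algebra K A B)" and Y: "Y \<in> carrier (tensor_algebra K C D)"
    and F1: "\<And>b c d. \<lbrakk>b \<in> carrier B; c \<in> carrier C; d \<in> carrier D\<rbrakk> \<Longrightarrow>
        (\<lambda>a. F a b c d) \<in> linear_maps K A G"
    and F2: "\<And>a c d. \<lbrakk>a \<in> carrier A; c \<in> carrier C; d \<in> carrier D\<rbrakk> \<Longrightarrow>
        (\<lambda>b. F a b c d) \<in> linear_maps K B G"
    and F3: "\<And>a b d. \<lbrakk>a \<in> carrier A; b \<in> carrier B; d \<in> carrier D\<rbrakk> \<Longrightarrow>
        (\<lambda>c. F a b c d) \<in> linear_maps K C G"
    and F4: "\<And>a b c. \<lbrakk>a \<in> carrier A; b \<in> carrier B; c \<in> carrier C\<rbrakk> \<Longrightarrow>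
        (\<lambda>d. F a b c d) \<in> linear_maps K D G"
  shows "\<phi> (lift G (\<lambda>a b. lift G (\<lambda>c d. F a b c d) Y) X) =
    lift G' (\<lambda>a b. lift G' (\<lambda>c d. \<phi> (F a b c d)) Y) X"
proof -
  have "\<phi> (lift G (\<lambda>a b. lift G (\<lambda>c d. F a b c d) Y) X) =
      lift G' (\<lambda>a b. \<phi> (lift G (\<lambda>c d. F a b c d) Y)) X"
    by (intro linear_lift[OF mods(1,2,5,6) \<phi> _ X] bilinear_mapI
        linear_lift_fun[OF mods(3,4,5) _ Y] mods F1 F2 F3 F4)
  also have "\<dots> = lift G' (\<lambda>a b. lift G' (\<lambda>c d. \<phi> (F a b c d)) Y) X"
    by (intro tensor_lift_cong[OF mods(1,2) X] linear_lift[OF mods(3,4,5,6) \<phi> _ Y] bilinear_mapI F3 F4)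
  finally show ?thesis .
qed

text \<open>Only the bialgebra part of H is recorded. Coproducts and coactions then share one
  calculus, since a Hopf algebra is a left comodule algebra over itself.\<close>

locale comodule_algebra =
  fixes K :: "'k ring" and H :: "('k, 'h) hopf"
    and L :: "('k, 'l, 'x) module_scheme" and coact :: "'l \<Rightarrow> ('h, 'l) tens"
  assumes H_algebra: "assoc_algebra K H"
    and H_comult_linear: "comult H \<in> linear_maps K H (tensor_algebra K H H)"
    and H_counit_linear: "counit H \<in> linear_maps K H (ground_algebra K)"
    and L_algebra: "assoc_algebra K L"
    and coact_hom: "coact \<in> algebra_homs K L (tensor_algebra K H L)"
    and coact_coassoc': "l \<in> carrier L \<Longrightarrow>
      tensor_assoc K H H L (tensor_map K (tensor_algebra K H H) L (comult H) id (coact l)) =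
      tensor_map K H (tensor_algebra K H L) id coact (coact l)"
    and coact_counit': "l \<in> carrier L \<Longrightarrow>
      lift L (\<lambda>h m. counit H h \<odot>\<^bsub>L\<^esub> m) (coact l) = l"
begin

interpretation H: assoc_algebra K H by (rule H_algebra)
interpretation L: assoc_algebra K L by (rule L_algebra)

lemma H_module: "module K H" and L_module: "module K L" by unfold_locales

lemma H_counit_closed: "x \<in> carrier H \<Longrightarrow> counit H x \<in> carrier K"
  using linear_maps_closed[OF H_counit_linear] by simp

lemma coact_linear: "coact \<in> linear_maps K L (tensor_algebra K H L)"
  using coact_hom by (simp add: algebra_homs_def)

lemma coact_closed: "x \<in> carrier L \<Longrightarrow> coact x \<in> carrier (tensor_algebra K H L)"
  using linear_maps_closed[OF coact_linear] .

lemma lin_coact [lin]: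
  assumes "module K G"
    and "\<And>a. a \<in> carrier H \<Longrightarrow> (\<lambda>b. F a b) \<in> linear_maps K L G"
    and "\<And>b. b \<in> carrier L \<Longrightarrow> (\<lambda>a. F a b) \<in> linear_maps K H G"
    and "f \<in> linear_maps K M L"
  shows "(\<lambda>x. lift G F (coact (f x))) \<in> linear_maps K M G"
  by (rule linear_maps_comp[OF lin_lift_var[OF H_module L_module assms(1-3)]
        linear_maps_comp[OF coact_linear assms(4)]])

lemma lin_coact_fun [lin]:
  assumes "module K G" "module K M" "u \<in> carrier L"
    and "\<And>a b. \<lbrakk>a \<in> carrier H; b \<in> carrier L\<rbrakk> \<Longrightarrow> (\<lambda>x. F x a b) \<in> linear_maps K M G"
    and "\<And>x b. \<lbrakk>x \<in> carrier M; b \<in> carrier L\<rbrakk> \<Longrightarrow> (\<lambda>a. F x a b) \<in> linear_maps K H G"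
    and "\<And>x a. \<lbrakk>x \<in> carrier M; a \<in> carrier H\<rbrakk> \<Longrightarrow> (\<lambda>b. F x a b) \<in> linear_maps K L G"
  shows "(\<lambda>x. lift G (F x) (coact u)) \<in> linear_maps K M G"
  by (rule linear_lift_fun[OF H_module L_module assms(1,2) coact_closed[OF assms(3)] assms(4)])
    (auto intro: bilinear_mapI assms(5,6))

lemma coact_cong:
  assumes "u \<in> carrier L" "\<And>a b. \<lbrakk>a \<in> carrier H; b \<in> carrier L\<rbrakk> \<Longrightarrow> F a b = F' a b"
  shows "lift G F (coact u) = lift G F' (coact u)"
  by (rule tensor_lift_cong[OF H_module L_module coact_closed[OF assms(1)] assms(2)])

lemma linear_coact:
  assumes "\<phi> \<in> linear_maps K G G'" "module K G" "module K G'" "u \<in> carrier L"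
    and "\<And>a. a \<in> carrier H \<Longrightarrow> (\<lambda>b. F a b) \<in> linear_maps K L G"
    and "\<And>b. b \<in> carrier L \<Longrightarrow> (\<lambda>a. F a b) \<in> linear_maps K H G"
  shows "\<phi> (lift G F (coact u)) = lift G' (\<lambda>a b. \<phi> (F a b)) (coact u)"
  by (intro linear_lift[OF H_module L_module assms(2,3,1)] bilinear_mapI assms coact_closed)

text \<open>The linear map \<open>f\<close> allows the counit law to be used in the middle of a
  larger expression.\<close>

lemma coact_counit:
  assumes G: "module K G" and f: "f \<in> linear_maps K L G" and u: "u \<in> carrier L"
  shows "lift G (\<lambda>y z. counit H y \<odot>\<^bsub>G\<^esub> f z) (coact u) = f u"
proof -
  have "f u = f (lift L (\<lambda>y z. counit H y \<odot>\<^bsub>L\<^esub> z) (coact u))"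
    using coact_counit'[OF u] by simp
  also have "\<dots> = lift G (\<lambda>y z. f (counit H y \<odot>\<^bsub>L\<^esub> z)) (coact u)"
    by (intro linear_coact[OF f L_module G u] linear_maps_comp[OF f] lin linear_maps_id L_module H_counit_linear)
      (auto intro: H_counit_closed)
  also have "\<dots> = lift G (\<lambda>y z. counit H y \<odot>\<^bsub>G\<^esub> f z) (coact u)"
    by (rule coact_cong[OF u]) (simp add: linear_maps_smult[OF f] H_counit_closed)
  finally show ?thesis by simp
qed

lemma coact_mult:
  assumes G: "module K G" and xy: "x \<in> carrier L" "y \<in> carrier L"
    and F: "\<And>a. a \<in> carrier H \<Longrightarrow> (\<lambda>b. F a b) \<in> linear_maps K L G"
      "\<And>b. b \<in> carrier L \<Longrightarrow> (\<lambda>a. F a b) \<in> linear_maps K H G"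
  shows "lift G F (coact (x \<otimes>\<^bsub>L\<^esub> y)) =
    lift G (\<lambda>x1 x2. lift G (\<lambda>y1 y2. F (x1 \<otimes>\<^bsub>H\<^esub> y1) (x2 \<otimes>\<^bsub>L\<^esub> y2)) (coact y)) (coact x)"
proof -
  have "coact (x \<otimes>\<^bsub>L\<^esub> y) = coact x \<otimes>\<^bsub>tensor_algebra K H L\<^esub> coact y"
    using coact_hom xy by (auto simp: algebra_homs_def ring_hom_def)
  moreover have "bilinear_map K H L G F"
    by (intro bilinear_mapI F)
  ultimately show ?thesis
    using lift_tensor_mult[OF H_algebra L_algebra G _ coact_closed[OF xy(1)] coact_closed[OF xy(2)], of F]
    by simp
qed

lemma coact_one:
  assumes G: "module K G"
    and F: "\<And>a. a \<in> carrier H \<Longrightarrow> (\<lambda>b. F a b) \<in> linear_maps K L G"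
      "\<And>b. b \<in> carrier L \<Longrightarrow> (\<lambda>a. F a b) \<in> linear_maps K H G"
  shows "lift G F (coact \<one>\<^bsub>L\<^esub>) = F \<one>\<^bsub>H\<^esub> \<one>\<^bsub>L\<^esub>"
proof -
  have "coact \<one>\<^bsub>L\<^esub> = tensor_elem K H L \<one>\<^bsub>H\<^esub> \<one>\<^bsub>L\<^esub>"
    using coact_hom by (auto simp: algebra_homs_def ring_hom_def tensor_algebra_def Let_def)
  then show ?thesis
    by (simp add: lift_tensor_elem[OF H_module L_module G] bilinear_mapI F)
qed

text \<open>In Sweedler notation both sides run over one threefold tensor in H \<otimes> H \<otimes>
  L; the left splits the H-leg of the coaction, the right its L-leg.\<close>

lemma coact_coassoc:
  assumes G: "module K G" and u: "u \<in> carrier L"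
    and F1: "\<And>b c. \<lbrakk>b \<in> carrier H; c \<in> carrier L\<rbrakk> \<Longrightarrow> (\<lambda>a. F a b c) \<in> linear_maps K H G"
    and F2: "\<And>a c. \<lbrakk>a \<in> carrier H; c \<in> carrier L\<rbrakk> \<Longrightarrow> (\<lambda>b. F a b c) \<in> linear_maps K H G"
    and F3: "\<And>a b. \<lbrakk>a \<in> carrier H; b \<in> carrier H\<rbrakk> \<Longrightarrow> (\<lambda>c. F a b c) \<in> linear_maps K L G"
  shows "lift G (\<lambda>x y. lift G (\<lambda>a b. F a b y) (comult H x)) (coact u) =
    lift G (\<lambda>x y. lift G (\<lambda>a b. F x a b) (coact y)) (coact u)"
proof -
  let ?HH = "tensor_algebra K H H" and ?HL = "tensor_algebra K H L"
  note H = H_module and L = L_module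
  have m: "module K ?HH" "module K ?HL" using H L by auto
  have tri: "trilinear_map K H H L G F" by (intro trilinear_mapI F1 F2 F3)
  have bil1: "bilinear_map K ?HH L G (\<lambda>Y c. lift G (\<lambda>a b. F a b c) Y)"
    by (rule trilinear_lift_bilinear[OF H H L G tri])
  have bil2: "bilinear_map K H ?HL G (\<lambda>a Y. lift G (\<lambda>b c. F a b c) Y)"
    by (intro bilinear_mapI linear_lift_fun[OF H L G] lift_linear H L G F1 F2 F3)
  have X: "tensor_map K ?HH L (comult H) id (coact u) \<in> carrier (tensor_algebra K ?HH L)"
    unfolding tensor_map_def
    by (intro lift_closed[OF H L] bilinear_mapI lin m L H_comult_linear linear_maps_closed[OF H_comult_linear] u
        tensor_module coact_closed) (auto intro: linear_maps_id)
  have "lift G (\<lambda>x y. lift G (\<lambda>a b. F a b y) (comult H x)) (coact u) =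
      lift G (\<lambda>Y c. lift G (\<lambda>a b. F a b c) Y) (tensor_map K ?HH L (comult H) id (coact u))"
    using lift_tensor_map[OF H L m(1) L G H_comult_linear _ bil1 coact_closed[OF u], of id]
      linear_maps_id[of K L] by (simp add: id_def)
  also have "\<dots> = lift G (\<lambda>a Y. lift G (\<lambda>b c. F a b c) Y)
      (tensor_assoc K H H L (tensor_map K ?HH L (comult H) id (coact u)))"
    by (rule lift_tensor_assoc[OF H H L G F1 F2 F3 X, symmetric])
  also have "\<dots> = lift G (\<lambda>x y. lift G (\<lambda>a b. F x a b) (coact y)) (coact u)"
    unfolding coact_coassoc'[OF u]
    using lift_tensor_map[OF H L H m(2) G _ coact_linear bil2 coact_closed[OF u], of id]
      linear_maps_id[of K H] by (simp add: id_def)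
  finally show ?thesis .
qed

lemma coact_swap:
  assumes "module K G" "u \<in> carrier L" "v \<in> carrier L"
    and "\<And>b c d. \<lbrakk>b \<in> carrier L; c \<in> carrier H; d \<in> carrier L\<rbrakk> \<Longrightarrow>
        (\<lambda>a. F a b c d) \<in> linear_maps K H G"
    and "\<And>a c d. \<lbrakk>a \<in> carrier H; c \<in> carrier H; d \<in> carrier L\<rbrakk> \<Longrightarrow>
        (\<lambda>b. F a b c d) \<in> linear_maps K L G"
    and "\<And>a b d. \<lbrakk>a \<in> carrier H; b \<in> carrier L; d \<in> carrier L\<rbrakk> \<Longrightarrow>
        (\<lambda>c. F a b c d) \<in> linear_maps K H G"
    and "\<And>a b c. \<lbrakk>a \<in> carrier H; b \<in> carrier L; c \<in> carrier H\<rbrakk> \<Longrightarrow>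
        (\<lambda>d. F a b c d) \<in> linear_maps K L G"
  shows "lift G (\<lambda>a b. lift G (\<lambda>c d. F a b c d) (coact v)) (coact u) =
    lift G (\<lambda>c d. lift G (\<lambda>a b. F a b c d) (coact u)) (coact v)"
  by (rule lift_swap[OF H_module L_module H_module L_module assms(1)
        coact_closed[OF assms(2)] coact_closed[OF assms(3)] assms(4-7)])

end

text \<open>The regular coaction of a Hopf algebra on itself; the rules for \<open>coact\<close> are
  reused below under names beginning with \<open>comult\<close>.\<close>

sublocale hopf_algebra \<subseteq> self: comodule_algebra K A A "comult A"
proof (intro comodule_algebra.intro)
  show "comult A \<in> linear_maps K A (tensor_algebra K A A)" "counit A \<in> linear_maps K A (ground_algebra K)"
    using comult_hom counit_hom by (simp_all add: algebra_homs_def)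
qed (fact assoc_algebra comult_hom coassoc counit_left)+

context hopf_algebra
begin

interpretation alg: assoc_algebra K A by (rule assoc_algebra)

lemmas hopf_module = self.H_module
lemmas comult_linear = self.H_comult_linear
lemmas comult_closed = self.coact_closed
lemmas counit_linear = self.H_counit_linear
lemmas counit_closed = self.H_counit_closed
lemmas comult_cong = self.coact_cong
lemmas linear_comult = self.linear_coact
lemmas comult_counit_left = self.coact_counit
lemmas comult_mult = self.coact_mult
lemmas comult_one = self.coact_one
lemmas comult_coassoc = self.coact_coassoc

lemma ground: "module K (ground_algebra K)"
  by (rule ground_module) (rule alg.is_cring)

lemma counit_mult: "\<lbrakk>x \<in> carrier A; y \<in> carrier A\<rbrakk> \<Longrightarrow> counit A (x \<otimes>\<^bsub>A\<^esub> y) = counit A x \<otimes>\<^bsub>K\<^esub> counit A y"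
  using counit_hom by (auto simp: algebra_homs_def ring_hom_def)

lemma counit_one: "counit A \<one>\<^bsub>A\<^esub> = \<one>\<^bsub>K\<^esub>"
  using counit_hom by (auto simp: algebra_homs_def ring_hom_def)

lemma lin_counit [lin]: "f \<in> linear_maps K M A \<Longrightarrow> (\<lambda>x. counit A (f x)) \<in> linear_maps K M (ground_algebra K)"
  by (rule linear_maps_comp[OF counit_linear])

text \<open>The comodule law supplies the counit on the first leg only; the law for the second leg
  is special to the coproduct.\<close>

lemma comult_counit_right:
  assumes G: "module K G" and f: "f \<in> linear_maps K A G" and u: "u \<in> carrier A"
  shows "lift G (\<lambda>y z. counit A z \<odot>\<^bsub>G\<^esub> f y) (comult A u) = f u"
proof -
  have "f u = f (lift A (\<lambda>y z. counit A z \<odot>\<^bsub>A\<^esub> y) (comult A u))"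
    using counit_right[OF u] by simp
  also have "\<dots> = lift G (\<lambda>y z. f (counit A z \<odot>\<^bsub>A\<^esub> y)) (comult A u)"
    by (intro linear_comult[OF f hopf_module G u] lin linear_maps_id hopf_module)
      (auto intro: counit_closed)
  also have "\<dots> = lift G (\<lambda>y z. counit A z \<odot>\<^bsub>G\<^esub> f y) (comult A u)"
    by (rule comult_cong[OF u]) (simp add: linear_maps_smult[OF f] counit_closed)
  finally show ?thesis by simp
qed

end


section \<open>Actions of a Hopf algebra on its dual\<close>

text \<open>The laws of the pairing of U with V that pass to the subalgebra H, with the coproduct of
  H in place of that of U.\<close>

locale bialgebra_pairing = H: hopf_algebra K H + V: hopf_algebra K V
  for K :: "'k ring" and H :: "('k, 'h) hopf" and V :: "('k, 'v) hopf" +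
  fixes pair :: "'h \<Rightarrow> 'v \<Rightarrow> 'k"
  assumes pair_bilinear: "bilinear_map K H V (ground_algebra K) pair"
    and pair_mult_left: "\<lbrakk>x \<in> carrier H; y \<in> carrier H; u \<in> carrier V\<rbrakk> \<Longrightarrow>
      pair (x \<otimes>\<^bsub>H\<^esub> y) u = lift K (\<lambda>u1 u2. pair x u1 \<otimes>\<^bsub>K\<^esub> pair y u2) (comult V u)"
    and pair_mult_right: "\<lbrakk>x \<in> carrier H; u \<in> carrier V; v \<in> carrier V\<rbrakk> \<Longrightarrow>
      pair x (u \<otimes>\<^bsub>V\<^esub> v) = lift K (\<lambda>x1 x2. pair x1 u \<otimes>\<^bsub>K\<^esub> pair x2 v) (comult H x)"
    and pair_one_left: "u \<in> carrier V \<Longrightarrow> pair \<one>\<^bsub>H\<^esub> u = counit V u"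
    and pair_one_right: "x \<in> carrier H \<Longrightarrow> pair x \<one>\<^bsub>V\<^esub> = counit H x"
begin

interpretation HA: assoc_algebra K H by (rule H.assoc_algebra)
interpretation VA: assoc_algebra K V by (rule V.assoc_algebra)

lemmas mods = H.hopf_module V.hopf_module H.ground H.assoc_algebra V.assoc_algebra

lemma pair_closed: "\<lbrakk>x \<in> carrier H; u \<in> carrier V\<rbrakk> \<Longrightarrow> pair x u \<in> carrier K"
  using bilinear_map_closed[OF pair_bilinear] by simp

lemma lin_pair_left [lin]:
  "\<lbrakk>f \<in> linear_maps K M H; u \<in> carrier V\<rbrakk> \<Longrightarrow> (\<lambda>x. pair (f x) u) \<in> linear_maps K M (ground_algebra K)"
  by (rule linear_maps_comp[OF bilinear_map_left[OF pair_bilinear]])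

lemma lin_pair_right [lin]:
  "\<lbrakk>f \<in> linear_maps K M V; x \<in> carrier H\<rbrakk> \<Longrightarrow> (\<lambda>u. pair x (f u)) \<in> linear_maps K M (ground_algebra K)"
  by (rule linear_maps_comp[OF bilinear_map_right[OF pair_bilinear]])

abbreviation "rt \<equiv> dual_act V pair"
abbreviation "lt \<equiv> dual_act_op V pair"

lemma lin_rt_right [lin]:
  "\<lbrakk>f \<in> linear_maps K M V; x \<in> carrier H\<rbrakk> \<Longrightarrow> (\<lambda>u. rt x (f u)) \<in> linear_maps K M V"
  unfolding dual_act_def by (intro lin linear_maps_id mods) (auto simp: pair_closed)

lemma lin_lt_right [lin]:
  "\<lbrakk>f \<in> linear_maps K M V; x \<in> carrier H\<rbrakk> \<Longrightarrow> (\<lambda>u. lt x (f u)) \<in> linear_maps K M V"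
  unfolding dual_act_op_def by (intro lin linear_maps_id mods) (auto simp: pair_closed)

lemma rt_linear_left: "u \<in> carrier V \<Longrightarrow> (\<lambda>x. rt x u) \<in> linear_maps K H V"
  unfolding dual_act_def by (intro lin linear_maps_id mods) (auto simp: pair_closed)

lemma lt_linear_left: "u \<in> carrier V \<Longrightarrow> (\<lambda>x. lt x u) \<in> linear_maps K H V"
  unfolding dual_act_op_def by (intro lin linear_maps_id mods) (auto simp: pair_closed)

lemma lin_rt_left [lin]:
  "\<lbrakk>f \<in> linear_maps K M H; u \<in> carrier V\<rbrakk> \<Longrightarrow> (\<lambda>x. rt (f x) u) \<in> linear_maps K M V"
  by (rule linear_maps_comp[OF rt_linear_left])

lemma lin_lt_left [lin]:
  "\<lbrakk>f \<in> linear_maps K M H; u \<in> carrier V\<rbrakk> \<Longrightarrow> (\<lambda>x. lt (f x) u) \<in> linear_maps K M V"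
  by (rule linear_maps_comp[OF lt_linear_left])

lemma rt_closed: "\<lbrakk>x \<in> carrier H; u \<in> carrier V\<rbrakk> \<Longrightarrow> rt x u \<in> carrier V"
  using linear_maps_closed[OF rt_linear_left] .

lemma lt_closed: "\<lbrakk>x \<in> carrier H; u \<in> carrier V\<rbrakk> \<Longrightarrow> lt x u \<in> carrier V"
  using linear_maps_closed[OF lt_linear_left] .

lemmas closed = pair_closed rt_closed lt_closed HA.m_closed VA.m_closed
  H.counit_closed V.counit_closed VA.smult_closed HA.smult_closed

lemma rt_one: "u \<in> carrier V \<Longrightarrow> rt \<one>\<^bsub>H\<^esub> u = u"
  unfolding dual_act_def
  using V.comult_cong[of u "\<lambda>u1 u2. pair \<one>\<^bsub>H\<^esub> u2 \<odot>\<^bsub>V\<^esub> u1" "\<lambda>y z. counit V z \<odot>\<^bsub>V\<^esub> y" V]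
  by (simp add: pair_one_left V.counit_right)

lemma lt_one: "u \<in> carrier V \<Longrightarrow> lt \<one>\<^bsub>H\<^esub> u = u"
  unfolding dual_act_op_def
  using V.comult_cong[of u "\<lambda>u1 u2. pair \<one>\<^bsub>H\<^esub> u1 \<odot>\<^bsub>V\<^esub> u2" "\<lambda>y z. counit V y \<odot>\<^bsub>V\<^esub> z" V]
  by (simp add: pair_one_left V.counit_left)

lemma rt_unit: "x \<in> carrier H \<Longrightarrow> rt x \<one>\<^bsub>V\<^esub> = counit H x \<odot>\<^bsub>V\<^esub> \<one>\<^bsub>V\<^esub>"
  unfolding dual_act_def pair_one_right[symmetric]
  by (rule V.comult_one) (intro lin linear_maps_id mods; auto simp: closed)+

lemma lt_unit: "x \<in> carrier H \<Longrightarrow> lt x \<one>\<^bsub>V\<^esub> = counit H x \<odot>\<^bsub>V\<^esub> \<one>\<^bsub>V\<^esub>"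
  unfolding dual_act_op_def pair_one_right[symmetric]
  by (rule V.comult_one) (intro lin linear_maps_id mods; auto simp: closed)+


lemma linear_rt:
  assumes \<phi>: "\<phi> \<in> linear_maps K V G" and G: "module K G" and x: "x \<in> carrier H" and v: "v \<in> carrier V"
  shows "\<phi> (rt x v) = lift G (\<lambda>a b. pair x b \<odot>\<^bsub>G\<^esub> \<phi> a) (comult V v)"
proof -
  have "\<phi> (rt x v) = lift G (\<lambda>a b. \<phi> (pair x b \<odot>\<^bsub>V\<^esub> a)) (comult V v)"
    unfolding dual_act_def
    by (intro V.linear_comult[OF \<phi>] lin linear_maps_id mods G v) (auto simp: closed x)
  also have "\<dots> = lift G (\<lambda>a b. pair x b \<odot>\<^bsub>G\<^esub> \<phi> a) (comult V v)"
    by (rule V.comult_cong) (auto simp: v linear_maps_smult[OF \<phi>] closed x)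
  finally show ?thesis .
qed

lemma linear_lt:
  assumes \<phi>: "\<phi> \<in> linear_maps K V G" and G: "module K G" and x: "x \<in> carrier H" and v: "v \<in> carrier V"
  shows "\<phi> (lt x v) = lift G (\<lambda>a b. pair x a \<odot>\<^bsub>G\<^esub> \<phi> b) (comult V v)"
proof -
  have "\<phi> (lt x v) = lift G (\<lambda>a b. \<phi> (pair x a \<odot>\<^bsub>V\<^esub> b)) (comult V v)"
    unfolding dual_act_op_def
    by (intro V.linear_comult[OF \<phi>] lin linear_maps_id mods G v) (auto simp: closed x)
  also have "\<dots> = lift G (\<lambda>a b. pair x a \<odot>\<^bsub>G\<^esub> \<phi> b) (comult V v)"
    by (rule V.comult_cong) (auto simp: v linear_maps_smult[OF \<phi>] closed x)
  finally show ?thesis .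
qed

context
  fixes G :: "('k, 'g, 'w) module_scheme" and F :: "'v \<Rightarrow> 'v \<Rightarrow> 'g"
  assumes G: "module K G"
    and F1: "\<And>a. a \<in> carrier V \<Longrightarrow> (\<lambda>b. F a b) \<in> linear_maps K V G"
    and F2: "\<And>b. b \<in> carrier V \<Longrightarrow> (\<lambda>a. F a b) \<in> linear_maps K V G"
begin

lemmas F_lin = lin linear_maps_id mods G linear_maps_comp[OF F1] linear_maps_comp[OF F2]

lemma F_closed: "\<lbrakk>a \<in> carrier V; b \<in> carrier V\<rbrakk> \<Longrightarrow> F a b \<in> carrier G"
  using linear_maps_closed[OF F1] .

lemma comult_lin: "(\<lambda>w. lift G F (comult V w)) \<in> linear_maps K V G"
  by (intro F_lin)

lemma smult_comult: "\<lbrakk>c \<in> carrier K; w \<in> carrier V\<rbrakk> \<Longrightarrow>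
    c \<odot>\<^bsub>G\<^esub> lift G F (comult V w) = lift G (\<lambda>a b. c \<odot>\<^bsub>G\<^esub> F a b) (comult V w)"
  by (intro V.linear_comult[of "\<lambda>y. c \<odot>\<^bsub>G\<^esub> y"] F_lin)

context
  fixes x v assumes x: "x \<in> carrier H" and v: "v \<in> carrier V"
begin

text \<open>Both sides sum \<langle>x, v3\<rangle> F v1 v2. The action \<open>rt\<close> consumes
  the last leg, so under the coproduct it affects the right factor alone.\<close>

lemma comult_rt: "lift G F (comult V (rt x v)) = lift G (\<lambda>a b. F a (rt x b)) (comult V v)"
proof -
  have "lift G F (comult V (rt x v)) =
      lift G (\<lambda>w c. lift G (\<lambda>a b. pair x c \<odot>\<^bsub>G\<^esub> F a b) (comult V w)) (comult V v)"
    unfolding linear_rt[OF comult_lin G x v]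
    by (intro V.comult_cong[OF v] smult_comult) (auto simp: closed x)
  also have "\<dots> = lift G (\<lambda>a w. lift G (\<lambda>b c. pair x c \<odot>\<^bsub>G\<^esub> F a b) (comult V w)) (comult V v)"
    by (intro V.comult_coassoc[OF G v] F_lin) (auto simp: closed x F_closed)
  also have "\<dots> = lift G (\<lambda>a w. F a (rt x w)) (comult V v)"
    by (intro V.comult_cong[OF v] linear_rt[OF F1 G x, symmetric])
  finally show ?thesis .
qed

text \<open>Mirror image: both sides sum \<langle>x, v1\<rangle> F v2 v3, and \<open>lt\<close>
  affects the left factor alone.\<close>

lemma comult_lt: "lift G F (comult V (lt x v)) = lift G (\<lambda>a b. F (lt x a) b) (comult V v)"
proof -
  have "lift G F (comult V (lt x v)) =
      lift G (\<lambda>c w. lift G (\<lambda>a b. pair x c \<odot>\<^bsub>G\<^esub> F a b) (comult V w)) (comult V v)"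
    unfolding linear_lt[OF comult_lin G x v]
    by (intro V.comult_cong[OF v] smult_comult) (auto simp: closed x)
  also have "\<dots> = lift G (\<lambda>w b. lift G (\<lambda>c a. pair x c \<odot>\<^bsub>G\<^esub> F a b) (comult V w)) (comult V v)"
    by (intro V.comult_coassoc[OF G v, symmetric] F_lin) (auto simp: closed x F_closed)
  also have "\<dots> = lift G (\<lambda>w b. F (lt x w) b) (comult V v)"
    by (intro V.comult_cong[OF v] linear_lt[OF F2 G x, symmetric])
  finally show ?thesis .
qed

text \<open>Both sides sum \<langle>x, v2\<rangle> F v1 v3: the middle leg may be split off from the
  left or from the right factor. This exchange is the source of the Takeuchi condition for the
  coproduct of B.\<close>

lemma comult_rt_lt:
  "lift G (\<lambda>a b. F (rt x a) b) (comult V v) = lift G (\<lambda>a b. F a (lt x b)) (comult V v)"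
proof -
  have "lift G (\<lambda>w b. F (rt x w) b) (comult V v) =
      lift G (\<lambda>w b. lift G (\<lambda>a c. pair x c \<odot>\<^bsub>G\<^esub> F a b) (comult V w)) (comult V v)"
    by (intro V.comult_cong[OF v] linear_rt[OF F2 G x])
  also have "\<dots> = lift G (\<lambda>a w. lift G (\<lambda>c b. pair x c \<odot>\<^bsub>G\<^esub> F a b) (comult V w)) (comult V v)"
    by (intro V.comult_coassoc[OF G v] F_lin) (auto simp: closed x F_closed)
  also have "\<dots> = lift G (\<lambda>a w. F a (lt x w)) (comult V v)"
    by (intro V.comult_cong[OF v] linear_lt[OF F1 G x, symmetric])
  finally show ?thesis .
qed

end

end

lemma counit_rt: "\<lbrakk>x \<in> carrier H; v \<in> carrier V\<rbrakk> \<Longrightarrow> counit V (rt x v) = pair x v"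
  using linear_rt[OF V.counit_linear mods(3)] V.comult_cong[of v "\<lambda>a b. pair x b \<otimes>\<^bsub>K\<^esub> counit V a"
      "\<lambda>a b. counit V a \<otimes>\<^bsub>K\<^esub> pair x b" "ground_algebra K"]
    V.comult_counit_left[OF mods(3) lin_pair_right[OF linear_maps_id]]
  by (simp add: closed HA.R.m_comm)

lemma counit_lt: "\<lbrakk>x \<in> carrier H; v \<in> carrier V\<rbrakk> \<Longrightarrow> counit V (lt x v) = pair x v"
  using linear_lt[OF V.counit_linear mods(3)] V.comult_cong[of v "\<lambda>a b. pair x a \<otimes>\<^bsub>K\<^esub> counit V b"
      "\<lambda>a b. counit V b \<otimes>\<^bsub>K\<^esub> pair x a" "ground_algebra K"]
    V.comult_counit_right[OF mods(3) lin_pair_right[OF linear_maps_id]]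
  by (simp add: closed HA.R.m_comm)

section \<open>The two actions and the products of H and V\<close>

context
  fixes x y v assumes x: "x \<in> carrier H" and y: "y \<in> carrier H" and v: "v \<in> carrier V"
begin

text \<open>Under the pairing \<open>lt x\<close> is the transpose of left multiplication by
  \<open>x\<close>, and in the next lemma \<open>rt y\<close> that of right multiplication by
  \<open>y\<close>. This explains why \<open>rt\<close> is a left action and \<open>lt\<close> a
  right action, and why the two commute.\<close>

lemma pair_lt: "pair y (lt x v) = pair (x \<otimes>\<^bsub>H\<^esub> y) v"
  by (simp add: linear_lt[OF lin_pair_right[OF linear_maps_id y] mods(3) x v] pair_mult_left x y v
      tensor_lift_ground)

lemma pair_rt: "pair x (rt y v) = pair (x \<otimes>\<^bsub>H\<^esub> y) v"
  unfolding linear_rt[OF lin_pair_right[OF linear_maps_id x] mods(3) y v] pair_mult_left[OF x y v]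
    tensor_lift_ground[symmetric]
  by (rule V.comult_cong) (simp_all add: v closed x y HA.R.m_comm)

end

lemma rt_mult:
  assumes x: "x \<in> carrier H" and y: "y \<in> carrier H" and v: "v \<in> carrier V"
  shows "rt (x \<otimes>\<^bsub>H\<^esub> y) v = rt x (rt y v)"
proof -
  have "rt x (rt y v) = lift V (\<lambda>a b. pair x (rt y b) \<odot>\<^bsub>V\<^esub> a) (comult V v)"
    unfolding dual_act_def[of V pair x]
    by (intro comult_rt lin linear_maps_id mods x y v) (auto simp: closed x)
  also have "\<dots> = rt (x \<otimes>\<^bsub>H\<^esub> y) v"
    unfolding dual_act_def[of V pair "x \<otimes>\<^bsub>H\<^esub> y"]
    by (intro V.comult_cong v) (simp add: pair_rt x y)
  finally show ?thesis by simp
qed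

text \<open>The order is reversed: \<open>lt\<close> is an action of the opposite algebra.\<close>

lemma lt_mult:
  assumes x: "x \<in> carrier H" and y: "y \<in> carrier H" and v: "v \<in> carrier V"
  shows "lt (x \<otimes>\<^bsub>H\<^esub> y) v = lt y (lt x v)"
proof -
  have "lt y (lt x v) = lift V (\<lambda>a b. pair y (lt x a) \<odot>\<^bsub>V\<^esub> b) (comult V v)"
    unfolding dual_act_op_def[of V pair y]
    by (intro comult_lt lin linear_maps_id mods x y v) (auto simp: closed y)
  also have "\<dots> = lt (x \<otimes>\<^bsub>H\<^esub> y) v"
    unfolding dual_act_op_def[of V pair "x \<otimes>\<^bsub>H\<^esub> y"]
    by (intro V.comult_cong v) (simp add: pair_lt x y)
  finally show ?thesis by simp
qed

text \<open>The two actions consume opposite outer legs of the iterated coproduct.\<close>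

lemma rt_lt_commute:
  assumes x: "x \<in> carrier H" and y: "y \<in> carrier H" and v: "v \<in> carrier V"
  shows "rt x (lt y v) = lt y (rt x v)"
proof -
  have "rt x (lt y v) = lift V (\<lambda>a b. pair x b \<odot>\<^bsub>V\<^esub> lt y a) (comult V v)"
    unfolding dual_act_def[of V pair x]
    by (intro comult_lt lin linear_maps_id mods x y v) (auto simp: closed x)
  also have "\<dots> = lift V (\<lambda>a b. lt y (pair x b \<odot>\<^bsub>V\<^esub> a)) (comult V v)"
    by (rule V.comult_cong) (auto simp: v linear_maps_smult[OF lin_lt_right[OF linear_maps_id]] closed x y)
  also have "\<dots> = lt y (rt x v)"
    unfolding dual_act_def[of V pair x]
    by (intro V.linear_comult[symmetric] lin linear_maps_id mods x y v) (auto simp: closed x)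
  finally show ?thesis .
qed

text \<open>The scalar of the leg \<open>x2\<close> stands outermost because the sum over the legs
  of the second factor is folded first, and \<open>linear_rt\<close> and \<open>linear_lt\<close>
  have the pairing in front.\<close>

lemma smult_pair_mult:
  assumes x: "x \<in> carrier H" and abc: "a \<in> carrier V" "b \<in> carrier V" "c \<in> carrier V"
  shows "pair x (a \<otimes>\<^bsub>V\<^esub> b) \<odot>\<^bsub>V\<^esub> c =
      lift V (\<lambda>x1 x2. pair x2 b \<odot>\<^bsub>V\<^esub> (pair x1 a \<odot>\<^bsub>V\<^esub> c)) (comult H x)"
proof -
  have "pair x (a \<otimes>\<^bsub>V\<^esub> b) \<odot>\<^bsub>V\<^esub> c = lift V (\<lambda>x1 x2. (pair x1 a \<otimes>\<^bsub>K\<^esub> pair x2 b) \<odot>\<^bsub>V\<^esub> c) (comult H x)"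
    unfolding pair_mult_right[OF x abc(1,2)] tensor_lift_ground[symmetric]
    by (intro H.linear_comult[of "\<lambda>s. s \<odot>\<^bsub>V\<^esub> c"] lin linear_maps_id mods x abc HA.is_cring) (auto simp: closed abc)
  also have "\<dots> = lift V (\<lambda>x1 x2. pair x2 b \<odot>\<^bsub>V\<^esub> (pair x1 a \<odot>\<^bsub>V\<^esub> c)) (comult H x)"
    by (intro H.comult_cong x) (simp add: VA.smult_assoc1[symmetric] HA.R.m_comm closed abc)
  finally show ?thesis .
qed

text \<open>Pairing with a product in V splits \<open>x\<close> by its coproduct. The sum over the
  legs of \<open>x\<close> arises innermost; two interchanges bring it outside, and the sums over
  \<open>v\<close> and \<open>u\<close> fold back into actions.\<close>

lemma rt_V_mult:
  assumes x: "x \<in> carrier H" and u: "u \<in> carrier V" and v: "v \<in> carrier V"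
  shows "rt x (u \<otimes>\<^bsub>V\<^esub> v) = lift V (\<lambda>x1 x2. rt x1 u \<otimes>\<^bsub>V\<^esub> rt x2 v) (comult H x)"
proof -
  let ?f = "\<lambda>x1 x2 u1 u2 v1 v2. pair x2 v2 \<odot>\<^bsub>V\<^esub> (pair x1 u2 \<odot>\<^bsub>V\<^esub> (u1 \<otimes>\<^bsub>V\<^esub> v1))"
  have "rt x (u \<otimes>\<^bsub>V\<^esub> v) = lift V (\<lambda>u1 u2. lift V (\<lambda>v1 v2.
      pair x (u2 \<otimes>\<^bsub>V\<^esub> v2) \<odot>\<^bsub>V\<^esub> (u1 \<otimes>\<^bsub>V\<^esub> v1)) (comult V v)) (comult V u)"
    unfolding dual_act_def by (intro V.comult_mult lin linear_maps_id mods u v x) (auto simp: closed x)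
  also have "\<dots> = lift V (\<lambda>u1 u2. lift V (\<lambda>v1 v2. lift V (\<lambda>x1 x2.
      ?f x1 x2 u1 u2 v1 v2) (comult H x)) (comult V v)) (comult V u)"
    by (intro V.comult_cong u v smult_pair_mult x) (auto simp: closed)
  also have "\<dots> = lift V (\<lambda>u1 u2. lift V (\<lambda>x1 x2. lift V (\<lambda>v1 v2.
      ?f x1 x2 u1 u2 v1 v2) (comult V v)) (comult H x)) (comult V u)"
    by (intro V.comult_cong[OF u] lift_swap[OF mods(2,2,1,1,2)] lin linear_maps_id mods V.comult_closed H.comult_closed
        u v x) (auto simp: closed)
  also have "\<dots> = lift V (\<lambda>x1 x2. lift V (\<lambda>u1 u2. lift V (\<lambda>v1 v2.
      ?f x1 x2 u1 u2 v1 v2) (comult V v)) (comult V u)) (comult H x)"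
    by (intro lift_swap[OF mods(2,2,1,1,2)] lin linear_maps_id mods V.comult_closed H.comult_closed u v x)
      (auto simp: closed)
  also have "\<dots> = lift V (\<lambda>x1 x2. lift V (\<lambda>u1 u2. pair x1 u2 \<odot>\<^bsub>V\<^esub> (u1 \<otimes>\<^bsub>V\<^esub> rt x2 v)) (comult V u)) (comult H x)"
    by (intro H.comult_cong[OF x] V.comult_cong[OF u] linear_rt[of "\<lambda>y. _ \<odot>\<^bsub>V\<^esub> (_ \<otimes>\<^bsub>V\<^esub> y)", symmetric]
        lin linear_maps_id mods v) (auto simp: closed)
  also have "\<dots> = lift V (\<lambda>x1 x2. rt x1 u \<otimes>\<^bsub>V\<^esub> rt x2 v) (comult H x)"
    by (intro H.comult_cong[OF x] linear_rt[of "\<lambda>y. y \<otimes>\<^bsub>V\<^esub> _", symmetric] lin linear_maps_id mods u) (auto simp: closed v)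
  finally show ?thesis .
qed

text \<open>The same computation with the legs of \<open>u\<close> and \<open>v\<close> exchanged.
  The legs of \<open>x\<close> keep their order: although \<open>lt\<close> reverses products of H,
  it splits over the ordinary coproduct.\<close>

lemma lt_V_mult:
  assumes x: "x \<in> carrier H" and u: "u \<in> carrier V" and v: "v \<in> carrier V"
  shows "lt x (u \<otimes>\<^bsub>V\<^esub> v) = lift V (\<lambda>x1 x2. lt x1 u \<otimes>\<^bsub>V\<^esub> lt x2 v) (comult H x)"
proof -
  let ?f = "\<lambda>x1 x2 u1 u2 v1 v2. pair x2 v1 \<odot>\<^bsub>V\<^esub> (pair x1 u1 \<odot>\<^bsub>V\<^esub> (u2 \<otimes>\<^bsub>V\<^esub> v2))"
  have "lt x (u \<otimes>\<^bsub>V\<^esub> v) = lift V (\<lambda>u1 u2. lift V (\<lambda>v1 v2.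
      pair x (u1 \<otimes>\<^bsub>V\<^esub> v1) \<odot>\<^bsub>V\<^esub> (u2 \<otimes>\<^bsub>V\<^esub> v2)) (comult V v)) (comult V u)"
    unfolding dual_act_op_def by (intro V.comult_mult lin linear_maps_id mods u v x) (auto simp: closed x)
  also have "\<dots> = lift V (\<lambda>u1 u2. lift V (\<lambda>v1 v2. lift V (\<lambda>x1 x2.
      ?f x1 x2 u1 u2 v1 v2) (comult H x)) (comult V v)) (comult V u)"
    by (intro V.comult_cong u v smult_pair_mult x) (auto simp: closed)
  also have "\<dots> = lift V (\<lambda>u1 u2. lift V (\<lambda>x1 x2. lift V (\<lambda>v1 v2.
      ?f x1 x2 u1 u2 v1 v2) (comult V v)) (comult H x)) (comult V u)"
    by (intro V.comult_cong[OF u] lift_swap[OF mods(2,2,1,1,2)] lin linear_maps_id mods V.comult_closed H.comult_closed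
        u v x) (auto simp: closed)
  also have "\<dots> = lift V (\<lambda>x1 x2. lift V (\<lambda>u1 u2. lift V (\<lambda>v1 v2.
      ?f x1 x2 u1 u2 v1 v2) (comult V v)) (comult V u)) (comult H x)"
    by (intro lift_swap[OF mods(2,2,1,1,2)] lin linear_maps_id mods V.comult_closed H.comult_closed u v x)
      (auto simp: closed)
  also have "\<dots> = lift V (\<lambda>x1 x2. lift V (\<lambda>u1 u2. pair x1 u1 \<odot>\<^bsub>V\<^esub> (u2 \<otimes>\<^bsub>V\<^esub> lt x2 v)) (comult V u)) (comult H x)"
    by (intro H.comult_cong[OF x] V.comult_cong[OF u] linear_lt[of "\<lambda>y. _ \<odot>\<^bsub>V\<^esub> (_ \<otimes>\<^bsub>V\<^esub> y)", symmetric]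
        lin linear_maps_id mods v) (auto simp: closed)
  also have "\<dots> = lift V (\<lambda>x1 x2. lt x1 u \<otimes>\<^bsub>V\<^esub> lt x2 v) (comult H x)"
    by (intro H.comult_cong[OF x] linear_lt[of "\<lambda>y. y \<otimes>\<^bsub>V\<^esub> _", symmetric] lin linear_maps_id mods u) (auto simp: closed v)
  finally show ?thesis .
qed

end


section \<open>Tensor products of bimodules\<close>

definition bimod_balanced ::
  "('k, 'r) ring_scheme \<Rightarrow> ('k, 'l) module \<Rightarrow> ('l, 'k, 'm) bimod \<Rightarrow> ('l, 'k, 'n) bimod \<Rightarrow>
    ('k, 'p, 'z) module_scheme \<Rightarrow> ('m \<Rightarrow> 'n \<Rightarrow> 'p) \<Rightarrow> bool" where
  "bimod_balanced K L M N G F \<longleftrightarrow> bilinear_map K M N G F \<and>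
     (\<forall>m\<in>carrier M. \<forall>l\<in>carrier L. \<forall>n\<in>carrier N. F (rsmul M m l) n = F m (lsmul N l n))"

lemma bimod_balancedI:
  assumes "\<And>m. m \<in> carrier M \<Longrightarrow> (\<lambda>n. F m n) \<in> linear_maps K N G"
    and "\<And>n. n \<in> carrier N \<Longrightarrow> (\<lambda>m. F m n) \<in> linear_maps K M G"
    and "\<And>m l n. \<lbrakk>m \<in> carrier M; l \<in> carrier L; n \<in> carrier N\<rbrakk> \<Longrightarrow> F (rsmul M m l) n = F m (lsmul N l n)"
  shows "bimod_balanced K L M N G F"
  using assms by (auto simp: bimod_balanced_def intro: bilinear_mapI)

context
  fixes K :: "('k, 'r) ring_scheme" and L :: "('k, 'l) module"
    and M :: "('l, 'k, 'm) bimod" and N :: "('l, 'k, 'n) bimod"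
  assumes MN: "balanced_product K M N (carrier L) (rsmul M) (lsmul N)"
begin

interpretation bp: balanced_product K M N "carrier L" "rsmul M" "lsmul N" by (rule MN)

abbreviation (input) "MN \<equiv> bimod_tensor L M N"

lemma bimod_tensor_simps:
  "carrier MN = carrier bp.T" "add MN = add bp.T" "zero MN = zero bp.T" "smult MN = smult bp.T"
  by (simp_all add: bimod_tensor_def Let_def module.defs)

lemma bimod_tensor_linear_dom: "linear_maps K MN G = linear_maps K bp.T G"
  by (rule linear_maps_transfer) (simp_all add: bimod_tensor_simps)

lemma bimod_tensor_linear_cod: "linear_maps K G MN = linear_maps K G bp.T"
  by (rule linear_maps_transfer) (simp_all add: bimod_tensor_simps)

lemma bimod_tensor_lift:
  fixes f :: "'c \<Rightarrow> 'd \<Rightarrow> ('m, 'n) tens"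
  shows "lift bp.T f X = lift MN f X"
  by (rule tensor_lift_transfer) (simp_all add: bimod_tensor_simps)

lemma lsmul_bimod_tensor:
  "lsmul MN l X = lift MN (\<lambda>m n. bimod_elem L M N (lsmul M l m) n) X"
  unfolding bimod_tensor_lift[symmetric]
  by (simp add: bimod_tensor_def Let_def module.defs bimod.defs)

lemma rsmul_bimod_tensor:
  "rsmul MN X l = lift MN (\<lambda>m n. bimod_elem L M N m (rsmul N n l)) X"
  unfolding bimod_tensor_lift[symmetric]
  by (simp add: bimod_tensor_def Let_def module.defs bimod.defs)

lemma bimod_balanced_maps: "bimod_balanced K L M N G F \<Longrightarrow> F \<in> bp.balanced_maps G"
  by (auto simp: bimod_balanced_def bp.balanced_maps_def)

lemma bimod_tensor_module: "module K MN"
  by (rule module_transfer[OF bp.T_module]) (simp_all add: bimod_tensor_simps)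

lemma bimod_elem_closed: "\<lbrakk>m \<in> carrier M; n \<in> carrier N\<rbrakk> \<Longrightarrow> bimod_elem L M N m n \<in> carrier MN"
  using bp.elem_closed by (simp add: bimod_tensor_simps bimod_elem_def)

lemma bimod_elem_bilinear: "bilinear_map K M N MN (bimod_elem L M N)"
  using bp.elem_bilinear by (simp add: bilinear_map_def bimod_tensor_linear_cod bimod_elem_def)

lemma lin_bimod_elem_left:
  "\<lbrakk>f \<in> linear_maps K P M; n \<in> carrier N\<rbrakk> \<Longrightarrow> (\<lambda>x. bimod_elem L M N (f x) n) \<in> linear_maps K P MN"
  by (rule linear_maps_comp[OF bilinear_map_left[OF bimod_elem_bilinear]])

lemma lin_bimod_elem_right:
  "\<lbrakk>f \<in> linear_maps K P N; m \<in> carrier M\<rbrakk> \<Longrightarrow> (\<lambda>x. bimod_elem L M N m (f x)) \<in> linear_maps K P MN"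
  by (rule linear_maps_comp[OF bilinear_map_right[OF bimod_elem_bilinear]])

lemma bimod_elem_balanced:
  "\<lbrakk>m \<in> carrier M; l \<in> carrier L; n \<in> carrier N\<rbrakk> \<Longrightarrow>
    bimod_elem L M N (rsmul M m l) n = bimod_elem L M N m (lsmul N l n)"
  unfolding bimod_elem_def by (rule bp.elem_balanced)

lemma bimod_lift_elem:
  assumes "module K G" "bimod_balanced K L M N G F" "m \<in> carrier M" "n \<in> carrier N"
  shows "lift G F (bimod_elem L M N m n) = F m n"
  using assms by (simp add: bimod_elem_def bp.tensor_lift_elem bimod_balanced_maps)

lemma bimod_lift_linear:
  assumes "module K G" "bimod_balanced K L M N G F"
  shows "lift G F \<in> linear_maps K MN G"
  unfolding bimod_tensor_linear_dom using assms by (intro bp.tensor_lift_linear bimod_balanced_maps)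

lemma bimod_linear_eqI:
  assumes "module K G" "f \<in> linear_maps K MN G" "g \<in> linear_maps K MN G"
    and "\<And>m n. \<lbrakk>m \<in> carrier M; n \<in> carrier N\<rbrakk> \<Longrightarrow> f (bimod_elem L M N m n) = g (bimod_elem L M N m n)"
    and "X \<in> carrier MN"
  shows "f X = g X"
  by (rule bp.tensor_eqI[OF assms(1), of f g])
    (use assms in \<open>simp_all add: bimod_tensor_linear_dom bimod_tensor_simps bimod_elem_def\<close>)

lemma bimod_lift_cong:
  assumes "X \<in> carrier MN" "\<And>m n. \<lbrakk>m \<in> carrier M; n \<in> carrier N\<rbrakk> \<Longrightarrow> f m n = g m n"
  shows "lift G f X = lift G g X"
  using assms by (intro bp.tensor_lift_cong) (auto simp: bimod_tensor_simps)

lemma linear_bimod_lift_fun: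
  assumes "module K G" "module K P" "X \<in> carrier MN"
    and "\<And>a b. \<lbrakk>a \<in> carrier M; b \<in> carrier N\<rbrakk> \<Longrightarrow> (\<lambda>x. F x a b) \<in> linear_maps K P G"
    and "\<And>x. x \<in> carrier P \<Longrightarrow> bimod_balanced K L M N G (F x)"
  shows "(\<lambda>x. lift G (F x) X) \<in> linear_maps K P G"
  using assms by (intro bp.linear_tensor_lift_fun bimod_balanced_maps) (auto simp: bimod_tensor_simps)

end

section \<open>Source and target maps\<close>

lemma opposite_simps [simp]:
  "carrier (opposite A) = carrier A" "x \<otimes>\<^bsub>opposite A\<^esub> y = y \<otimes>\<^bsub>A\<^esub> x"
  "x \<oplus>\<^bsub>opposite A\<^esub> y = x \<oplus>\<^bsub>A\<^esub> y" "c \<odot>\<^bsub>opposite A\<^esub> x = c \<odot>\<^bsub>A\<^esub> x"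
  "\<one>\<^bsub>opposite A\<^esub> = \<one>\<^bsub>A\<^esub>" "\<zero>\<^bsub>opposite A\<^esub> = \<zero>\<^bsub>A\<^esub>"
  by (simp_all add: opposite_def)

lemma linear_maps_opposite_dom: "linear_maps K (opposite A) M = linear_maps K A M"
  by (simp add: linear_maps_def hom_def)

lemma linear_maps_opposite_cod: "linear_maps K M (opposite A) = linear_maps K M A"
  by (simp add: linear_maps_def hom_def)

text \<open>The axioms of a right bialgebroid that precede coproduct and counit. They suffice to
  form the tensor products over L and the Takeuchi product.\<close>

locale source_target =
  fixes K :: "'k ring" and L :: "('k, 'l) module" and B :: "('k, 'b) module"
    and s t :: "'l \<Rightarrow> 'b"
  assumes base: "assoc_algebra K L"
    and total: "assoc_algebra K B"
    and source_hom: "s \<in> algebra_homs K L B"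
    and target_antihom: "t \<in> algebra_homs K (opposite L) B"
    and images_commute: "\<lbrakk>l \<in> carrier L; m \<in> carrier L\<rbrakk> \<Longrightarrow> s l \<otimes>\<^bsub>B\<^esub> t m = t m \<otimes>\<^bsub>B\<^esub> s l"
begin

interpretation L: assoc_algebra K L by (rule base)
interpretation B: assoc_algebra K B by (rule total)

abbreviation "M \<equiv> bialgebroid_bimodule B s t"
abbreviation "T \<equiv> bimod_tensor L M M"
abbreviation "el \<equiv> bimod_elem L M M"

lemma M_simps [simp]:
  "carrier M = carrier B" "add M = add B" "zero M = zero B" "smult M = smult B"
  "lsmul M = (\<lambda>l a. a \<otimes>\<^bsub>B\<^esub> t l)" "rsmul M = (\<lambda>a l. a \<otimes>\<^bsub>B\<^esub> s l)"
  by (simp_all add: bialgebroid_bimodule_def module.defs bimod.defs)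

lemma linear_maps_M_dom [simp]: "linear_maps K M G = linear_maps K B G"
  by (rule linear_maps_transfer) simp_all

lemma linear_maps_M_cod [simp]: "linear_maps K G M = linear_maps K G B"
  by (rule linear_maps_transfer) simp_all

lemma B_mod: "module K B" by unfold_locales

lemma M_module: "module K M"
  by (rule module_transfer[OF B_mod]) simp_all

lemma s_linear: "s \<in> linear_maps K L B" and t_linear: "t \<in> linear_maps K L B"
  using source_hom target_antihom by (auto simp: algebra_homs_def linear_maps_opposite_dom)

lemma s_closed: "l \<in> carrier L \<Longrightarrow> s l \<in> carrier B" and t_closed: "l \<in> carrier L \<Longrightarrow> t l \<in> carrier B"
  using linear_maps_closed[OF s_linear] linear_maps_closed[OF t_linear] by auto

lemma s_one: "s \<one>\<^bsub>L\<^esub> = \<one>\<^bsub>B\<^esub>" and t_one: "t \<one>\<^bsub>L\<^esub> = \<one>\<^bsub>B\<^esub>"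
  using source_hom target_antihom by (auto simp: algebra_homs_def ring_hom_def)

text \<open>With its analogue for \<open>t\<close> this realises the scalar \<open>c\<close> by the
  element \<open>c\<close> times 1 of L on both sides of the tensor sign, as
  \<open>balanced_product\<close> requires.\<close>

lemma s_scalar: "\<lbrakk>c \<in> carrier K; a \<in> carrier B\<rbrakk> \<Longrightarrow> a \<otimes>\<^bsub>B\<^esub> s (c \<odot>\<^bsub>L\<^esub> \<one>\<^bsub>L\<^esub>) = c \<odot>\<^bsub>B\<^esub> a"
  by (simp add: linear_maps_smult[OF s_linear] s_one B.smult_mult_right)

lemma t_scalar: "\<lbrakk>c \<in> carrier K; a \<in> carrier B\<rbrakk> \<Longrightarrow> a \<otimes>\<^bsub>B\<^esub> t (c \<odot>\<^bsub>L\<^esub> \<one>\<^bsub>L\<^esub>) = c \<odot>\<^bsub>B\<^esub> a"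
  by (simp add: linear_maps_smult[OF t_linear] t_one B.smult_mult_right)

lemma MM: "balanced_product K M M (carrier L) (rsmul M) (lsmul M)"
proof (intro balanced_product.intro balanced_product_axioms.intro M_module)
  fix c assume c: "c \<in> carrier K"
  show "\<exists>r\<in>carrier L. (\<forall>m\<in>carrier M. rsmul M m r = c \<odot>\<^bsub>M\<^esub> m) \<and> (\<forall>n\<in>carrier M. lsmul M r n = c \<odot>\<^bsub>M\<^esub> n)"
    by (rule bexI[of _ "c \<odot>\<^bsub>L\<^esub> \<one>\<^bsub>L\<^esub>"]) (use c in \<open>auto simp: s_scalar t_scalar\<close>)
qed (auto intro!: lin_mult_left total linear_maps_id s_closed t_closed)

lemmas T_module = bimod_tensor_module[OF MM]
lemmas el_closed = bimod_elem_closed[OF MM, simplified]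
lemmas lin_el_left = lin_bimod_elem_left[OF MM, simplified]
lemmas lin_el_right = lin_bimod_elem_right[OF MM, simplified]
lemmas el_balanced = bimod_elem_balanced[OF MM, simplified]

text \<open>The two actions of L on B commute because the images of \<open>s\<close> and
  \<open>t\<close> do. The outer actions on B \<otimes>_L B thereby respect the inner
  balancing.\<close>

lemma mult_s_t: "\<lbrakk>a \<in> carrier B; l \<in> carrier L; m \<in> carrier L\<rbrakk> \<Longrightarrow>
    (a \<otimes>\<^bsub>B\<^esub> s l) \<otimes>\<^bsub>B\<^esub> t m = (a \<otimes>\<^bsub>B\<^esub> t m) \<otimes>\<^bsub>B\<^esub> s l"
  by (simp add: B.m_assoc s_closed t_closed images_commute)

lemmas st_lin = lin_el_left lin_el_right lin_mult_left lin_mult_right linear_maps_id total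
lemmas st_closed = el_closed s_closed t_closed B.m_closed

lemma lsmul_T_balanced: "l \<in> carrier L \<Longrightarrow> bimod_balanced K L M M T (\<lambda>m n. el (m \<otimes>\<^bsub>B\<^esub> t l) n)"
  by (intro bimod_balancedI)
    (auto intro!: st_lin simp: st_closed mult_s_t el_balanced)

lemma rsmul_T_balanced: "l \<in> carrier L \<Longrightarrow> bimod_balanced K L M M T (\<lambda>m n. el m (n \<otimes>\<^bsub>B\<^esub> s l))"
  by (intro bimod_balancedI)
    (auto intro!: st_lin simp: st_closed mult_s_t[symmetric] el_balanced)

lemma lsmul_T: "lsmul T l X = lift T (\<lambda>m n. el (m \<otimes>\<^bsub>B\<^esub> t l) n) X"
  using lsmul_bimod_tensor[OF MM] by simp

lemma rsmul_T: "rsmul T X l = lift T (\<lambda>m n. el m (n \<otimes>\<^bsub>B\<^esub> s l)) X"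
  using rsmul_bimod_tensor[OF MM] by simp

lemma lsmul_T_linear: "l \<in> carrier L \<Longrightarrow> lsmul T l \<in> linear_maps K T T"
  unfolding lsmul_T by (rule bimod_lift_linear[OF MM T_module lsmul_T_balanced])

lemma rsmul_T_linear: "l \<in> carrier L \<Longrightarrow> (\<lambda>X. rsmul T X l) \<in> linear_maps K T T"
  unfolding rsmul_T by (rule bimod_lift_linear[OF MM T_module rsmul_T_balanced])

lemma lsmul_T_el: "\<lbrakk>l \<in> carrier L; a \<in> carrier B; b \<in> carrier B\<rbrakk> \<Longrightarrow> lsmul T l (el a b) = el (a \<otimes>\<^bsub>B\<^esub> t l) b"
  unfolding lsmul_T by (rule bimod_lift_elem[OF MM T_module lsmul_T_balanced]) auto

lemma rsmul_T_el: "\<lbrakk>l \<in> carrier L; a \<in> carrier B; b \<in> carrier B\<rbrakk> \<Longrightarrow> rsmul T (el a b) l = el a (b \<otimes>\<^bsub>B\<^esub> s l)"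
  unfolding rsmul_T by (rule bimod_lift_elem[OF MM T_module rsmul_T_balanced]) auto

lemma T_eqI:
  assumes "module K G" "f \<in> linear_maps K T G" "g \<in> linear_maps K T G"
    and "\<And>a b. \<lbrakk>a \<in> carrier B; b \<in> carrier B\<rbrakk> \<Longrightarrow> f (el a b) = g (el a b)"
    and "X \<in> carrier T"
  shows "f X = g X"
  by (rule bimod_linear_eqI[OF MM assms(1-3) _ assms(5)]) (use assms(4) in auto)

lemma T_smult_linear: "c \<in> carrier K \<Longrightarrow> (\<lambda>X. c \<odot>\<^bsub>T\<^esub> X) \<in> linear_maps K T T"
  by (intro lin_smult_right T_module linear_maps_id)

lemma lsmul_T_scalar:
  assumes "c \<in> carrier K" "X \<in> carrier T"
  shows "lsmul T (c \<odot>\<^bsub>L\<^esub> \<one>\<^bsub>L\<^esub>) X = c \<odot>\<^bsub>T\<^esub> X"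
proof (rule T_eqI[of T "lsmul T (c \<odot>\<^bsub>L\<^esub> \<one>\<^bsub>L\<^esub>)" "\<lambda>X. c \<odot>\<^bsub>T\<^esub> X", OF T_module])
  fix a b assume "a \<in> carrier B" "b \<in> carrier B"
  then show "lsmul T (c \<odot>\<^bsub>L\<^esub> \<one>\<^bsub>L\<^esub>) (el a b) = c \<odot>\<^bsub>T\<^esub> el a b"
    using assms linear_maps_smult[OF lin_el_left[OF linear_maps_id]]
    by (simp add: lsmul_T_el t_scalar)
qed (use assms in \<open>auto intro: lsmul_T_linear T_smult_linear\<close>)

lemma rsmul_T_scalar:
  assumes "c \<in> carrier K" "X \<in> carrier T"
  shows "rsmul T X (c \<odot>\<^bsub>L\<^esub> \<one>\<^bsub>L\<^esub>) = c \<odot>\<^bsub>T\<^esub> X"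
proof (rule T_eqI[of T "\<lambda>X. rsmul T X (c \<odot>\<^bsub>L\<^esub> \<one>\<^bsub>L\<^esub>)" "\<lambda>X. c \<odot>\<^bsub>T\<^esub> X", OF T_module])
  fix a b assume "a \<in> carrier B" "b \<in> carrier B"
  then show "rsmul T (el a b) (c \<odot>\<^bsub>L\<^esub> \<one>\<^bsub>L\<^esub>) = c \<odot>\<^bsub>T\<^esub> el a b"
    using assms linear_maps_smult[OF lin_el_right[OF linear_maps_id]]
    by (simp add: rsmul_T_el s_scalar)
qed (use assms in \<open>auto intro: rsmul_T_linear T_smult_linear\<close>)

lemma MT: "balanced_product K M T (carrier L) (rsmul M) (lsmul T)"
proof (intro balanced_product.intro balanced_product_axioms.intro M_module T_module)
  fix c assume c: "c \<in> carrier K"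
  show "\<exists>r\<in>carrier L. (\<forall>m\<in>carrier M. rsmul M m r = c \<odot>\<^bsub>M\<^esub> m) \<and> (\<forall>n\<in>carrier T. lsmul T r n = c \<odot>\<^bsub>T\<^esub> n)"
    by (rule bexI[of _ "c \<odot>\<^bsub>L\<^esub> \<one>\<^bsub>L\<^esub>"]) (use c in \<open>auto simp: s_scalar lsmul_T_scalar\<close>)
qed (auto intro!: lin_mult_left total linear_maps_id s_closed lsmul_T_linear)

lemma TM: "balanced_product K T M (carrier L) (rsmul T) (lsmul M)"
proof (intro balanced_product.intro balanced_product_axioms.intro M_module T_module)
  fix c assume c: "c \<in> carrier K"
  show "\<exists>r\<in>carrier L. (\<forall>m\<in>carrier T. rsmul T m r = c \<odot>\<^bsub>T\<^esub> m) \<and> (\<forall>n\<in>carrier M. lsmul M r n = c \<odot>\<^bsub>M\<^esub> n)"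
    by (rule bexI[of _ "c \<odot>\<^bsub>L\<^esub> \<one>\<^bsub>L\<^esub>"]) (use c in \<open>auto simp: t_scalar rsmul_T_scalar\<close>)
qed (auto intro!: lin_mult_left total linear_maps_id t_closed rsmul_T_linear)

section \<open>Rebracketing threefold tensor products over L\<close>

abbreviation "MT \<equiv> bimod_tensor L M T"
abbreviation "TM \<equiv> bimod_tensor L T M"
abbreviation "elMT \<equiv> bimod_elem L M T"
abbreviation "elTM \<equiv> bimod_elem L T M"

lemmas MT_module = bimod_tensor_module[OF MT]
lemmas TM_module = bimod_tensor_module[OF TM]
lemmas lin_MT_left = lin_bimod_elem_left[OF MT, simplified]
lemmas lin_MT_right = lin_bimod_elem_right[OF MT, simplified]
lemmas lin_TM_left = lin_bimod_elem_left[OF TM, simplified]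
lemmas lin_TM_right = lin_bimod_elem_right[OF TM, simplified]
lemmas MT_balanced = bimod_elem_balanced[OF MT, simplified]
lemmas TM_balanced = bimod_elem_balanced[OF TM, simplified]

lemma inner_balanced:
  assumes "p \<in> carrier B"
  shows "bimod_balanced K L M M MT (\<lambda>m n. elMT m (el n p))"
  using assms by (intro bimod_balancedI)
    (auto intro!: lin_MT_left lin_MT_right st_lin simp: st_closed MT_balanced lsmul_T_el)

lemma inner_linear:
  "p \<in> carrier B \<Longrightarrow> lift MT (\<lambda>m n. elMT m (el n p)) \<in> linear_maps K T MT"
  by (rule bimod_lift_linear[OF MM MT_module inner_balanced])

lemma inner_el:
  "\<lbrakk>p \<in> carrier B; a \<in> carrier B; b \<in> carrier B\<rbrakk> \<Longrightarrow>
    lift MT (\<lambda>m n. elMT m (el n p)) (el a b) = elMT a (el b p)"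
  by (rule bimod_lift_elem[OF MM MT_module inner_balanced]) auto

text \<open>At an elementary tensor m \<otimes> n the claim is that n s(l) \<otimes> p equals n
  \<otimes> p t(l), the balancing relation of the inner tensor product.\<close>

lemma outer_balanced: "bimod_balanced K L T M MT (\<lambda>X p. lift MT (\<lambda>m n. elMT m (el n p)) X)"
proof (rule bimod_balancedI)
  fix X assume "X \<in> carrier T"
  then show "(\<lambda>p. lift MT (\<lambda>m n. elMT m (el n p)) X) \<in> linear_maps K M MT"
    by (intro linear_bimod_lift_fun[OF MM MT_module M_module])
      (auto intro!: lin_MT_left lin_MT_right st_lin inner_balanced)
next
  fix X l p assume X: "X \<in> carrier T" and l: "l \<in> carrier L" and "p \<in> carrier M"
  then have p: "p \<in> carrier B" "lsmul M l p \<in> carrier B" by (simp_all add: t_closed)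
  show "lift MT (\<lambda>m n. elMT m (el n p)) (rsmul T X l) =
      lift MT (\<lambda>m n. elMT m (el n (lsmul M l p))) X"
    by (rule T_eqI[OF MT_module linear_maps_comp[OF inner_linear[OF p(1)] rsmul_T_linear[OF l]]
          inner_linear[OF p(2)] _ X])
      (use p l in \<open>auto simp: st_closed rsmul_T_el inner_el el_balanced\<close>)
qed (use inner_linear in auto)

lemma assoc_linear: "bimod_assoc L M M M \<in> linear_maps K TM MT"
  unfolding bimod_assoc_def Let_def by (rule bimod_lift_linear[OF TM MT_module outer_balanced])

lemma assoc_elTM:
  "\<lbrakk>X \<in> carrier T; p \<in> carrier B\<rbrakk> \<Longrightarrow>
    bimod_assoc L M M M (elTM X p) = lift MT (\<lambda>m n. elMT m (el n p)) X"
  unfolding bimod_assoc_def Let_def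
  using bimod_lift_elem[OF TM MT_module outer_balanced, of X p] by simp

context
  fixes \<Delta> assumes \<Delta>: "\<Delta> \<in> bimodule_maps K L M T"
begin

lemma \<Delta>_lin: "\<Delta> \<in> linear_maps K B T"
  using \<Delta> by (simp add: bimodule_maps_def)

text \<open>The bimodule property of \<Delta> lets \<Delta> \<otimes> id, and in the next lemma id
  \<otimes> \<Delta>, descend to the tensor product over L.\<close>

lemma \<Delta>_elTM_balanced: "bimod_balanced K L M M TM (\<lambda>m n. elTM (\<Delta> m) n)"
  by (intro bimod_balancedI)
    (use \<Delta> in \<open>auto intro!: lin_TM_left lin_TM_right st_lin \<Delta>_lin
      simp: bimodule_maps_def TM_balanced linear_maps_closed[OF \<Delta>_lin]\<close>)

lemma \<Delta>_elMT_balanced: "bimod_balanced K L M M MT (\<lambda>m n. elMT m (\<Delta> n))"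
  by (intro bimod_balancedI)
    (use \<Delta> in \<open>auto intro!: lin_MT_left lin_MT_right st_lin \<Delta>_lin
      simp: bimodule_maps_def MT_balanced linear_maps_closed[OF \<Delta>_lin]\<close>)

lemma coassoc_left_linear:
  "(\<lambda>X. bimod_assoc L M M M (bimod_tensor_map L T M \<Delta> id X)) \<in> linear_maps K T MT"
  unfolding bimod_tensor_map_def id_def
  by (rule linear_maps_comp[OF assoc_linear bimod_lift_linear[OF MM TM_module \<Delta>_elTM_balanced]])

lemma coassoc_left_el:
  assumes "a \<in> carrier B" "b \<in> carrier B"
  shows "bimod_assoc L M M M (bimod_tensor_map L T M \<Delta> id (el a b)) =
    lift MT (\<lambda>m n. elMT m (el n b)) (\<Delta> a)"
  unfolding bimod_tensor_map_def id_def
  using bimod_lift_elem[OF MM TM_module \<Delta>_elTM_balanced, of a b] assms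
  by (simp add: assoc_elTM linear_maps_closed[OF \<Delta>_lin])

lemma coassoc_right_linear: "bimod_tensor_map L M T id \<Delta> \<in> linear_maps K T MT"
  unfolding bimod_tensor_map_def id_def
  by (rule bimod_lift_linear[OF MM MT_module \<Delta>_elMT_balanced])

lemma coassoc_right_el:
  assumes "a \<in> carrier B" "b \<in> carrier B"
  shows "bimod_tensor_map L M T id \<Delta> (el a b) = elMT a (\<Delta> b)"
  unfolding bimod_tensor_map_def id_def
  using bimod_lift_elem[OF MM MT_module \<Delta>_elMT_balanced, of a b] assms by simp

end

section \<open>Factorwise multiplication and the Takeuchi product\<close>

definition fmult :: "'b \<Rightarrow> 'b \<Rightarrow> ('b, 'b) tens \<Rightarrow> ('b, 'b) tens" where
  "fmult a b Y = lift T (\<lambda>a' b'. el (a \<otimes>\<^bsub>B\<^esub> a') (b \<otimes>\<^bsub>B\<^esub> b')) Y"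

text \<open>The balancing relation multiplies on the right, so left multiplication by fixed
  \<open>a\<close> and \<open>b\<close> preserves it by associativity, for arbitrary
  \<open>a\<close> and \<open>b\<close>.\<close>

lemma fmult_balanced:
  assumes "a \<in> carrier B" "b \<in> carrier B"
  shows "bimod_balanced K L M M T (\<lambda>a' b'. el (a \<otimes>\<^bsub>B\<^esub> a') (b \<otimes>\<^bsub>B\<^esub> b'))"
  by (intro bimod_balancedI)
    (use assms in \<open>auto intro!: st_lin simp: st_closed el_balanced simp flip: B.m_assoc\<close>)

lemma fmult_linear: "\<lbrakk>a \<in> carrier B; b \<in> carrier B\<rbrakk> \<Longrightarrow> fmult a b \<in> linear_maps K T T"
  unfolding fmult_def by (rule bimod_lift_linear[OF MM T_module fmult_balanced])

lemma fmult_closed: "\<lbrakk>a \<in> carrier B; b \<in> carrier B; Y \<in> carrier T\<rbrakk> \<Longrightarrow> fmult a b Y \<in> carrier T"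
  by (rule linear_maps_closed[OF fmult_linear])

lemma fmult_el: "\<lbrakk>a \<in> carrier B; b \<in> carrier B; c \<in> carrier B; d \<in> carrier B\<rbrakk> \<Longrightarrow>
    fmult a b (el c d) = el (a \<otimes>\<^bsub>B\<^esub> c) (b \<otimes>\<^bsub>B\<^esub> d)"
  unfolding fmult_def by (rule bimod_lift_elem[OF MM T_module fmult_balanced]) auto

lemma lin_fmult: "\<lbrakk>f \<in> linear_maps K P T; a \<in> carrier B; b \<in> carrier B\<rbrakk> \<Longrightarrow>
    (\<lambda>x. fmult a b (f x)) \<in> linear_maps K P T"
  by (rule linear_maps_comp[OF fmult_linear])

lemma fmult_linear_left: "\<lbrakk>b \<in> carrier B; Y \<in> carrier T\<rbrakk> \<Longrightarrow> (\<lambda>a. fmult a b Y) \<in> linear_maps K B T"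
  unfolding fmult_def
  by (rule linear_bimod_lift_fun[OF MM T_module B_mod]) (auto intro!: st_lin fmult_balanced)

lemma fmult_linear_right: "\<lbrakk>a \<in> carrier B; Y \<in> carrier T\<rbrakk> \<Longrightarrow> (\<lambda>b. fmult a b Y) \<in> linear_maps K B T"
  unfolding fmult_def
  by (rule linear_bimod_lift_fun[OF MM T_module B_mod]) (auto intro!: st_lin fmult_balanced)

lemma fmult_fmult:
  assumes "a \<in> carrier B" "b \<in> carrier B" "c \<in> carrier B" "d \<in> carrier B" "Y \<in> carrier T"
  shows "fmult a b (fmult c d Y) = fmult (a \<otimes>\<^bsub>B\<^esub> c) (b \<otimes>\<^bsub>B\<^esub> d) Y"
  by (rule T_eqI[of T "\<lambda>Y. fmult a b (fmult c d Y)" "fmult (a \<otimes>\<^bsub>B\<^esub> c) (b \<otimes>\<^bsub>B\<^esub> d)", OF T_module])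
    (use assms in \<open>auto intro!: lin_fmult fmult_linear simp: fmult_el B.m_assoc\<close>)

abbreviation "R \<equiv> takeuchi_algebra L B s t"

lemma takeuchi_iff: "z \<in> carrier R \<longleftrightarrow> z \<in> carrier T \<and>
    (\<forall>l\<in>carrier L. fmult (s l) \<one>\<^bsub>B\<^esub> z = fmult \<one>\<^bsub>B\<^esub> (t l) z)"
proof -
  have "bimod_tensor_map L M M (\<lambda>a. s l \<otimes>\<^bsub>B\<^esub> a) id z = fmult (s l) \<one>\<^bsub>B\<^esub> z"
    "bimod_tensor_map L M M id (\<lambda>b. t l \<otimes>\<^bsub>B\<^esub> b) z = fmult \<one>\<^bsub>B\<^esub> (t l) z"
    if "z \<in> carrier T" for l
    unfolding bimod_tensor_map_def fmult_def
    by (rule bimod_lift_cong[OF MM that]; simp)+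
  then show ?thesis
    by (auto simp: takeuchi_algebra_def Let_def)
qed

lemma takeuchi_simps: "add R = add T" "smult R = smult T" "zero R = zero T"
    "one R = el \<one>\<^bsub>B\<^esub> \<one>\<^bsub>B\<^esub>" "X \<otimes>\<^bsub>R\<^esub> Y = lift T (\<lambda>a b. fmult a b Y) X"
  by (simp_all add: takeuchi_algebra_def Let_def fmult_def)

text \<open>Balance in the left factor is the delicate side: moving \<open>s l\<close> from
  \<open>a\<close> to \<open>t l\<close> on \<open>b\<close> places these elements directly in front
  of \<open>Y\<close>, where the Takeuchi condition exchanges them.\<close>

lemma takeuchi_mult_balanced:
  assumes Y: "Y \<in> carrier R"
  shows "bimod_balanced K L M M T (\<lambda>a b. fmult a b Y)"
proof (rule bimod_balancedI)
  have YT: "Y \<in> carrier T" and eq: "\<And>l. l \<in> carrier L \<Longrightarrow> fmult (s l) \<one>\<^bsub>B\<^esub> Y = fmult \<one>\<^bsub>B\<^esub> (t l) Y"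
    using Y by (auto simp: takeuchi_iff)
  show "(\<lambda>n. fmult m n Y) \<in> linear_maps K M T" if "m \<in> carrier M" for m
    using that by (simp add: fmult_linear_right YT)
  show "(\<lambda>m. fmult m n Y) \<in> linear_maps K M T" if "n \<in> carrier M" for n
    using that by (simp add: fmult_linear_left YT)
  fix m l n assume "m \<in> carrier M" "l \<in> carrier L" "n \<in> carrier M"
  then have *: "m \<in> carrier B" "l \<in> carrier L" "n \<in> carrier B" by auto
  have "fmult (m \<otimes>\<^bsub>B\<^esub> s l) (n \<otimes>\<^bsub>B\<^esub> \<one>\<^bsub>B\<^esub>) Y = fmult m n (fmult (s l) \<one>\<^bsub>B\<^esub> Y)"
    by (rule fmult_fmult[symmetric]) (auto simp: * s_closed YT)
  also have "\<dots> = fmult (m \<otimes>\<^bsub>B\<^esub> \<one>\<^bsub>B\<^esub>) (n \<otimes>\<^bsub>B\<^esub> t l) Y"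
    unfolding eq[OF *(2)] by (rule fmult_fmult) (auto simp: * t_closed YT)
  finally show "fmult (rsmul M m l) n Y = fmult m (lsmul M l n) Y"
    using * by simp
qed

text \<open>Membership in the Takeuchi product is demanded of the right factor alone; the left
  factor ranges over the whole tensor product.\<close>

lemma takeuchi_linear_left:
  assumes "Y \<in> carrier R"
  shows "(\<lambda>X. X \<otimes>\<^bsub>R\<^esub> Y) \<in> linear_maps K T T"
  unfolding takeuchi_simps by (rule bimod_lift_linear[OF MM T_module takeuchi_mult_balanced[OF assms]])

lemma takeuchi_mult_el:
  assumes "Y \<in> carrier R" "a \<in> carrier B" "b \<in> carrier B"
  shows "el a b \<otimes>\<^bsub>R\<^esub> Y = fmult a b Y"
  unfolding takeuchi_simps
  by (rule bimod_lift_elem[OF MM T_module takeuchi_mult_balanced[OF assms(1)]]) (use assms in auto)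

end


lemma regular_bimodule_simps [simp]:
  "carrier (regular_bimodule L) = carrier L" "add (regular_bimodule L) = add L"
  "smult (regular_bimodule L) = smult L"
  "lsmul (regular_bimodule L) = (\<lambda>l x. l \<otimes>\<^bsub>L\<^esub> x)" "rsmul (regular_bimodule L) = (\<lambda>x l. x \<otimes>\<^bsub>L\<^esub> l)"
  by (simp_all add: regular_bimodule_def module.defs bimod.defs)

section \<open>The algebra \<open>V \<ltimes> (L \<otimes> L\<^sub>o\<^sub>p)\<close>\<close>

text \<open>The data entering the multiplication: the coaction of H on L, and the pairing through
  which H acts on V from both sides.\<close>

locale smash_data = comodule_algebra K H L coact + bialgebra_pairing K H V pair
  for K :: "'k ring" and H :: "('k, 'h) hopf" and V :: "('k, 'v) hopf"
    and L :: "('k, 'l) module" and pair :: "'h \<Rightarrow> 'v \<Rightarrow> 'k" and coact :: "'l \<Rightarrow> ('h, 'l) tens"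
begin

interpretation HA: assoc_algebra K H by (rule H.assoc_algebra)
interpretation VA: assoc_algebra K V by (rule V.assoc_algebra)
interpretation LA: assoc_algebra K L by (rule L_algebra)

abbreviation mult_L (infixl "\<bullet>" 70) where "x \<bullet> y \<equiv> x \<otimes>\<^bsub>L\<^esub> y"
abbreviation one_L ("\<one>\<^sub>L") where "\<one>\<^sub>L \<equiv> \<one>\<^bsub>L\<^esub>"
abbreviation "sm \<equiv> smash_elem K V L"
abbreviation "B \<equiv> smash_algebra K V L pair coact"
abbreviation mult_B (infixl "\<star>" 70) where "x \<star> y \<equiv> x \<otimes>\<^bsub>B\<^esub> y"
abbreviation (input) "T3 \<equiv> tensor_algebra K (tensor_algebra K V L) (opposite L)"

lemma opposite_module: "module K (opposite L)"
  by (rule module_transfer[OF L_module]) (auto simp: fun_eq_iff)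

lemma B_simps:
  "carrier B = carrier T3" "add B = add T3" "zero B = zero T3" "smult B = smult T3"
  by (simp_all add: smash_algebra_def Let_def)

lemma B_one: "\<one>\<^bsub>B\<^esub> = sm \<one>\<^bsub>V\<^esub> \<one>\<^sub>L \<one>\<^sub>L"
  by (simp add: smash_algebra_def Let_def smash_elem_def tensor_algebra_def)

lemma T3_module: "module K T3"
  by (intro tensor_module mods L_module opposite_module)

lemma B_module: "module K B"
  by (rule module_transfer[OF T3_module]) (simp_all add: B_simps)

lemma B_linear_dom: "linear_maps K B G = linear_maps K T3 G"
  by (rule linear_maps_transfer) (simp_all add: B_simps)

lemma B_linear_cod: "linear_maps K G B = linear_maps K G T3"
  by (rule linear_maps_transfer) (simp_all add: B_simps)

lemmas Bmods = mods L_module L_algebra B_module HA.is_cring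

interpretation BM: module K B by (rule B_module)

lemmas Vs = mods(2) L_module opposite_module

lemma lin_sm1 [lin]:
  assumes "f \<in> linear_maps K M V" "l \<in> carrier L" "m \<in> carrier L"
  shows "(\<lambda>x. sm (f x) l m) \<in> linear_maps K M B"
  unfolding smash_elem_def B_linear_cod
  by (intro lin_elem_left[OF tensor_module[OF Vs(1,2)] Vs(3)] lin_elem_left[OF Vs(1,2)]) (use assms in auto)

lemma lin_sm2 [lin]:
  assumes "f \<in> linear_maps K M L" "u \<in> carrier V" "m \<in> carrier L"
  shows "(\<lambda>x. sm u (f x) m) \<in> linear_maps K M B"
  unfolding smash_elem_def B_linear_cod
  by (intro lin_elem_left[OF tensor_module[OF Vs(1,2)] Vs(3)] lin_elem_right[OF Vs(1,2)]) (use assms in auto)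

lemma lin_sm3 [lin]:
  assumes "f \<in> linear_maps K M L" "u \<in> carrier V" "l \<in> carrier L"
  shows "(\<lambda>x. sm u l (f x)) \<in> linear_maps K M B"
  unfolding smash_elem_def B_linear_cod
  by (intro lin_elem_right[OF tensor_module[OF Vs(1,2)] Vs(3)])
    (use assms Vs in \<open>auto simp: linear_maps_opposite_cod\<close>)

lemma sm_closed: "\<lbrakk>u \<in> carrier V; l \<in> carrier L; m \<in> carrier L\<rbrakk> \<Longrightarrow> sm u l m \<in> carrier B"
  using linear_maps_closed[OF lin_sm1[OF linear_maps_id]] .

lemma trilinear_opposite: "trilinear_map K V L (opposite L) G F = trilinear_map K V L L G F"
  by (simp add: trilinear_map_def linear_maps_opposite_dom)

lemma lift_sm:
  assumes "module K G" "trilinear_map K V L L G F" "u \<in> carrier V" "l \<in> carrier L" "m \<in> carrier L"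
  shows "triple_lift G F (sm u l m) = F u l m"
  unfolding smash_elem_def
  by (rule triple_lift_elem[OF Vs]) (use assms in \<open>auto simp: trilinear_opposite\<close>)

lemma lin_triple_lift_var:
  assumes "module K G"
    and "\<And>b c. \<lbrakk>b \<in> carrier L; c \<in> carrier L\<rbrakk> \<Longrightarrow> (\<lambda>a. F a b c) \<in> linear_maps K V G"
    and "\<And>a c. \<lbrakk>a \<in> carrier V; c \<in> carrier L\<rbrakk> \<Longrightarrow> (\<lambda>b. F a b c) \<in> linear_maps K L G"
    and "\<And>a b. \<lbrakk>a \<in> carrier V; b \<in> carrier L\<rbrakk> \<Longrightarrow> (\<lambda>c. F a b c) \<in> linear_maps K L G"
  shows "triple_lift G F \<in> linear_maps K B G"
  unfolding B_linear_dom
  by (rule triple_lift_linear[OF Vs assms(1)]) (unfold trilinear_opposite, intro trilinear_mapI assms)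

lemma lin_triple_lift [lin]:
  assumes "module K G"
    and "\<And>b c. \<lbrakk>b \<in> carrier L; c \<in> carrier L\<rbrakk> \<Longrightarrow> (\<lambda>a. F a b c) \<in> linear_maps K V G"
    and "\<And>a c. \<lbrakk>a \<in> carrier V; c \<in> carrier L\<rbrakk> \<Longrightarrow> (\<lambda>b. F a b c) \<in> linear_maps K L G"
    and "\<And>a b. \<lbrakk>a \<in> carrier V; b \<in> carrier L\<rbrakk> \<Longrightarrow> (\<lambda>c. F a b c) \<in> linear_maps K L G"
    and "f \<in> linear_maps K M B"
  shows "(\<lambda>x. triple_lift G F (f x)) \<in> linear_maps K M G"
  by (rule linear_maps_comp[OF lin_triple_lift_var[OF assms(1-4)] assms(5)])

lemma lin_triple_lift_fun [lin]:
  assumes "module K G" "module K M" "X \<in> carrier B"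
    and "\<And>a b c. \<lbrakk>a \<in> carrier V; b \<in> carrier L; c \<in> carrier L\<rbrakk> \<Longrightarrow> (\<lambda>x. F x a b c) \<in> linear_maps K M G"
    and "\<And>x b c. \<lbrakk>x \<in> carrier M; b \<in> carrier L; c \<in> carrier L\<rbrakk> \<Longrightarrow> (\<lambda>a. F x a b c) \<in> linear_maps K V G"
    and "\<And>x a c. \<lbrakk>x \<in> carrier M; a \<in> carrier V; c \<in> carrier L\<rbrakk> \<Longrightarrow> (\<lambda>b. F x a b c) \<in> linear_maps K L G"
    and "\<And>x a b. \<lbrakk>x \<in> carrier M; a \<in> carrier V; b \<in> carrier L\<rbrakk> \<Longrightarrow> (\<lambda>c. F x a b c) \<in> linear_maps K L G"
  shows "(\<lambda>x. triple_lift G (F x) X) \<in> linear_maps K M G"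
  by (rule triple_linear_lift_fun[OF Vs assms(1,2)])
    (use assms(3-7) in \<open>auto simp: B_simps trilinear_opposite intro!: trilinear_mapI\<close>)

lemma B_eqI:
  assumes "f \<in> linear_maps K B G" "g \<in> linear_maps K B G" "module K G"
    and "\<And>u l m. \<lbrakk>u \<in> carrier V; l \<in> carrier L; m \<in> carrier L\<rbrakk> \<Longrightarrow> f (sm u l m) = g (sm u l m)"
    and "X \<in> carrier B"
  shows "f X = g X"
  by (rule triple_linear_eqI[OF Vs assms(3), of f g])
    (use assms in \<open>auto simp: B_linear_dom B_simps smash_elem_def\<close>)

lemma triple_cong:
  assumes "X \<in> carrier B"
    and "\<And>a b c. \<lbrakk>a \<in> carrier V; b \<in> carrier L; c \<in> carrier L\<rbrakk> \<Longrightarrow> F a b c = F' a b c"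
  shows "triple_lift G F X = triple_lift G F' X"
  by (rule triple_lift_cong[OF Vs]) (use assms in \<open>auto simp: B_simps\<close>)

lemma triple_lift_sm:
  assumes "module K G"
    and "\<And>b c. \<lbrakk>b \<in> carrier L; c \<in> carrier L\<rbrakk> \<Longrightarrow> (\<lambda>a. F a b c) \<in> linear_maps K V G"
    and "\<And>a c. \<lbrakk>a \<in> carrier V; c \<in> carrier L\<rbrakk> \<Longrightarrow> (\<lambda>b. F a b c) \<in> linear_maps K L G"
    and "\<And>a b. \<lbrakk>a \<in> carrier V; b \<in> carrier L\<rbrakk> \<Longrightarrow> (\<lambda>c. F a b c) \<in> linear_maps K L G"
    and "u \<in> carrier V" "l \<in> carrier L" "m \<in> carrier L"
  shows "triple_lift G F (sm u l m) = F u l m"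
  by (intro lift_sm assms trilinear_mapI)

lemma tensor_lift_B:
  fixes f :: "'c \<Rightarrow> 'd \<Rightarrow> (('v, 'l) tens, 'l) tens"
  shows "lift B f X = lift T3 f X"
  by (rule tensor_lift_transfer) (simp_all add: B_simps)

section \<open>The product in terms of the three left multiplication operators\<close>

definition opV :: "'v \<Rightarrow> (('v, 'l) tens, 'l) tens \<Rightarrow> (('v, 'l) tens, 'l) tens" where
  "opV u Y = triple_lift B (\<lambda>v a b. sm (u \<otimes>\<^bsub>V\<^esub> v) a b) Y"

definition opS :: "'l \<Rightarrow> (('v, 'l) tens, 'l) tens \<Rightarrow> (('v, 'l) tens, 'l) tens" where
  "opS l Y = triple_lift B (\<lambda>v a b.
     lift B (\<lambda>l1 l2. sm (rt l1 v) (l2 \<bullet> a) b) (coact l)) Y"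

text \<open>The factor \<open>b \<bullet> m2\<close> is the product of \<open>m2\<close> and
  \<open>b\<close> in the opposite algebra.\<close>

definition opT :: "'l \<Rightarrow> (('v, 'l) tens, 'l) tens \<Rightarrow> (('v, 'l) tens, 'l) tens" where
  "opT m Y = triple_lift B (\<lambda>v a b.
     lift B (\<lambda>m1 m2. sm (lt m1 v) a (b \<bullet> m2)) (coact m)) Y"

lemmas lins = lin linear_maps_id Bmods
lemmas cl = closed LA.m_closed sm_closed VA.one_closed LA.one_closed HA.one_closed

lemma lin_opV1 [lin]: "\<lbrakk>f \<in> linear_maps K M B; u \<in> carrier V\<rbrakk> \<Longrightarrow> (\<lambda>x. opV u (f x)) \<in> linear_maps K M B"
  unfolding opV_def by (intro lins) (auto simp: cl)

lemma lin_opS1 [lin]: "\<lbrakk>f \<in> linear_maps K M B; u \<in> carrier L\<rbrakk> \<Longrightarrow> (\<lambda>x. opS u (f x)) \<in> linear_maps K M B"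
  unfolding opS_def by (intro lins) (auto simp: cl)

lemma lin_opT1 [lin]: "\<lbrakk>f \<in> linear_maps K M B; u \<in> carrier L\<rbrakk> \<Longrightarrow> (\<lambda>x. opT u (f x)) \<in> linear_maps K M B"
  unfolding opT_def by (intro lins) (auto simp: cl)

lemma opV_linear: "Y \<in> carrier B \<Longrightarrow> (\<lambda>u. opV u Y) \<in> linear_maps K V B"
  unfolding opV_def by (intro lins) (auto simp: cl)

lemma opS_linear: "Y \<in> carrier B \<Longrightarrow> (\<lambda>u. opS u Y) \<in> linear_maps K L B"
  unfolding opS_def by (intro lins) (auto simp: cl)

lemma opT_linear: "Y \<in> carrier B \<Longrightarrow> (\<lambda>u. opT u Y) \<in> linear_maps K L B"
  unfolding opT_def by (intro lins) (auto simp: cl)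

lemma lin_opV2 [lin]: "\<lbrakk>f \<in> linear_maps K M V; Y \<in> carrier B\<rbrakk> \<Longrightarrow> (\<lambda>x. opV (f x) Y) \<in> linear_maps K M B"
  by (rule linear_maps_comp[OF opV_linear])

lemma lin_opS2 [lin]: "\<lbrakk>f \<in> linear_maps K M L; Y \<in> carrier B\<rbrakk> \<Longrightarrow> (\<lambda>x. opS (f x) Y) \<in> linear_maps K M B"
  by (rule linear_maps_comp[OF opS_linear])

lemma lin_opT2 [lin]: "\<lbrakk>f \<in> linear_maps K M L; Y \<in> carrier B\<rbrakk> \<Longrightarrow> (\<lambda>x. opT (f x) Y) \<in> linear_maps K M B"
  by (rule linear_maps_comp[OF opT_linear])

lemma opV_closed: "\<lbrakk>u \<in> carrier V; Y \<in> carrier B\<rbrakk> \<Longrightarrow> opV u Y \<in> carrier B"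
  using linear_maps_closed[OF opV_linear] .
lemma opS_closed: "\<lbrakk>u \<in> carrier L; Y \<in> carrier B\<rbrakk> \<Longrightarrow> opS u Y \<in> carrier B"
  using linear_maps_closed[OF opS_linear] .
lemma opT_closed: "\<lbrakk>u \<in> carrier L; Y \<in> carrier B\<rbrakk> \<Longrightarrow> opT u Y \<in> carrier B"
  using linear_maps_closed[OF opT_linear] .

lemmas lins' = lin linear_maps_id Bmods
lemmas cl' = cl opV_closed opS_closed opT_closed

lemma opV_sm: "\<lbrakk>u \<in> carrier V; v \<in> carrier V; a \<in> carrier L; b \<in> carrier L\<rbrakk> \<Longrightarrow>
    opV u (sm v a b) = sm (u \<otimes>\<^bsub>V\<^esub> v) a b"
  unfolding opV_def by (intro triple_lift_sm lins') (auto simp: cl)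

lemma opS_sm: "\<lbrakk>l \<in> carrier L; v \<in> carrier V; a \<in> carrier L; b \<in> carrier L\<rbrakk> \<Longrightarrow>
    opS l (sm v a b) = lift B (\<lambda>l1 l2. sm (rt l1 v) (l2 \<bullet> a) b) (coact l)"
  unfolding opS_def by (intro triple_lift_sm lins') (auto simp: cl)

lemma opT_sm: "\<lbrakk>m \<in> carrier L; v \<in> carrier V; a \<in> carrier L; b \<in> carrier L\<rbrakk> \<Longrightarrow>
    opT m (sm v a b) = lift B (\<lambda>m1 m2. sm (lt m1 v) a (b \<bullet> m2)) (coact m)"
  unfolding opT_def by (intro triple_lift_sm lins') (auto simp: cl)

lemma linear_opS:
  assumes "\<phi> \<in> linear_maps K B G" "module K G"
    and "l \<in> carrier L" "v \<in> carrier V" "a \<in> carrier L" "b \<in> carrier L"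
  shows "\<phi> (opS l (sm v a b)) = lift G (\<lambda>l1 l2. \<phi> (sm (rt l1 v) (l2 \<bullet> a) b)) (coact l)"
  unfolding opS_sm[OF assms(3-6)] by (intro linear_coact lins' assms) (auto simp: cl assms)

lemma linear_opT:
  assumes "\<phi> \<in> linear_maps K B G" "module K G"
    and "m \<in> carrier L" "v \<in> carrier V" "a \<in> carrier L" "b \<in> carrier L"
  shows "\<phi> (opT m (sm v a b)) = lift G (\<lambda>m1 m2. \<phi> (sm (lt m1 v) a (b \<bullet> m2))) (coact m)"
  unfolding opT_sm[OF assms(3-6)] by (intro linear_coact lins' assms) (auto simp: cl assms)

text \<open>The operators are composed so that \<open>lt\<close> is applied inside
  \<open>rt\<close>, as in the product formula; their sums come out in the other order and are
  interchanged.\<close>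

lemma op_sm:
  assumes "u \<in> carrier V" "l \<in> carrier L" "m \<in> carrier L" "v \<in> carrier V" "a \<in> carrier L" "b \<in> carrier L"
  shows "opV u (opS l (opT m (sm v a b))) = lift B (\<lambda>l1 l2. lift B (\<lambda>m1 m2.
      sm (u \<otimes>\<^bsub>V\<^esub> rt l1 (lt m1 v)) (l2 \<bullet> a) (b \<bullet> m2)) (coact m)) (coact l)" (is "_ = ?r")
proof -
  have "opV u (opS l (opT m (sm v a b))) =
      lift B (\<lambda>m1 m2. opV u (opS l (sm (lt m1 v) a (b \<bullet> m2)))) (coact m)"
    by (intro linear_opT[of "\<lambda>y. opV u (opS l y)"] lins' assms)
  also have "\<dots> = lift B (\<lambda>m1 m2. lift B (\<lambda>l1 l2.
      opV u (sm (rt l1 (lt m1 v)) (l2 \<bullet> a) (b \<bullet> m2))) (coact l)) (coact m)"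
    by (intro coact_cong linear_opS[of "\<lambda>y. opV u y"] lins' assms) (auto simp: cl assms)
  also have "\<dots> = lift B (\<lambda>m1 m2. lift B (\<lambda>l1 l2.
      sm (u \<otimes>\<^bsub>V\<^esub> rt l1 (lt m1 v)) (l2 \<bullet> a) (b \<bullet> m2)) (coact l)) (coact m)"
    by (intro coact_cong assms opV_sm) (auto simp: cl assms)
  also have "\<dots> = ?r"
    by (intro coact_swap lins' assms) (auto simp: cl assms)
  finally show ?thesis .
qed

text \<open>For fixed \<open>u\<close>, \<open>l\<close>, \<open>m\<close> the defining inner sum
  and the composite of operators are linear in \<open>Y\<close> and agree on elementary tensors.
  This replaces the nested lifts in the definition of the product.\<close>

lemma mult_B:
  assumes X: "X \<in> carrier B" and Y: "Y \<in> carrier B"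
  shows "X \<star> Y = triple_lift B (\<lambda>u l m. opV u (opS l (opT m Y))) X"
proof -
  let ?f = "\<lambda>u l m v a b. lift B (\<lambda>l1 l2. lift B (\<lambda>m1 m2.
      sm (u \<otimes>\<^bsub>V\<^esub> rt l1 (lt m1 v)) (l2 \<bullet> a) (b \<bullet> m2)) (coact m)) (coact l)"
  have "X \<star> Y = triple_lift B (\<lambda>u l m. triple_lift B (?f u l m) Y) X"
    unfolding triple_lift_def tensor_lift_B by (simp add: smash_algebra_def Let_def triple_lift_def)
  also have "\<dots> = triple_lift B (\<lambda>u l m. opV u (opS l (opT m Y))) X"
  proof (rule triple_cong[OF X])
    fix u l m assume ulm: "u \<in> carrier V" "l \<in> carrier L" "m \<in> carrier L"
    show "triple_lift B (?f u l m) Y = opV u (opS l (opT m Y))"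
    proof (rule B_eqI[of _ B "\<lambda>Y. opV u (opS l (opT m Y))", OF _ _ B_module _ Y])
      show "triple_lift B (?f u l m) \<in> linear_maps K B B"
        by (intro lins') (auto simp: cl ulm)
      fix v a b assume vab: "v \<in> carrier V" "a \<in> carrier L" "b \<in> carrier L"
      show "triple_lift B (?f u l m) (sm v a b) = opV u (opS l (opT m (sm v a b)))"
        unfolding op_sm[OF ulm vab] by (intro triple_lift_sm lins' vab) (auto simp: cl ulm)
    qed (intro lins' ulm)
  qed
  finally show ?thesis .
qed

lemma sm_mult:
  assumes "u \<in> carrier V" "l \<in> carrier L" "m \<in> carrier L" "Y \<in> carrier B"
  shows "sm u l m \<star> Y = opV u (opS l (opT m Y))"
  unfolding mult_B[OF sm_closed[OF assms(1-3)] assms(4)]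
  by (intro triple_lift_sm lins' assms) (auto simp: cl' assms)

section \<open>Relations between the operators\<close>

lemma op_eqI:
  assumes "f \<in> linear_maps K B B" "g \<in> linear_maps K B B" "Y \<in> carrier B"
    and "\<And>u l m. \<lbrakk>u \<in> carrier V; l \<in> carrier L; m \<in> carrier L\<rbrakk> \<Longrightarrow> f (sm u l m) = g (sm u l m)"
  shows "f Y = g Y"
  by (rule B_eqI[OF assms(1,2) B_module assms(4,3)])

lemma opV_opV:
  assumes "u \<in> carrier V" "v \<in> carrier V" "Y \<in> carrier B"
  shows "opV u (opV v Y) = opV (u \<otimes>\<^bsub>V\<^esub> v) Y"
  by (rule op_eqI[of "\<lambda>Y. opV u (opV v Y)" "\<lambda>Y. opV (u \<otimes>\<^bsub>V\<^esub> v) Y", OF _ _ assms(3)])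
    (intro lins' cl assms | simp add: opV_sm cl assms VA.m_assoc)+

lemma opV_one: "Y \<in> carrier B \<Longrightarrow> opV \<one>\<^bsub>V\<^esub> Y = Y"
  by (rule op_eqI[of "\<lambda>Y. opV \<one>\<^bsub>V\<^esub> Y" "\<lambda>Y. Y"])
    (intro lins' cl | simp add: opV_sm cl)+

lemma opS_one: "Y \<in> carrier B \<Longrightarrow> opS \<one>\<^sub>L Y = Y"
proof (rule op_eqI[of "\<lambda>Y. opS \<one>\<^sub>L Y" "\<lambda>Y. Y"])
  fix u l m assume *: "u \<in> carrier V" "l \<in> carrier L" "m \<in> carrier L"
  have "opS \<one>\<^sub>L (sm u l m) = sm (rt \<one>\<^bsub>H\<^esub> u) (\<one>\<^sub>L \<bullet> l) m"
    unfolding opS_sm[OF LA.one_closed *] by (intro coact_one lins') (auto simp: cl *)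
  then show "opS \<one>\<^sub>L (sm u l m) = sm u l m" by (simp add: * rt_one)
qed (intro lins' cl | assumption)+

lemma opT_one: "Y \<in> carrier B \<Longrightarrow> opT \<one>\<^sub>L Y = Y"
proof (rule op_eqI[of "\<lambda>Y. opT \<one>\<^sub>L Y" "\<lambda>Y. Y"])
  fix u l m assume *: "u \<in> carrier V" "l \<in> carrier L" "m \<in> carrier L"
  have "opT \<one>\<^sub>L (sm u l m) = sm (lt \<one>\<^bsub>H\<^esub> u) l (m \<bullet> \<one>\<^sub>L)"
    unfolding opT_sm[OF LA.one_closed *] by (intro coact_one lins') (auto simp: cl *)
  then show "opT \<one>\<^sub>L (sm u l m) = sm u l m" by (simp add: * lt_one)
qed (intro lins' cl | assumption)+

text \<open>Multiplicativity of the coaction matches the left action law of \<open>rt\<close> in one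
  leg and associativity of L in the other.\<close>

lemma opS_opS:
  assumes "l \<in> carrier L" "a \<in> carrier L" "Y \<in> carrier B"
  shows "opS l (opS a Y) = opS (l \<bullet> a) Y" (is "?f Y = ?g Y")
proof (rule op_eqI[of ?f ?g, OF _ _ assms(3)])
  fix v c d assume *: "v \<in> carrier V" "c \<in> carrier L" "d \<in> carrier L"
  have "?f (sm v c d) = lift B (\<lambda>a1 a2. opS l (sm (rt a1 v) (a2 \<bullet> c) d)) (coact a)"
    by (intro linear_opS[of "\<lambda>Y. opS l Y"] lins' assms *)
  also have "\<dots> = lift B (\<lambda>a1 a2. lift B (\<lambda>l1 l2.
      sm (rt l1 (rt a1 v)) (l2 \<bullet> (a2 \<bullet> c)) d) (coact l)) (coact a)"
    by (intro coact_cong assms opS_sm) (auto simp: cl *)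
  also have "\<dots> = lift B (\<lambda>l1 l2. lift B (\<lambda>a1 a2.
      sm (rt l1 (rt a1 v)) (l2 \<bullet> (a2 \<bullet> c)) d) (coact a)) (coact l)"
    by (intro coact_swap lins' assms) (auto simp: cl *)
  also have "\<dots> = lift B (\<lambda>l1 l2. lift B (\<lambda>a1 a2.
      sm (rt (l1 \<otimes>\<^bsub>H\<^esub> a1) v) ((l2 \<bullet> a2) \<bullet> c) d) (coact a)) (coact l)"
    by (intro coact_cong assms) (simp add: rt_mult LA.m_assoc *)
  also have "\<dots> = ?g (sm v c d)"
    unfolding opS_sm[OF LA.m_closed[OF assms(1,2)] *]
    by (intro coact_mult[symmetric] lins' assms) (auto simp: cl *)
  finally show "?f (sm v c d) = ?g (sm v c d)" .
qed (intro lins' cl assms)+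

text \<open>Two reversals agree: \<open>lt\<close> is an action of the opposite algebra, and the
  last leg of B multiplies in the opposite of L. The coaction of \<open>b \<bullet> m\<close>
  therefore fits both.\<close>

lemma opT_opT:
  assumes "m \<in> carrier L" "b \<in> carrier L" "Y \<in> carrier B"
  shows "opT m (opT b Y) = opT (b \<bullet> m) Y" (is "?f Y = ?g Y")
proof (rule op_eqI[of ?f ?g, OF _ _ assms(3)])
  fix v c d assume *: "v \<in> carrier V" "c \<in> carrier L" "d \<in> carrier L"
  have "?f (sm v c d) = lift B (\<lambda>b1 b2. opT m (sm (lt b1 v) c (d \<bullet> b2))) (coact b)"
    by (intro linear_opT[of "\<lambda>Y. opT m Y"] lins' assms *)
  also have "\<dots> = lift B (\<lambda>b1 b2. lift B (\<lambda>m1 m2.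
      sm (lt m1 (lt b1 v)) c ((d \<bullet> b2) \<bullet> m2)) (coact m)) (coact b)"
    by (intro coact_cong assms opT_sm) (auto simp: cl *)
  also have "\<dots> = lift B (\<lambda>b1 b2. lift B (\<lambda>m1 m2.
      sm (lt (b1 \<otimes>\<^bsub>H\<^esub> m1) v) c (d \<bullet> (b2 \<bullet> m2))) (coact m)) (coact b)"
    by (intro coact_cong assms) (simp add: lt_mult LA.m_assoc *)
  also have "\<dots> = ?g (sm v c d)"
    unfolding opT_sm[OF LA.m_closed[OF assms(2,1)] *]
    by (intro coact_mult[symmetric] lins' assms) (auto simp: cl *)
  finally show "?f (sm v c d) = ?g (sm v c d)" .
qed (intro lins' cl assms)+

text \<open>The operators act on different legs of L, and on V through commuting actions.\<close>

lemma opT_opS: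
  assumes "l \<in> carrier L" "m \<in> carrier L" "Y \<in> carrier B"
  shows "opT m (opS l Y) = opS l (opT m Y)" (is "?f Y = ?g Y")
proof (rule op_eqI[of ?f ?g, OF _ _ assms(3)])
  fix v c d assume *: "v \<in> carrier V" "c \<in> carrier L" "d \<in> carrier L"
  have "?f (sm v c d) = lift B (\<lambda>l1 l2. opT m (sm (rt l1 v) (l2 \<bullet> c) d)) (coact l)"
    by (intro linear_opS[of "\<lambda>Y. opT m Y"] lins' assms *)
  also have "\<dots> = lift B (\<lambda>l1 l2. lift B (\<lambda>m1 m2.
      sm (lt m1 (rt l1 v)) (l2 \<bullet> c) (d \<bullet> m2)) (coact m)) (coact l)"
    by (intro coact_cong assms opT_sm) (auto simp: cl *)
  also have "\<dots> = lift B (\<lambda>l1 l2. lift B (\<lambda>m1 m2.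
      sm (\<one>\<^bsub>V\<^esub> \<otimes>\<^bsub>V\<^esub> rt l1 (lt m1 v)) (l2 \<bullet> c) (d \<bullet> m2)) (coact m)) (coact l)"
    by (intro coact_cong assms) (simp add: rt_lt_commute * cl)
  also have "\<dots> = ?g (sm v c d)"
    by (simp add: op_sm[symmetric] opV_one cl' * assms)
  finally show "?f (sm v c d) = ?g (sm v c d)" .
qed (intro lins' cl assms)+

text \<open>The cross relation s(l) v = (l1 \<triangleright> v) s(l2). The first leg of the coaction
  acts on a product v w and splits over it by its coproduct; coassociativity hands the second half
  to w together with the L-leg.\<close>

lemma opS_opV:
  assumes "l \<in> carrier L" "v \<in> carrier V" "Y \<in> carrier B"
  shows "opS l (opV v Y) = lift B (\<lambda>l1 l2. opV (rt l1 v) (opS l2 Y)) (coact l)" (is "?f Y = ?g Y")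
proof (rule op_eqI[of ?f ?g, OF _ _ assms(3)])
  fix w c d assume *: "w \<in> carrier V" "c \<in> carrier L" "d \<in> carrier L"
  have "?f (sm w c d) = lift B (\<lambda>l1 l2. sm (rt l1 (v \<otimes>\<^bsub>V\<^esub> w)) (l2 \<bullet> c) d) (coact l)"
    by (simp add: opV_sm opS_sm * assms cl)
  also have "\<dots> = lift B (\<lambda>l1 l2. lift B (\<lambda>x y.
      sm (rt x v \<otimes>\<^bsub>V\<^esub> rt y w) (l2 \<bullet> c) d) (comult H l1)) (coact l)"
    by (intro coact_cong assms, subst rt_V_mult, (auto simp: * assms)[3],
        intro H.linear_comult[of "\<lambda>Y. sm Y _ _"] lins') (auto simp: cl * assms)
  also have "\<dots> = lift B (\<lambda>x l'. lift B (\<lambda>y l2.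
      sm (rt x v \<otimes>\<^bsub>V\<^esub> rt y w) (l2 \<bullet> c) d) (coact l')) (coact l)"
    by (intro coact_coassoc lins' assms) (auto simp: cl * assms)
  also have "\<dots> = lift B (\<lambda>x l'. lift B (\<lambda>y l2.
      opV (rt x v) (sm (rt y w) (l2 \<bullet> c) d)) (coact l')) (coact l)"
    by (intro coact_cong assms opV_sm[symmetric]) (auto simp: cl * assms)
  also have "\<dots> = ?g (sm w c d)"
    by (intro coact_cong linear_opS[of "\<lambda>Y. opV _ Y", symmetric] lins' assms *) (auto simp: cl assms)
  finally show "?f (sm w c d) = ?g (sm w c d)" .
qed (intro lins' | auto simp: cl' assms)+

text \<open>The analogous cross relation for t, with \<open>lt\<close>; no reversal occurs because
  \<open>lt\<close> splits over products of V in the same order as \<open>rt\<close>.\<close>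

lemma opT_opV:
  assumes "l \<in> carrier L" "v \<in> carrier V" "Y \<in> carrier B"
  shows "opT l (opV v Y) = lift B (\<lambda>l1 l2. opV (lt l1 v) (opT l2 Y)) (coact l)" (is "?f Y = ?g Y")
proof (rule op_eqI[of ?f ?g, OF _ _ assms(3)])
  fix w c d assume *: "w \<in> carrier V" "c \<in> carrier L" "d \<in> carrier L"
  have "?f (sm w c d) = lift B (\<lambda>l1 l2. sm (lt l1 (v \<otimes>\<^bsub>V\<^esub> w)) c (d \<bullet> l2)) (coact l)"
    by (simp add: opV_sm opT_sm * assms cl)
  also have "\<dots> = lift B (\<lambda>l1 l2. lift B (\<lambda>x y.
      sm (lt x v \<otimes>\<^bsub>V\<^esub> lt y w) c (d \<bullet> l2)) (comult H l1)) (coact l)"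
    by (intro coact_cong assms, subst lt_V_mult, (auto simp: * assms)[3],
        intro H.linear_comult[of "\<lambda>Y. sm Y _ _"] lins') (auto simp: cl * assms)
  also have "\<dots> = lift B (\<lambda>x l'. lift B (\<lambda>y l2.
      sm (lt x v \<otimes>\<^bsub>V\<^esub> lt y w) c (d \<bullet> l2)) (coact l')) (coact l)"
    by (intro coact_coassoc lins' assms) (auto simp: cl * assms)
  also have "\<dots> = lift B (\<lambda>x l'. lift B (\<lambda>y l2.
      opV (lt x v) (sm (lt y w) c (d \<bullet> l2))) (coact l')) (coact l)"
    by (intro coact_cong assms opV_sm[symmetric]) (auto simp: cl * assms)
  also have "\<dots> = ?g (sm w c d)"
    by (intro coact_cong linear_opT[of "\<lambda>Y. opV _ Y", symmetric] lins' assms *) (auto simp: cl assms)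
  finally show "?f (sm w c d) = ?g (sm w c d)" .
qed (intro lins' | auto simp: cl' assms)+

section \<open>Associativity and unit\<close>

lemma mult_linear_left: "Y \<in> carrier B \<Longrightarrow> (\<lambda>X. X \<star> Y) \<in> linear_maps K B B"
  by (subst linear_maps_cong[OF mult_B B_module]) (assumption+, intro lins', auto simp: cl')

lemma mult_linear_right: "X \<in> carrier B \<Longrightarrow> (\<lambda>Y. X \<star> Y) \<in> linear_maps K B B"
  by (subst linear_maps_cong[OF mult_B B_module]) (assumption+, intro lins', auto simp: cl')

lemma mult_closed: "\<lbrakk>X \<in> carrier B; Y \<in> carrier B\<rbrakk> \<Longrightarrow> X \<star> Y \<in> carrier B"
  using linear_maps_closed[OF mult_linear_left] .

lemma lin_mult_B1: "\<lbrakk>f \<in> linear_maps K M B; Y \<in> carrier B\<rbrakk> \<Longrightarrow> (\<lambda>x. f x \<star> Y) \<in> linear_maps K M B"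
  by (rule linear_maps_comp[OF mult_linear_left])

lemma lin_mult_B2: "\<lbrakk>f \<in> linear_maps K M B; Y \<in> carrier B\<rbrakk> \<Longrightarrow> (\<lambda>x. Y \<star> f x) \<in> linear_maps K M B"
  by (rule linear_maps_comp[OF mult_linear_right])

lemma sm_mult_sm:
  assumes "u \<in> carrier V" "l \<in> carrier L" "m \<in> carrier L" "v \<in> carrier V" "a \<in> carrier L" "b \<in> carrier L"
  shows "sm u l m \<star> sm v a b = lift B (\<lambda>l1 l2. lift B (\<lambda>m1 m2.
      sm (u \<otimes>\<^bsub>V\<^esub> rt l1 (lt m1 v)) (l2 \<bullet> a) (b \<bullet> m2)) (coact m)) (coact l)"
  by (simp add: sm_mult op_sm assms cl')

text \<open>For elementary \<open>X\<close> and \<open>Y\<close> the right side is a word of six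
  operators applied to \<open>Z\<close>. The cross relations carry T and S past the second V, and
  merging gives the summands of the product formula for \<open>X \<star> Y\<close>.\<close>

lemma mult_assoc_B:
  assumes X: "X \<in> carrier B" and Y: "Y \<in> carrier B" and Z: "Z \<in> carrier B"
  shows "(X \<star> Y) \<star> Z = X \<star> (Y \<star> Z)"
    (is "?f X = ?g X")
proof (rule op_eqI[of ?f ?g, OF _ _ X])
  fix u l m assume ulm: "u \<in> carrier V" "l \<in> carrier L" "m \<in> carrier L"
  show "?f (sm u l m) = ?g (sm u l m)" (is "?p Y = ?q Y")
  proof (rule op_eqI[of ?p ?q, OF _ _ Y])
    fix v a b assume vab: "v \<in> carrier V" "a \<in> carrier L" "b \<in> carrier L"
    \<comment> \<open>The operators behind \<open>opV v\<close>; they stay closed up while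
      \<open>opT m\<close> and \<open>opS l\<close> cross \<open>opV v\<close>.\<close>
    define W where "W = opS a (opT b Z)"
    have W: "W \<in> carrier B" unfolding W_def by (simp add: cl' vab Z)
    have "?q (sm v a b) = opV u (opS l (opT m (opV v W)))"
      by (simp add: sm_mult ulm vab Z W_def cl')
    also have "\<dots> = lift B (\<lambda>m1 m2. opV u (opS l (opV (lt m1 v) (opT m2 W)))) (coact m)"
      unfolding opT_opV[OF ulm(3) vab(1) W]
      by (intro linear_coact[of "\<lambda>Y. opV u (opS l Y)"] lins' ulm) (auto simp: cl' ulm vab W)
    also have "\<dots> = lift B (\<lambda>m1 m2. lift B (\<lambda>l1 l2.
        opV u (opV (rt l1 (lt m1 v)) (opS l2 (opT m2 W)))) (coact l)) (coact m)"
      by (rule coact_cong[OF ulm(3)], subst opS_opV, (auto simp: cl' ulm vab W)[3],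
        intro linear_coact[of "\<lambda>Y. opV u Y"] lins' ulm) (auto simp: cl' ulm vab W)
    \<comment> \<open>Inside \<open>W\<close> the operator \<open>opT m2\<close> passes
      \<open>opS a\<close>; neighbouring operators of the same kind then merge into one elementary
      factor.\<close>
    also have "\<dots> = lift B (\<lambda>m1 m2. lift B (\<lambda>l1 l2.
        sm (u \<otimes>\<^bsub>V\<^esub> rt l1 (lt m1 v)) (l2 \<bullet> a) (b \<bullet> m2) \<star> Z) (coact l)) (coact m)"
      by (intro coact_cong ulm)
        (simp add: W_def opT_opS opS_opS opT_opT opV_opV sm_mult cl' ulm vab Z)
    also have "\<dots> = lift B (\<lambda>l1 l2. lift B (\<lambda>m1 m2.
        sm (u \<otimes>\<^bsub>V\<^esub> rt l1 (lt m1 v)) (l2 \<bullet> a) (b \<bullet> m2) \<star> Z) (coact m)) (coact l)"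
      by (intro coact_swap lin_mult_B1 lins' ulm) (auto simp: cl' ulm vab Z)
    also have "\<dots> = ?p (sm v a b)"
      unfolding sm_mult_sm[OF ulm vab]
      by (intro linear_lift2[of K H L H L B B "\<lambda>Y. Y \<star> Z", symmetric] coact_closed lin_mult_B1 lins' ulm)
        (auto simp: cl' ulm vab Z)
    finally show "?p (sm v a b) = ?q (sm v a b)" by simp
  qed (intro lin_mult_B1 lin_mult_B2 lins' mult_closed sm_closed ulm Z)+
qed (intro lin_mult_B1 lin_mult_B2 lins' mult_closed Y Z)+

text \<open>H acts on the unit of V through its counit, from both sides, and this collapses both
  coactions. Right multiplication by sources and targets thus touches only the legs in L, and the
  bimodule structure of B has no twist.\<close>

lemma sm_mult_right:
  assumes "u \<in> carrier V" "l \<in> carrier L" "m \<in> carrier L" "a \<in> carrier L" "b \<in> carrier L"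
  shows "sm u l m \<star> sm \<one>\<^bsub>V\<^esub> a b = sm u (l \<bullet> a) (b \<bullet> m)"
proof -
  have "sm u l m \<star> sm \<one>\<^bsub>V\<^esub> a b = lift B (\<lambda>l1 l2. lift B (\<lambda>m1 m2.
      sm (u \<otimes>\<^bsub>V\<^esub> rt l1 (lt m1 \<one>\<^bsub>V\<^esub>)) (l2 \<bullet> a) (b \<bullet> m2)) (coact m)) (coact l)"
    by (rule sm_mult_sm) (auto simp: assms cl)
  also have "\<dots> = lift B (\<lambda>l1 l2. lift B (\<lambda>m1 m2. counit H m1 \<odot>\<^bsub>B\<^esub>
      (counit H l1 \<odot>\<^bsub>B\<^esub> sm u (l2 \<bullet> a) (b \<bullet> m2))) (coact m)) (coact l)"
    by (intro coact_cong assms)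
      (simp add: lt_unit rt_unit linear_maps_smult[OF lin_rt_right[OF linear_maps_id]] cl assms
        VA.smult_mult_right linear_maps_smult[OF lin_sm1[OF linear_maps_id]])
  also have "\<dots> = lift B (\<lambda>l1 l2. counit H l1 \<odot>\<^bsub>B\<^esub> sm u (l2 \<bullet> a) (b \<bullet> m)) (coact l)"
    by (intro coact_cong coact_counit lins' assms) (auto simp: cl assms)
  also have "\<dots> = sm u (l \<bullet> a) (b \<bullet> m)"
    by (intro coact_counit lins' assms) (auto simp: cl assms)
  finally show ?thesis .
qed

lemma B_algebra: "assoc_algebra K B"
proof -
  note mc = mult_closed
  have one: "\<one>\<^bsub>B\<^esub> \<in> carrier B" by (simp add: B_one cl)
  have l_one: "\<one>\<^bsub>B\<^esub> \<star> X = X" if "X \<in> carrier B" for X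
    using that by (simp add: B_one sm_mult opV_one opS_one opT_one cl)
  have r_one: "X \<star> \<one>\<^bsub>B\<^esub> = X" if X: "X \<in> carrier B" for X
    by (rule op_eqI[of "\<lambda>X. X \<star> \<one>\<^bsub>B\<^esub>" "\<lambda>X. X", OF _ _ X])
      (auto simp: B_one sm_mult_right cl intro!: lin_mult_B1 lins' one[unfolded B_one])
  have "ring B"
  proof (rule ringI)
    show "abelian_group B" by unfold_locales
    show "monoid B"
      by (rule monoidI) (auto simp: mc one mult_assoc_B l_one r_one)
  qed (auto simp: linear_maps_add[OF mult_linear_left] linear_maps_add[OF mult_linear_right])
  then show ?thesis
    by (intro assoc_algebra.intro assoc_algebra_axioms.intro B_module)
      (auto simp: linear_maps_smult[OF mult_linear_left] linear_maps_smult[OF mult_linear_right])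
qed

section \<open>Source and target in the algebra B\<close>

abbreviation "so \<equiv> smash_source K V L"
abbreviation "ta \<equiv> smash_target K V L"

lemma so_closed: "l \<in> carrier L \<Longrightarrow> so l \<in> carrier B"
  by (simp add: smash_source_def cl)

lemma ta_closed: "l \<in> carrier L \<Longrightarrow> ta l \<in> carrier B"
  by (simp add: smash_target_def cl)

lemma so_mult: "\<lbrakk>l \<in> carrier L; Y \<in> carrier B\<rbrakk> \<Longrightarrow> so l \<star> Y = opS l Y"
  by (simp add: smash_source_def sm_mult opV_one opT_one cl')

lemma ta_mult: "\<lbrakk>l \<in> carrier L; Y \<in> carrier B\<rbrakk> \<Longrightarrow> ta l \<star> Y = opT l Y"
  by (simp add: smash_target_def sm_mult opV_one opS_one cl')

lemma sm_mult_so: "\<lbrakk>u \<in> carrier V; l \<in> carrier L; m \<in> carrier L; a \<in> carrier L\<rbrakk> \<Longrightarrow>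
    sm u l m \<star> so a = sm u (l \<bullet> a) m"
  by (simp add: smash_source_def sm_mult_right cl)

lemma sm_mult_ta: "\<lbrakk>u \<in> carrier V; l \<in> carrier L; m \<in> carrier L; a \<in> carrier L\<rbrakk> \<Longrightarrow>
    sm u l m \<star> ta a = sm u l (a \<bullet> m)"
  by (simp add: smash_target_def sm_mult_right cl)

lemma so_hom: "so \<in> algebra_homs K L B"
proof -
  have "so \<in> linear_maps K L B"
    unfolding smash_source_def by (intro lins') (auto simp: cl)
  moreover have "so (l \<bullet> m) = so l \<star> so m" if "l \<in> carrier L" "m \<in> carrier L" for l m
    using sm_mult_so[of "\<one>\<^bsub>V\<^esub>" l "\<one>\<^sub>L" m] that by (simp add: smash_source_def[of K V L l] smash_source_def[of K V L "l \<bullet> m"] cl)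
  ultimately show ?thesis
    by (auto simp: algebra_homs_def B_one smash_source_def intro!: ring_hom_memI
        dest: linear_maps_closed linear_maps_add)
qed

lemma ta_hom: "ta \<in> algebra_homs K (opposite L) B"
proof -
  have "ta \<in> linear_maps K (opposite L) B"
    unfolding smash_target_def linear_maps_opposite_dom by (intro lins') (auto simp: cl)
  moreover have "ta (m \<bullet> l) = ta l \<star> ta m" if "l \<in> carrier L" "m \<in> carrier L" for l m
    using sm_mult_ta[of "\<one>\<^bsub>V\<^esub>" "\<one>\<^sub>L" l m] that by (simp add: smash_target_def[of K V L l] smash_target_def[of K V L "m \<bullet> l"] cl)
  ultimately show ?thesis
    by (auto simp: algebra_homs_def B_one smash_target_def intro!: ring_hom_memI
        dest: linear_maps_closed linear_maps_add)
qed

text \<open>Both products are 1 \<otimes> l \<otimes> m.\<close>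

lemma so_ta_commute: "\<lbrakk>l \<in> carrier L; m \<in> carrier L\<rbrakk> \<Longrightarrow> so l \<star> ta m = ta m \<star> so l"
  using sm_mult_ta[of "\<one>\<^bsub>V\<^esub>" l "\<one>\<^sub>L" m] sm_mult_so[of "\<one>\<^bsub>V\<^esub>" "\<one>\<^sub>L" m l]
  by (simp add: smash_source_def[of K V L l] smash_target_def[of K V L m] cl)


section \<open>The bialgebroid structure\<close>


interpretation BA: assoc_algebra K B by (rule B_algebra)

interpretation ST: source_target K L B so ta
  by (intro source_target.intro L_algebra B_algebra so_hom ta_hom so_ta_commute)

section \<open>The coproduct: bimodule property and coassociativity\<close>

abbreviation "\<Delta> \<equiv> smash_comult K V L pair coact"
abbreviation "\<epsilon> \<equiv> smash_counit V L"

lemmas dl = lin linear_maps_id Bmods B_algebra ST.T_module ST.lin_el_left ST.lin_el_right ST.lin_fmult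
lemmas dc = cl' so_closed ta_closed ST.el_closed ST.fmult_closed

lemma smash_comult_elem_eq: "smash_comult_elem K V L pair coact u l m =
    lift ST.T (\<lambda>u1 u2. ST.el (sm u1 \<one>\<^sub>L m) (sm u2 l \<one>\<^sub>L)) (comult V u)"
  by (simp add: smash_comult_elem_def Let_def smash_bimodule_def)

lemma comult_eq: "\<Delta> X = triple_lift ST.T (smash_comult_elem K V L pair coact) X"
  by (simp add: smash_comult_def Let_def smash_bimodule_def)

lemma comult_B_linear: "\<Delta> \<in> linear_maps K B ST.T"
  unfolding comult_eq[abs_def] smash_comult_elem_eq[abs_def] by (intro dl) (auto simp: dc)

lemma lin_comult_B [lin]: "f \<in> linear_maps K M B \<Longrightarrow> (\<lambda>x. \<Delta> (f x)) \<in> linear_maps K M ST.T"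
  by (rule linear_maps_comp[OF comult_B_linear])

lemma comult_B_closed: "X \<in> carrier B \<Longrightarrow> \<Delta> X \<in> carrier ST.T"
  by (rule linear_maps_closed[OF comult_B_linear])

lemma comult_sm':
  assumes "u \<in> carrier V" "l \<in> carrier L" "m \<in> carrier L"
  shows "\<Delta> (sm u l m) = smash_comult_elem K V L pair coact u l m"
  unfolding comult_eq smash_comult_elem_eq[abs_def]
  by (intro triple_lift_sm dl assms) (auto simp: dc)

lemma comult_sm:
  assumes "u \<in> carrier V" "l \<in> carrier L" "m \<in> carrier L"
  shows "\<Delta> (sm u l m) = lift ST.T (\<lambda>u1 u2. ST.el (sm u1 \<one>\<^sub>L m) (sm u2 l \<one>\<^sub>L)) (comult V u)"
  by (simp add: comult_sm' assms smash_comult_elem_eq)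

lemma linear_comult_sm:
  assumes "\<phi> \<in> linear_maps K ST.T G" "module K G"
    and "u \<in> carrier V" "l \<in> carrier L" "m \<in> carrier L"
  shows "\<phi> (\<Delta> (sm u l m)) =
    lift G (\<lambda>u1 u2. \<phi> (ST.el (sm u1 \<one>\<^sub>L m) (sm u2 l \<one>\<^sub>L))) (comult V u)"
  unfolding comult_sm[OF assms(3-5)]
  by (intro V.linear_comult dl assms) (auto simp: dc assms)

text \<open>Right multiplication by \<open>so l\<close> changes only the source leg, which \<Delta>
  places in the second factor; the next lemma is the counterpart for the target leg and the first
  factor.\<close>

lemma comult_so:
  assumes "X \<in> carrier B" "l \<in> carrier L"
  shows "\<Delta> (X \<star> so l) = rsmul ST.T (\<Delta> X) l" (is "?f X = ?g X")
proof (rule B_eqI[of ?f _ ?g, OF _ _ ST.T_module _ assms(1)])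
  fix u a b assume *: "u \<in> carrier V" "a \<in> carrier L" "b \<in> carrier L"
  show "?f (sm u a b) = ?g (sm u a b)"
    unfolding linear_comult_sm[OF ST.rsmul_T_linear[OF assms(2)] ST.T_module *]
      sm_mult_so[OF * assms(2)] comult_sm[OF *(1) LA.m_closed[OF *(2) assms(2)] *(3)]
    by (intro V.comult_cong *) (simp add: ST.rsmul_T_el sm_mult_so dc * assms)
qed (intro linear_maps_comp[OF ST.rsmul_T_linear[OF assms(2)] comult_B_linear] | intro lin dl so_closed assms)+

lemma comult_ta:
  assumes "X \<in> carrier B" "l \<in> carrier L"
  shows "\<Delta> (X \<star> ta l) = lsmul ST.T l (\<Delta> X)" (is "?f X = ?g X")
proof (rule B_eqI[of ?f _ ?g, OF _ _ ST.T_module _ assms(1)])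
  fix u a b assume *: "u \<in> carrier V" "a \<in> carrier L" "b \<in> carrier L"
  show "?f (sm u a b) = ?g (sm u a b)"
    unfolding linear_comult_sm[OF ST.lsmul_T_linear[OF assms(2)] ST.T_module *]
      sm_mult_ta[OF * assms(2)] comult_sm[OF *(1,2) LA.m_closed[OF assms(2) *(3)]]
    by (intro V.comult_cong *) (simp add: ST.lsmul_T_el sm_mult_ta dc * assms)
qed (intro linear_maps_comp[OF ST.lsmul_T_linear[OF assms(2)] comult_B_linear] | intro lin dl ta_closed assms)+

lemma comult_bimodule_map: "\<Delta> \<in> bimodule_maps K L ST.M ST.T"
  by (simp add: bimodule_maps_def comult_B_linear comult_so comult_ta)

text \<open>On u \<otimes> a \<otimes> b both sides have the target leg b in the first factor, the
  source leg a in the third and units elsewhere. What remains is coassociativity of V.\<close>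

lemma comult_coassoc_B:
  assumes X: "X \<in> carrier B"
  shows "bimod_assoc L ST.M ST.M ST.M (bimod_tensor_map L ST.T ST.M \<Delta> id (\<Delta> X)) =
    bimod_tensor_map L ST.M ST.T id \<Delta> (\<Delta> X)" (is "?f X = ?g X")
proof (rule B_eqI[of ?f _ ?g, OF _ _ ST.MT_module _ X])
  note l = ST.coassoc_left_linear[OF comult_bimodule_map]
  note r = ST.coassoc_right_linear[OF comult_bimodule_map]
  note lin3 = lin dl ST.MT_module ST.lin_MT_left ST.lin_MT_right
  show "?f \<in> linear_maps K B ST.MT"
    by (rule linear_maps_comp[OF l comult_B_linear])
  show "?g \<in> linear_maps K B ST.MT"
    by (rule linear_maps_comp[OF r comult_B_linear])
  fix u a b assume *: "u \<in> carrier V" "a \<in> carrier L" "b \<in> carrier L"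
  let ?F = "\<lambda>x y z. ST.elMT (sm x \<one>\<^sub>L b) (ST.el (sm y \<one>\<^sub>L \<one>\<^sub>L) (sm z a \<one>\<^sub>L))"
  have "?f (sm u a b) =
      lift ST.MT (\<lambda>w z. lift ST.MT (\<lambda>x y. ?F x y z) (comult V w)) (comult V u)"
    unfolding linear_comult_sm[OF l ST.MT_module *]
  proof (rule V.comult_cong[OF *(1)])
    fix w z assume wz: "w \<in> carrier V" "z \<in> carrier V"
    have z: "sm z a \<one>\<^sub>L \<in> carrier B" by (simp add: dc wz *)
    show "bimod_assoc L ST.M ST.M ST.M (bimod_tensor_map L ST.T ST.M \<Delta> id (ST.el (sm w \<one>\<^sub>L b) (sm z a \<one>\<^sub>L))) =
        lift ST.MT (\<lambda>x y. ?F x y z) (comult V w)"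
      by (subst ST.coassoc_left_el[OF comult_bimodule_map _ z], simp add: dc wz *,
          subst linear_comult_sm[OF ST.inner_linear[OF z] ST.MT_module], (simp_all add: dc wz *)[3],
          intro V.comult_cong wz ST.inner_el) (auto simp: dc wz *)
  qed
  also have "\<dots> = lift ST.MT (\<lambda>x w. lift ST.MT (\<lambda>y z. ?F x y z) (comult V w)) (comult V u)"
    by (intro V.comult_coassoc lin3 *) (auto simp: dc *)
  also have "\<dots> = ?g (sm u a b)"
    unfolding linear_comult_sm[OF r ST.MT_module *]
  proof (rule V.comult_cong[OF *(1)])
    fix x w assume xw: "x \<in> carrier V" "w \<in> carrier V"
    show "lift ST.MT (\<lambda>y z. ?F x y z) (comult V w) =
        bimod_tensor_map L ST.M ST.T id \<Delta> (ST.el (sm x \<one>\<^sub>L b) (sm w a \<one>\<^sub>L))"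
      by (subst ST.coassoc_right_el[OF comult_bimodule_map], (auto simp: dc * xw)[2],
          intro linear_comult_sm[of "\<lambda>Y. ST.elMT (sm x \<one>\<^sub>L b) Y", symmetric] lin3) (auto simp: dc * xw)
  qed
  finally show "?f (sm u a b) = ?g (sm u a b)" .
qed

text \<open>The coaction acts on V by \<open>rt\<close>, which the coproduct of V passes to the
  second factor, and the source leg sits there as well.\<close>

lemma comult_opS:
  assumes "l \<in> carrier L" "Y \<in> carrier B"
  shows "\<Delta> (opS l Y) = ST.fmult \<one>\<^bsub>B\<^esub> (so l) (\<Delta> Y)" (is "?f Y = ?g Y")
proof (rule B_eqI[of ?f _ ?g, OF _ _ ST.T_module _ assms(2)])
  fix v a b assume *: "v \<in> carrier V" "a \<in> carrier L" "b \<in> carrier L"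
  let ?F = "\<lambda>l1 l2 v1 v2. ST.el (sm v1 \<one>\<^sub>L b) (sm (rt l1 v2) (l2 \<bullet> a) \<one>\<^sub>L)"
  have "?f (sm v a b) = lift ST.T (\<lambda>l1 l2. \<Delta> (sm (rt l1 v) (l2 \<bullet> a) b)) (coact l)"
    by (intro linear_opS comult_B_linear ST.T_module assms *)
  also have "\<dots> = lift ST.T (\<lambda>l1 l2. lift ST.T (\<lambda>v1 v2. ?F l1 l2 v1 v2) (comult V v)) (coact l)"
    by (intro coact_cong assms, subst comult_sm, (auto simp: dc *)[3], intro comult_rt lin dl *) (auto simp: dc *)
  also have "\<dots> = lift ST.T (\<lambda>v1 v2. lift ST.T (\<lambda>l1 l2. ?F l1 l2 v1 v2) (coact l)) (comult V v)"
    by (intro lift_swap[OF mods(1) L_module mods(2,2)] coact_closed V.comult_closed lin dl assms *) (auto simp: dc *)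
  also have "\<dots> = lift ST.T (\<lambda>v1 v2. ST.el (sm v1 \<one>\<^sub>L b) (opS l (sm v2 a \<one>\<^sub>L))) (comult V v)"
    by (intro V.comult_cong linear_opS[of "\<lambda>y. ST.el (sm _ \<one>\<^sub>L b) y", symmetric] lin dl assms *) (auto simp: dc *)
  also have "\<dots> = ?g (sm v a b)"
    by (subst linear_comult_sm[OF ST.fmult_linear ST.T_module *], (simp_all add: dc assms)[2])
      (intro V.comult_cong *, simp add: ST.fmult_el so_mult dc * assms)
  finally show "?f (sm v a b) = ?g (sm v a b)" .
qed (intro lin dl so_closed BA.one_closed assms)+

text \<open>Likewise \<open>lt\<close> passes to the first factor, where the target leg
  sits.\<close>

lemma comult_opT:
  assumes "l \<in> carrier L" "Y \<in> carrier B"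
  shows "\<Delta> (opT l Y) = ST.fmult (ta l) \<one>\<^bsub>B\<^esub> (\<Delta> Y)" (is "?f Y = ?g Y")
proof (rule B_eqI[of ?f _ ?g, OF _ _ ST.T_module _ assms(2)])
  fix v a b assume *: "v \<in> carrier V" "a \<in> carrier L" "b \<in> carrier L"
  let ?F = "\<lambda>l1 l2 v1 v2. ST.el (sm (lt l1 v1) \<one>\<^sub>L (b \<bullet> l2)) (sm v2 a \<one>\<^sub>L)"
  have "?f (sm v a b) = lift ST.T (\<lambda>l1 l2. \<Delta> (sm (lt l1 v) a (b \<bullet> l2))) (coact l)"
    by (intro linear_opT comult_B_linear ST.T_module assms *)
  also have "\<dots> = lift ST.T (\<lambda>l1 l2. lift ST.T (\<lambda>v1 v2. ?F l1 l2 v1 v2) (comult V v)) (coact l)"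
    by (intro coact_cong assms, subst comult_sm, (auto simp: dc *)[3], intro comult_lt lin dl *) (auto simp: dc *)
  also have "\<dots> = lift ST.T (\<lambda>v1 v2. lift ST.T (\<lambda>l1 l2. ?F l1 l2 v1 v2) (coact l)) (comult V v)"
    by (intro lift_swap[OF mods(1) L_module mods(2,2)] coact_closed V.comult_closed lin dl assms *) (auto simp: dc *)
  also have "\<dots> = lift ST.T (\<lambda>v1 v2. ST.el (opT l (sm v1 \<one>\<^sub>L b)) (sm v2 a \<one>\<^sub>L)) (comult V v)"
    by (intro V.comult_cong linear_opT[of "\<lambda>y. ST.el y (sm _ a \<one>\<^sub>L)", symmetric] lin dl assms *) (auto simp: dc *)
  also have "\<dots> = ?g (sm v a b)"
    by (subst linear_comult_sm[OF ST.fmult_linear ST.T_module *], (simp_all add: dc assms)[2])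
      (intro V.comult_cong *, simp add: ST.fmult_el ta_mult dc * assms)
  finally show "?f (sm v a b) = ?g (sm v a b)" .
qed (intro lin dl ta_closed BA.one_closed assms)+

lemma sm_one_mult: "\<lbrakk>u \<in> carrier V; Y \<in> carrier B\<rbrakk> \<Longrightarrow> sm u \<one>\<^sub>L \<one>\<^sub>L \<star> Y = opV u Y"
  by (simp add: sm_mult opS_one opT_one dc)

lemma fmult_lin2 [lin]:
  assumes "f \<in> linear_maps K M B" "b \<in> carrier B" "Y \<in> carrier ST.T"
  shows "(\<lambda>x. ST.fmult (f x) b Y) \<in> linear_maps K M ST.T"
  by (rule linear_maps_comp[OF ST.fmult_linear_left assms(1)]) (use assms in auto)

lemma fmult_lin3 [lin]:
  assumes "f \<in> linear_maps K M B" "b \<in> carrier B" "Y \<in> carrier ST.T"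
  shows "(\<lambda>x. ST.fmult b (f x) Y) \<in> linear_maps K M ST.T"
  by (rule linear_maps_comp[OF ST.fmult_linear_right assms(1)]) (use assms in auto)

text \<open>The multiplicativity of the coproduct of V; the legs in L stay in place.\<close>

lemma comult_opV:
  assumes "u \<in> carrier V" "Y \<in> carrier B"
  shows "\<Delta> (opV u Y) = lift ST.T (\<lambda>u1 u2.
    ST.fmult (sm u1 \<one>\<^sub>L \<one>\<^sub>L) (sm u2 \<one>\<^sub>L \<one>\<^sub>L) (\<Delta> Y)) (comult V u)" (is "?f Y = ?g Y")
proof (rule B_eqI[of ?f _ ?g, OF _ _ ST.T_module _ assms(2)])
  show "?f \<in> linear_maps K B ST.T"
    by (intro lin dl assms)
  show "?g \<in> linear_maps K B ST.T"
    by (intro lin dl assms) (auto simp: dc comult_B_closed)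
  fix v a b assume *: "v \<in> carrier V" "a \<in> carrier L" "b \<in> carrier L"
  have "?f (sm v a b) = lift ST.T (\<lambda>u1 u2. lift ST.T (\<lambda>v1 v2.
      ST.el (sm (u1 \<otimes>\<^bsub>V\<^esub> v1) \<one>\<^sub>L b) (sm (u2 \<otimes>\<^bsub>V\<^esub> v2) a \<one>\<^sub>L)) (comult V v)) (comult V u)"
    unfolding opV_sm[OF assms(1) *] comult_sm[OF VA.m_closed[OF assms(1) *(1)] *(2,3)]
    by (intro V.comult_mult lin dl assms *) (auto simp: dc *)
  also have "\<dots> = ?g (sm v a b)"
  proof (rule V.comult_cong[OF assms(1)])
    fix u1 u2 assume u: "u1 \<in> carrier V" "u2 \<in> carrier V"
    have c: "sm u1 \<one>\<^sub>L \<one>\<^sub>L \<in> carrier B" "sm u2 \<one>\<^sub>L \<one>\<^sub>L \<in> carrier B" by (simp_all add: dc u)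
    show "lift ST.T (\<lambda>v1 v2.
      ST.el (sm (u1 \<otimes>\<^bsub>V\<^esub> v1) \<one>\<^sub>L b) (sm (u2 \<otimes>\<^bsub>V\<^esub> v2) a \<one>\<^sub>L)) (comult V v) =
      ST.fmult (sm u1 \<one>\<^sub>L \<one>\<^sub>L) (sm u2 \<one>\<^sub>L \<one>\<^sub>L) (\<Delta> (sm v a b))"
      unfolding linear_comult_sm[OF ST.fmult_linear[OF c] ST.T_module *]
      by (intro V.comult_cong *) (simp add: ST.fmult_el sm_one_mult opV_sm dc u *)
  qed
  finally show "?f (sm v a b) = ?g (sm v a b)" .
qed

text \<open>On the left, \<open>l\<close> contributes \<open>rt l1\<close> and a source leg
  \<open>l2\<close> to the first factor; on the right, \<open>lt l1\<close> and a target leg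
  \<open>l2\<close> to the second. The balancing relation moves \<open>l2\<close>, and
  \<open>comult_rt_lt\<close> moves \<open>l1\<close>.\<close>

lemma comult_takeuchi_eq:
  assumes "l \<in> carrier L" "Y \<in> carrier B"
  shows "ST.fmult (so l) \<one>\<^bsub>B\<^esub> (\<Delta> Y) = ST.fmult \<one>\<^bsub>B\<^esub> (ta l) (\<Delta> Y)" (is "?f Y = ?g Y")
proof (rule B_eqI[of ?f _ ?g, OF _ _ ST.T_module _ assms(2)])
  fix v a b assume *: "v \<in> carrier V" "a \<in> carrier L" "b \<in> carrier L"
  let ?F = "\<lambda>l2 v1 v2. ST.el (sm v1 \<one>\<^sub>L b) (sm v2 a l2)"
  \<comment> \<open>The balancing relation over L, read as right multiplication by
    \<open>so y\<close> on one side and by \<open>ta y\<close> on the other.\<close>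
  have move: "ST.el (sm x (y \<bullet> \<one>\<^sub>L) b) (sm z a \<one>\<^sub>L) = ?F y x z"
    if "x \<in> carrier V" "y \<in> carrier L" "z \<in> carrier V" for x y z
    using ST.el_balanced[of "sm x \<one>\<^sub>L b" y "sm z a \<one>\<^sub>L"] that
    by (simp add: sm_mult_so sm_mult_ta dc *)
  have "?f (sm v a b) = lift ST.T (\<lambda>v1 v2. ST.el (opS l (sm v1 \<one>\<^sub>L b)) (sm v2 a \<one>\<^sub>L)) (comult V v)"
    by (subst linear_comult_sm[OF ST.fmult_linear ST.T_module *], (simp_all add: dc assms)[2])
      (intro V.comult_cong *, simp add: ST.fmult_el so_mult dc * assms)
  also have "\<dots> = lift ST.T (\<lambda>v1 v2. lift ST.T (\<lambda>l1 l2.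
      ST.el (sm (rt l1 v1) (l2 \<bullet> \<one>\<^sub>L) b) (sm v2 a \<one>\<^sub>L)) (coact l)) (comult V v)"
    by (intro V.comult_cong linear_opS[of "\<lambda>y. ST.el y _"] lin dl assms *) (auto simp: dc *)
  also have "\<dots> = lift ST.T (\<lambda>v1 v2. lift ST.T (\<lambda>l1 l2. ?F l2 (rt l1 v1) v2) (coact l)) (comult V v)"
    by (intro V.comult_cong coact_cong assms * move) (auto simp: dc)
  also have "\<dots> = lift ST.T (\<lambda>l1 l2. lift ST.T (\<lambda>v1 v2. ?F l2 (rt l1 v1) v2) (comult V v)) (coact l)"
    by (intro lift_swap[OF mods(2,2) mods(1) L_module] coact_closed V.comult_closed lin dl assms *) (auto simp: dc *)
  \<comment> \<open>The action of \<open>l1\<close> changes sides here; the interchanges before and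
    after make the coproduct of \<open>v\<close> the inner sum, as that rule requires.\<close>
  also have "\<dots> = lift ST.T (\<lambda>l1 l2. lift ST.T (\<lambda>v1 v2. ?F l2 v1 (lt l1 v2)) (comult V v)) (coact l)"
    by (intro coact_cong assms comult_rt_lt[of ST.T "?F _"] lin dl *) (auto simp: dc *)
  also have "\<dots> = lift ST.T (\<lambda>v1 v2. lift ST.T (\<lambda>l1 l2. ?F l2 v1 (lt l1 v2)) (coact l)) (comult V v)"
    by (intro lift_swap[OF mods(1) L_module mods(2,2)] coact_closed V.comult_closed lin dl assms *) (auto simp: dc *)
  also have "\<dots> = lift ST.T (\<lambda>v1 v2. ST.el (sm v1 \<one>\<^sub>L b) (opT l (sm v2 a \<one>\<^sub>L))) (comult V v)"
    by (intro V.comult_cong *, subst linear_opT[of "\<lambda>y. ST.el _ y" ST.T], (intro lin dl assms | simp add: dc *)+,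
        intro coact_cong assms) simp
  also have "\<dots> = ?g (sm v a b)"
    by (subst linear_comult_sm[OF ST.fmult_linear ST.T_module *], (simp_all add: dc assms)[2])
      (intro V.comult_cong *, simp add: ST.fmult_el ta_mult dc * assms)
  finally show "?f (sm v a b) = ?g (sm v a b)" .
qed (intro lin dl so_closed ta_closed BA.one_closed assms)+

section \<open>The coproduct is an algebra homomorphism into the Takeuchi product\<close>

lemma comult_takeuchi: "Y \<in> carrier B \<Longrightarrow> \<Delta> Y \<in> carrier ST.R"
  by (simp add: ST.takeuchi_iff comult_B_closed comult_takeuchi_eq)

text \<open>For elementary \<open>X\<close>, left multiplication is \<open>opV u\<close>,
  \<open>opS l\<close>, \<open>opT m\<close>, and each passes through \<Delta> as a factorwise
  multiplication.\<close>

lemma comult_B_mult: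
  assumes X: "X \<in> carrier B" and Y: "Y \<in> carrier B"
  shows "\<Delta> (X \<star> Y) = \<Delta> X \<otimes>\<^bsub>ST.R\<^esub> \<Delta> Y" (is "?f X = ?g X")
proof (rule B_eqI[of ?f _ ?g, OF _ _ ST.T_module _ X])
  \<comment> \<open>The summands of \<open>\<Delta> X\<close> need not be Takeuchi elements one by
    one, so right multiplication by \<open>\<Delta> Y\<close> must be linear on all of
    \<open>ST.T\<close>.\<close>
  note r = ST.takeuchi_linear_left[OF comult_takeuchi[OF Y]]
  show "?f \<in> linear_maps K B ST.T"
    by (intro lin dl Y)
  show "?g \<in> linear_maps K B ST.T"
    by (rule linear_maps_comp[OF r comult_B_linear])
  fix u l m assume *: "u \<in> carrier V" "l \<in> carrier L" "m \<in> carrier L"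
  have "?f (sm u l m) = lift ST.T (\<lambda>u1 u2. ST.fmult (sm u1 \<one>\<^sub>L \<one>\<^sub>L) (sm u2 \<one>\<^sub>L \<one>\<^sub>L)
      (ST.fmult \<one>\<^bsub>B\<^esub> (so l) (ST.fmult (ta m) \<one>\<^bsub>B\<^esub> (\<Delta> Y)))) (comult V u)"
    by (simp add: sm_mult comult_opV comult_opS comult_opT dc * Y)
  \<comment> \<open>The first factors combine to \<open>sm u1 \<one>\<^sub>L m\<close> by
    \<open>ta m\<close>, the second to \<open>sm u2 l \<one>\<^sub>L\<close> by \<open>so l\<close>:
    these are the legs of the coproduct of \<open>sm u l m\<close>.\<close>
  also have "\<dots> = lift ST.T (\<lambda>u1 u2. ST.fmult (sm u1 \<one>\<^sub>L m) (sm u2 l \<one>\<^sub>L) (\<Delta> Y)) (comult V u)"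
    by (intro V.comult_cong *)
      (simp add: ST.fmult_fmult sm_mult_so sm_mult_ta comult_B_closed dc * Y)
  also have "\<dots> = ?g (sm u l m)"
    unfolding linear_comult_sm[OF r ST.T_module *]
    by (intro V.comult_cong *) (simp add: ST.takeuchi_mult_el comult_takeuchi dc * Y)
  finally show "?f (sm u l m) = ?g (sm u l m)" .
qed

lemma comult_B_one: "\<Delta> \<one>\<^bsub>B\<^esub> = \<one>\<^bsub>ST.R\<^esub>"
  unfolding B_one comult_sm[OF VA.one_closed LA.one_closed LA.one_closed] ST.takeuchi_simps
  by (intro V.comult_one lin dl) (auto simp: dc)

lemma comult_hom_B: "\<Delta> \<in> algebra_homs K B ST.R"
proof -
  \<comment> \<open>The Takeuchi product carries the module operations of \<open>ST.T\<close> on a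
    smaller carrier.\<close>
  have "linear_maps K B ST.R = {f \<in> linear_maps K B ST.T. \<forall>x\<in>carrier B. f x \<in> carrier ST.R}"
    using ST.takeuchi_iff by (auto simp: linear_maps_def hom_def ST.takeuchi_simps Pi_iff)
  then show ?thesis
    by (auto simp: algebra_homs_def comult_B_linear comult_takeuchi comult_B_mult comult_B_one
        ST.takeuchi_simps(1) linear_maps_add[OF comult_B_linear] intro!: ring_hom_memI)
qed

section \<open>The counit\<close>

lemma counit_B_linear: "\<epsilon> \<in> linear_maps K B L"
  unfolding smash_counit_def by (intro lin dl) (auto simp: dc)

lemma lin_counit_B [lin]: "f \<in> linear_maps K M B \<Longrightarrow> (\<lambda>x. \<epsilon> (f x)) \<in> linear_maps K M L"
  by (rule linear_maps_comp[OF counit_B_linear])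

lemma counit_B_closed: "X \<in> carrier B \<Longrightarrow> \<epsilon> X \<in> carrier L"
  by (rule linear_maps_closed[OF counit_B_linear])

lemma counit_sm:
  assumes "u \<in> carrier V" "l \<in> carrier L" "m \<in> carrier L"
  shows "\<epsilon> (sm u l m) = counit V u \<odot>\<^bsub>L\<^esub> (m \<bullet> l)"
  unfolding smash_counit_def by (intro triple_lift_sm lin dl assms) (auto simp: dc)

lemma lin_so [lin]: "f \<in> linear_maps K M L \<Longrightarrow> (\<lambda>x. so (f x)) \<in> linear_maps K M B"
  by (rule linear_maps_comp[OF ST.s_linear])

lemma lin_ta [lin]: "f \<in> linear_maps K M L \<Longrightarrow> (\<lambda>x. ta (f x)) \<in> linear_maps K M B"
  by (rule linear_maps_comp[OF ST.t_linear])

lemmas ec = dc counit_B_closed LA.smult_closed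

text \<open>In the value m l of the counit the source leg stands last, so it absorbs right
  multiplication; the target leg stands first and, in the next lemma, absorbs left
  multiplication.\<close>

lemma counit_so:
  assumes "X \<in> carrier B" "l \<in> carrier L"
  shows "\<epsilon> (X \<star> so l) = \<epsilon> X \<bullet> l" (is "?f X = ?g X")
  by (rule B_eqI[of ?f L ?g, OF _ _ L_module _ assms(1)])
    (intro lin dl so_closed assms |
      simp add: sm_mult_so counit_sm ec assms LA.smult_mult_left LA.m_assoc)+

lemma counit_ta:
  assumes "X \<in> carrier B" "l \<in> carrier L"
  shows "\<epsilon> (X \<star> ta l) = l \<bullet> \<epsilon> X" (is "?f X = ?g X")
  by (rule B_eqI[of ?f L ?g, OF _ _ L_module _ assms(1)])
    (intro lin dl ta_closed assms |
      simp add: sm_mult_ta counit_sm ec assms LA.smult_mult_right LA.m_assoc)+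

lemma counit_bimodule_map: "\<epsilon> \<in> bimodule_maps K L ST.M (regular_bimodule L)"
proof -
  have "linear_maps K B (regular_bimodule L) = linear_maps K B L"
    by (rule linear_maps_transfer) simp_all
  then show ?thesis
    by (simp add: bimodule_maps_def counit_B_linear counit_so counit_ta)
qed

lemma counit_B_one: "\<epsilon> \<one>\<^bsub>B\<^esub> = \<one>\<^sub>L"
  by (simp add: B_one counit_sm ec V.counit_one)

lemma counit_opS_sm:
  assumes "l \<in> carrier L" "v \<in> carrier V" "a \<in> carrier L" "b \<in> carrier L"
  shows "\<epsilon> (opS l (sm v a b)) =
    lift L (\<lambda>h x. pair h v \<odot>\<^bsub>L\<^esub> (b \<bullet> (x \<bullet> a))) (coact l)"
proof -
  have "\<epsilon> (opS l (sm v a b)) = lift L (\<lambda>h x. \<epsilon> (sm (rt h v) (x \<bullet> a) b)) (coact l)"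
    by (intro linear_opS counit_B_linear lin dl assms)
  also have "\<dots> = lift L (\<lambda>h x. pair h v \<odot>\<^bsub>L\<^esub> (b \<bullet> (x \<bullet> a))) (coact l)"
    by (intro coact_cong assms) (simp add: counit_sm counit_rt ec assms)
  finally show ?thesis .
qed

text \<open>The counit of V sends both \<open>rt h v\<close> and \<open>lt h v\<close> to
  \<langle>h, v\<rangle>, and the leg \<open>x\<close> lands between \<open>b\<close> and
  \<open>a\<close> in either case.\<close>

lemma counit_opT_sm:
  assumes "l \<in> carrier L" "v \<in> carrier V" "a \<in> carrier L" "b \<in> carrier L"
  shows "\<epsilon> (opT l (sm v a b)) = \<epsilon> (opS l (sm v a b))"
proof -
  have "\<epsilon> (opT l (sm v a b)) = lift L (\<lambda>h x. \<epsilon> (sm (lt h v) a (b \<bullet> x))) (coact l)"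
    by (intro linear_opT counit_B_linear lin dl assms)
  also have "\<dots> = lift L (\<lambda>h x. pair h v \<odot>\<^bsub>L\<^esub> (b \<bullet> (x \<bullet> a))) (coact l)"
    by (intro coact_cong assms) (simp add: counit_sm counit_lt ec assms LA.m_assoc)
  finally show ?thesis by (simp add: counit_opS_sm assms)
qed

lemma counit_opT_opS:
  assumes "l \<in> carrier L" "Y \<in> carrier B"
  shows "\<epsilon> (opT l Y) = \<epsilon> (opS l Y)"
  by (rule B_eqI[of "\<lambda>Y. \<epsilon> (opT l Y)" L "\<lambda>Y. \<epsilon> (opS l Y)", OF _ _ L_module _ assms(2)])
    (intro lin dl assms | simp add: counit_opT_sm assms)+

text \<open>On elementary arguments both sides are the sum of \<epsilon>(u) \<langle>m1 l1,
  v\<rangle> d m2 l2 c. The order m l in the counit fits the order in which the two actions compose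
  under the pairing.\<close>

lemma counit_opS:
  assumes a: "a \<in> carrier B" and b: "b \<in> carrier B"
  shows "\<epsilon> (opS (\<epsilon> a) b) = \<epsilon> (a \<star> b)" (is "?f a = ?g a")
proof (rule B_eqI[of ?f L ?g, OF _ _ L_module _ a])
  fix u l m assume *: "u \<in> carrier V" "l \<in> carrier L" "m \<in> carrier L"
  show "?f (sm u l m) = ?g (sm u l m)" (is "?p b = ?q b")
  proof (rule B_eqI[of ?p L ?q, OF _ _ L_module _ b])
    fix v c d assume vcd: "v \<in> carrier V" "c \<in> carrier L" "d \<in> carrier L"
    let ?F = "\<lambda>m1 m2 l1 l2. counit V u \<odot>\<^bsub>L\<^esub> (pair (m1 \<otimes>\<^bsub>H\<^esub> l1) v \<odot>\<^bsub>L\<^esub> (d \<bullet> ((m2 \<bullet> l2) \<bullet> c)))"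
    have "?p (sm v c d) = counit V u \<odot>\<^bsub>L\<^esub> \<epsilon> (opS (m \<bullet> l) (sm v c d))"
    proof -
      \<comment> \<open>The counit of u \<otimes> l \<otimes> m carries the scalar \<epsilon>(u),
        which linearity in the source argument pulls out.\<close>
      have "(\<lambda>x. \<epsilon> (opS x (sm v c d))) \<in> linear_maps K L L"
        by (intro lin dl) (simp add: ec vcd)
      from linear_maps_smult[OF this V.counit_closed[OF *(1)] LA.m_closed[OF *(3,2)]]
      show ?thesis by (simp add: counit_sm *)
    qed
    also have "\<epsilon> (opS (m \<bullet> l) (sm v c d)) = lift L (\<lambda>m1 m2. lift L (\<lambda>l1 l2.
        pair (m1 \<otimes>\<^bsub>H\<^esub> l1) v \<odot>\<^bsub>L\<^esub> (d \<bullet> ((m2 \<bullet> l2) \<bullet> c))) (coact l)) (coact m)"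
      unfolding counit_opS_sm[OF LA.m_closed[OF *(3,2)] vcd]
      by (intro coact_mult lin dl *) (auto simp: ec vcd)
    also have "counit V u \<odot>\<^bsub>L\<^esub> \<dots> = lift L (\<lambda>m1 m2. lift L (\<lambda>l1 l2. ?F m1 m2 l1 l2) (coact l)) (coact m)"
      by (intro linear_lift2[of K H L H L L L "\<lambda>y. counit V u \<odot>\<^bsub>L\<^esub> y"] coact_closed lin dl *) (auto simp: ec * vcd)
    also have "\<dots> = lift L (\<lambda>l1 l2. lift L (\<lambda>m1 m2. ?F m1 m2 l1 l2) (coact m)) (coact l)"
      by (intro coact_swap lin dl *) (auto simp: ec * vcd)
    \<comment> \<open>The counit turns \<open>rt l1\<close> into pairing with \<open>l1\<close>;
      then \<open>pair_lt\<close> multiplies by \<open>m1\<close> from the left, giving the H-leg of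
      the coaction on \<open>m \<bullet> l\<close>.\<close>
    also have "\<dots> = lift L (\<lambda>l1 l2. lift L (\<lambda>m1 m2.
        \<epsilon> (sm (u \<otimes>\<^bsub>V\<^esub> rt l1 (lt m1 v)) (l2 \<bullet> c) (d \<bullet> m2))) (coact m)) (coact l)"
      by (intro coact_cong *)
        (simp add: counit_sm ec * vcd V.counit_mult counit_rt pair_lt LA.m_assoc LA.smult_assoc1)
    also have "\<dots> = ?q (sm v c d)"
      unfolding sm_mult_sm[OF * vcd]
      by (intro linear_lift2[of K H L H L B L \<epsilon>, symmetric] counit_B_linear coact_closed lin dl *)
        (auto simp: ec * vcd)
    finally show "?p (sm v c d) = ?q (sm v c d)" .
  qed (intro lin dl ec *)+
qed (intro lin dl b)+

text \<open>The counit of u1 \<otimes> 1 \<otimes> m is \<epsilon>(u1) m, and right multiplication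
  by its target restores the leg m in the other factor.\<close>

lemma counit_left_B:
  assumes X: "X \<in> carrier B"
  shows "lift B (\<lambda>b c. c \<star> ta (\<epsilon> b)) (\<Delta> X) = X" (is "?f (\<Delta> X) = X")
proof -
  have ta_mult': "ta (l \<bullet> m) = ta m \<star> ta l" if "l \<in> carrier L" "m \<in> carrier L" for l m
    using ta_hom that by (auto simp: algebra_homs_def ring_hom_def)
  \<comment> \<open>Balance uses that t reverses products: the target of \<epsilon>(b) l is t(l)
    t(\<epsilon>(b)), and t(l) is the action on c.\<close>
  have bal: "bimod_balanced K L ST.M ST.M B (\<lambda>b c. c \<star> ta (\<epsilon> b))"
    by (intro bimod_balancedI) (auto intro!: lin dl simp: ec counit_so ta_mult' BA.m_assoc)
  note l = bimod_lift_linear[OF ST.MM B_module bal]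
  show ?thesis
  proof (rule op_eqI[of "\<lambda>X. ?f (\<Delta> X)" "\<lambda>X. X", OF linear_maps_comp[OF l comult_B_linear] linear_maps_id X])
    fix u a b assume *: "u \<in> carrier V" "a \<in> carrier L" "b \<in> carrier L"
    have "?f (\<Delta> (sm u a b)) = lift B (\<lambda>u1 u2. counit V u1 \<odot>\<^bsub>B\<^esub> sm u2 a b) (comult V u)"
      unfolding linear_comult_sm[OF l B_module *]
      by (intro V.comult_cong *, subst bimod_lift_elem[OF ST.MM B_module bal])
        (simp_all add: ec * counit_sm linear_maps_smult[OF ST.t_linear] BA.smult_mult_right sm_mult_ta)
    also have "\<dots> = sm u a b"
      by (intro V.comult_counit_left lin dl *)
    finally show "?f (\<Delta> (sm u a b)) = sm u a b" .
  qed
qed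

lemma counit_right_B:
  assumes X: "X \<in> carrier B"
  shows "lift B (\<lambda>b c. b \<star> so (\<epsilon> c)) (\<Delta> X) = X" (is "?f (\<Delta> X) = X")
proof -
  have so_mult': "so (l \<bullet> m) = so l \<star> so m" if "l \<in> carrier L" "m \<in> carrier L" for l m
    using so_hom that by (auto simp: algebra_homs_def ring_hom_def)
  \<comment> \<open>Here \<epsilon>(c t(l)) = l \<epsilon>(c), and s keeps the order, so s(l)
    appears next to b.\<close>
  have bal: "bimod_balanced K L ST.M ST.M B (\<lambda>b c. b \<star> so (\<epsilon> c))"
    by (intro bimod_balancedI) (auto intro!: lin dl simp: ec counit_ta so_mult' BA.m_assoc)
  note l = bimod_lift_linear[OF ST.MM B_module bal]
  show ?thesis
  proof (rule op_eqI[of "\<lambda>X. ?f (\<Delta> X)" "\<lambda>X. X", OF linear_maps_comp[OF l comult_B_linear] linear_maps_id X])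
    fix u a b assume *: "u \<in> carrier V" "a \<in> carrier L" "b \<in> carrier L"
    have "?f (\<Delta> (sm u a b)) = lift B (\<lambda>u1 u2. counit V u2 \<odot>\<^bsub>B\<^esub> sm u1 a b) (comult V u)"
      unfolding linear_comult_sm[OF l B_module *]
      by (intro V.comult_cong *, subst bimod_lift_elem[OF ST.MM B_module bal])
        (simp_all add: ec * counit_sm linear_maps_smult[OF ST.s_linear] BA.smult_mult_right sm_mult_so)
    also have "\<dots> = sm u a b"
      by (intro V.comult_counit_right lin dl *)
    finally show "?f (\<Delta> (sm u a b)) = sm u a b" .
  qed
qed

theorem smash_right_bialgebroid: "right_bialgebroid K L B so ta \<Delta> \<epsilon>"
proof (rule right_bialgebroid.intro)
  fix a b assume ab: "a \<in> carrier B" "b \<in> carrier B"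
  show "\<epsilon> (so (\<epsilon> a) \<star> b) = \<epsilon> (a \<star> b)"
    by (simp add: so_mult counit_B_closed counit_opS ab)
  show "\<epsilon> (ta (\<epsilon> a) \<star> b) = \<epsilon> (a \<star> b)"
    by (simp add: ta_mult counit_B_closed counit_opS counit_opT_opS ab)
qed (simp_all add: L_algebra B_algebra so_hom ta_hom so_ta_commute comult_bimodule_map comult_coassoc_B
    comult_hom_B counit_bimodule_map counit_B_one counit_left_B counit_right_B)

end

section \<open>Restriction of the pairing to the Hopf subalgebra, and the theorem\<close>

lemma smash_dataI:
  fixes H U :: "('k, 'u) hopf" and V :: "('k, 'v) hopf" and L :: "('k, 'l) module"
  assumes "nondegenerate_hopf_pairing K U V pair" and "hopf_subalgebra K H U"
    and "base_algebra K H L act coact"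
  shows "smash_data K H V L pair coact"
proof -
  interpret UV: nondegenerate_hopf_pairing K U V pair by fact
  interpret HU: hopf_subalgebra K H U by fact
  interpret HL: base_algebra K H L act coact by fact
  have id_lin: "(\<lambda>x. x) \<in> linear_maps K H U" and id_ring: "id \<in> ring_hom H U"
    using HU.inclusion_hom by (auto simp: algebra_homs_def id_def)
  have sub: "x \<in> carrier U" if "x \<in> carrier H" for x
    using HU.subset that by auto
  have lin_left: "(\<lambda>x. pair x u) \<in> linear_maps K H (ground_algebra K)" if "u \<in> carrier V" for u
    using linear_maps_comp[OF bilinear_map_left[OF UV.bilinear that] id_lin] .
  have pair_prod: "bilinear_map K U U (ground_algebra K) (\<lambda>x1 x2. pair x1 u \<otimes>\<^bsub>K\<^esub> pair x2 v)"
    if "u \<in> carrier V" "v \<in> carrier V" for u v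
  proof -
    interpret K: assoc_algebra K U by (rule UV.U.assoc_algebra)
    show ?thesis
      using bilinear_map_closed[OF UV.bilinear] bilinear_map_left[OF UV.bilinear] that
      by (intro bilinear_mapI lin_ground_mult_left lin_ground_mult_right K.is_cring) auto
  qed
  \<comment> \<open>The coproducts of \<open>x\<close> in H and in U are cosets for different
    relations; \<open>id \<otimes> id\<close> carries one to the other, and a lift composed with it
    is the lift over H.\<close>
  have mult_right: "pair x (u \<otimes>\<^bsub>V\<^esub> v) = lift K (\<lambda>x1 x2. pair x1 u \<otimes>\<^bsub>K\<^esub> pair x2 v) (comult H x)"
    if "x \<in> carrier H" "u \<in> carrier V" "v \<in> carrier V" for x u v
  proof -
    have "lift (ground_algebra K) (\<lambda>x1 x2. pair x1 u \<otimes>\<^bsub>K\<^esub> pair x2 v) (tensor_map K U U id id (comult H x)) =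
        lift (ground_algebra K) (\<lambda>x1 x2. pair (id x1) u \<otimes>\<^bsub>K\<^esub> pair (id x2) v) (comult H x)"
      by (rule lift_tensor_map[OF HU.H.hopf_module HU.H.hopf_module UV.U.hopf_module UV.U.hopf_module
            UV.U.ground _ _ pair_prod[OF that(2,3)] HU.H.comult_closed[OF that(1)]])
        (use id_lin in \<open>simp_all add: id_def\<close>)
    then show ?thesis
      using UV.pair_mult_right[OF sub[OF that(1)] that(2,3)] HU.inclusion_comult[OF that(1)]
      by (simp add: tensor_lift_ground)
  qed
  show ?thesis
  proof (intro smash_data.intro comodule_algebra.intro
      bialgebra_pairing.intro bialgebra_pairing_axioms.intro)
    show "bilinear_map K H V (ground_algebra K) pair"
      using lin_left bilinear_map_right[OF UV.bilinear] sub by (auto intro: bilinear_mapI)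
    show "pair (x \<otimes>\<^bsub>H\<^esub> y) u = lift K (\<lambda>u1 u2. pair x u1 \<otimes>\<^bsub>K\<^esub> pair y u2) (comult V u)"
      if "x \<in> carrier H" "y \<in> carrier H" "u \<in> carrier V" for x y u
      using UV.pair_mult_left[OF sub[OF that(1)] sub[OF that(2)] that(3)] that id_ring
      by (simp add: ring_hom_def)
    show "pair \<one>\<^bsub>H\<^esub> u = counit V u" if "u \<in> carrier V" for u
      using UV.pair_one_left[OF that] id_ring by (simp add: ring_hom_def)
    show "pair x \<one>\<^bsub>V\<^esub> = counit H x" if "x \<in> carrier H" for x
      using UV.pair_one_right[OF sub[OF that]] HU.inclusion_counit[OF that] by simp
  qed (use HU.H.hopf_algebra_axioms HU.H.assoc_algebra HU.H.comult_linear HU.H.counit_linear UV.V.hopf_algebra_axioms HL.L_algebra HL.coact_hom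
      HL.coact_coassoc HL.coact_counit mult_right in auto)
qed

theorem proposition8p4:
  fixes K :: "'k ring"
    and U H :: "('k, 'u) hopf"
    and V :: "('k, 'v) hopf"
    and L :: "('k, 'l) module"
    and pair :: "'u \<Rightarrow> 'v \<Rightarrow> 'k"
    and act :: "'u \<Rightarrow> 'l \<Rightarrow> 'l"
    and coact :: "'l \<Rightarrow> ('u, 'l) tens"
  assumes "ground_ring K"
    and "nondegenerate_hopf_pairing K U V pair"
    and "hopf_subalgebra K H U"
    and "base_algebra K H L act coact"
  shows "(\<forall>u\<in>carrier V. \<forall>l\<in>carrier L. \<forall>m\<in>carrier L.
            \<forall>v\<in>carrier V. \<forall>a\<in>carrier L. \<forall>b\<in>carrier L.
            smash_elem K V L u l m \<otimes>\<^bsub>smash_algebra K V L pair coact\<^esub> smash_elem K V L v a b =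
            tensor_lift (smash_algebra K V L pair coact) (\<lambda>l1 l2.
              tensor_lift (smash_algebra K V L pair coact) (\<lambda>m1 m2.
                smash_elem K V L
                  (u \<otimes>\<^bsub>V\<^esub> dual_act V pair l1 (dual_act_op V pair m1 v))
                  (l2 \<otimes>\<^bsub>L\<^esub> a)
                  (m2 \<otimes>\<^bsub>opposite L\<^esub> b))
              (coact m))
            (coact l))
       \<and> (\<forall>u\<in>carrier V. \<forall>l\<in>carrier L. \<forall>m\<in>carrier L.
            smash_comult K V L pair coact (smash_elem K V L u l m) =
              smash_comult_elem K V L pair coact u l m
          \<and> smash_counit V L (smash_elem K V L u l m) = counit V u \<odot>\<^bsub>L\<^esub> (m \<otimes>\<^bsub>L\<^esub> l))
       \<and> right_bialgebroid K L (smash_algebra K V L pair coact)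
            (smash_source K V L) (smash_target K V L)
            (smash_comult K V L pair coact) (smash_counit V L)"
proof -
  interpret smash_data K H V L pair coact
    using assms(2-4) by (rule smash_dataI)
  show ?thesis
    \<comment> \<open>The product of \<open>m2\<close> and \<open>b\<close> in the opposite algebra
      simplifies to \<open>b \<bullet> m2\<close>, the form in which the operators were
      computed.\<close>
    by (simp add: sm_mult_sm comult_sm' counit_sm smash_right_bialgebroid)
qed

end
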